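(* The structure group $G_X$ of a finite nondegenerate symmetric set $(X,S)$ is solvable.
   Context: Let $X$ be a nonempty set and $S:X\times X\to X\times X$ a bijection, $S(x,y)=(g_x(y),f_y(x))$. $(X,S)$ is nondegenerate if all maps $f_y,g_x:X\to X$ are bijections; braided if $S^{12}S^{23}S^{12}=S^{23}S^{12}S^{23}$ on $X^3$ (with $S^{12}=S\times\mathrm{id}$, $S^{23}=\mathrm{id}\times S$); involutive if $S^2=\mathrm{id}$; symmetric if braided and involutive. The structure group $G_X$ is the group generated by the elements of $X$ with defining relations $xy=tz$ whenever $S(x,y)=(t,z)$. *)

theory Defs
  imports "HOL-Algebra.Solvable_Groups"
begin

section \<open>Groups given by generators and relations\<close>

text \<open>
  A word over the generators \<open>X\<close> is a list of letters \<open>(x, e)\<close> with \<open>x \<in> X\<close>, where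
  \<open>(x, True)\<close> stands for \<open>x\<close> and \<open>(x, False)\<close> for its formal inverse.
\<close>

definition group_words :: "'a set \<Rightarrow> ('a \<times> bool) list set" where
  "group_words X = lists (X \<times> UNIV)"

text \<open>
  The least congruence on the monoid of words that contains the pairs in \<open>R\<close> and makes
  \<open>(x, True)\<close> and \<open>(x, False)\<close> inverse to each other. A pair \<open>(u, v) \<in> R\<close> is the
  relation \<open>u = v\<close>.
\<close>

inductive_set pres_cong ::
    "'a set \<Rightarrow> (('a \<times> bool) list \<times> ('a \<times> bool) list) set
      \<Rightarrow> (('a \<times> bool) list \<times> ('a \<times> bool) list) set"
  for X R where
    rel: "(u, v) \<in> R \<Longrightarrow> (u, v) \<in> pres_cong X R"
  | cancel: "x \<in> X \<Longrightarrow> ([(x, e), (x, \<not> e)], []) \<in> pres_cong X R"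
  | refl: "w \<in> group_words X \<Longrightarrow> (w, w) \<in> pres_cong X R"
  | sym: "(u, v) \<in> pres_cong X R \<Longrightarrow> (v, u) \<in> pres_cong X R"
  | trans: "(u, v) \<in> pres_cong X R \<Longrightarrow> (v, w) \<in> pres_cong X R \<Longrightarrow> (u, w) \<in> pres_cong X R"
  | append: "(u, v) \<in> pres_cong X R \<Longrightarrow> (u', v') \<in> pres_cong X R
      \<Longrightarrow> (u @ u', v @ v') \<in> pres_cong X R"

text \<open>The relations \<open>R\<close> are meant to be pairs of elements of \<^term>\<open>group_words X\<close>.\<close>

definition presented_group ::
    "'a set \<Rightarrow> (('a \<times> bool) list \<times> ('a \<times> bool) list) set \<Rightarrow> ('a \<times> bool) list set monoid" where
  "presented_group X R =
    \<lparr> carrier = group_words X // pres_cong X R,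
      mult = (\<lambda>A B. \<Union>u\<in>A. \<Union>v\<in>B. pres_cong X R `` {u @ v}),
      one = pres_cong X R `` {[]} \<rparr>"

lemma pres_cong_words:
  assumes "R \<subseteq> group_words X \<times> group_words X" "(u, v) \<in> pres_cong X R"
  shows "u \<in> group_words X \<and> v \<in> group_words X"
  using assms(2) assms(1) by induction (auto simp: group_words_def)

lemma equiv_pres_cong:
  assumes "R \<subseteq> group_words X \<times> group_words X"
  shows "equiv (group_words X) (pres_cong X R)"
proof (rule equivI)
  show "pres_cong X R \<subseteq> group_words X \<times> group_words X"
    using pres_cong_words[OF assms] by auto
  show "refl_on (group_words X) (pres_cong X R)"
    by (auto simp: refl_on_def intro: pres_cong.refl)
  show "sym (pres_cong X R)"
    by (rule symI) (rule pres_cong.sym)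
  show "trans (pres_cong X R)"
    by (rule transI) (rule pres_cong.trans)
qed

lemma presented_group_mult:
  assumes R: "R \<subseteq> group_words X \<times> group_words X"
    and u: "u \<in> group_words X" and v: "v \<in> group_words X"
  shows "(pres_cong X R `` {u}) \<otimes>\<^bsub>presented_group X R\<^esub> (pres_cong X R `` {v})
    = pres_cong X R `` {u @ v}"
proof -
  have eq: "pres_cong X R `` {u' @ v'} = pres_cong X R `` {u @ v}"
    if "(u, u') \<in> pres_cong X R" "(v, v') \<in> pres_cong X R" for u' v'
    using equiv_class_eq[OF equiv_pres_cong[OF R] pres_cong.append[OF that]] by simp
  let ?A = "pres_cong X R `` {u}" and ?B = "pres_cong X R `` {v}"
  have "(\<Union>u'\<in>?A. \<Union>v'\<in>?B. pres_cong X R `` {u' @ v'})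
      = (\<Union>u'\<in>?A. \<Union>v'\<in>?B. pres_cong X R `` {u @ v})"
    by (intro SUP_cong HOL.refl eq) simp_all
  also have "\<dots> = pres_cong X R `` {u @ v}"
  proof -
    have "u \<in> ?A" "v \<in> ?B"
      using pres_cong.refl[OF u] pres_cong.refl[OF v] by simp_all
    then have "?A \<noteq> {}" "?B \<noteq> {}" by (metis empty_iff)+
    then show ?thesis by (simp only: UN_constant if_False)
  qed
  finally show ?thesis
    by (simp add: presented_group_def)
qed

lemma word_inverse_cong:
  assumes "w \<in> group_words X"
  shows "(rev (map (\<lambda>(x, e). (x, \<not> e)) w) @ w, []) \<in> pres_cong X R"
  using assms
proof (induction w)
  case Nil
  show ?case using pres_cong.refl[OF Nil.prems] by simp
next
  case (Cons a w)
  obtain x e where a: "a = (x, e)" by force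
  have x: "x \<in> X" and w: "w \<in> group_words X"
    using Cons.prems a by (auto simp: group_words_def)
  let ?r = "rev (map (\<lambda>(x, e). (x, \<not> e)) w)"
  have r: "?r \<in> group_words X"
    using w by (auto simp: group_words_def in_lists_conv_set)
  have "([(x, \<not> e), (x, e)] @ w, [] @ w) \<in> pres_cong X R"
    using pres_cong.append[OF pres_cong.cancel[OF x, of "\<not> e" R] pres_cong.refl[OF w]] by simp
  from pres_cong.append[OF pres_cong.refl[OF r] this]
  have "(?r @ [(x, \<not> e), (x, e)] @ w, ?r @ w) \<in> pres_cong X R" by simp
  from pres_cong.trans[OF this Cons.IH[OF w]] show ?case
    by (simp add: a)
qed

lemma group_presented_group:
  assumes R: "R \<subseteq> group_words X \<times> group_words X"
  shows "group (presented_group X R)"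
proof -
  let ?G = "presented_group X R"
  note m = presented_group_mult[OF R]
  have app: "u @ v \<in> group_words X" if "u \<in> group_words X" "v \<in> group_words X" for u v
    using that by (simp add: group_words_def)
  have nil: "[] \<in> group_words X" by (simp add: group_words_def)
  have one: "\<one>\<^bsub>?G\<^esub> = pres_cong X R `` {[]}"
    by (simp add: presented_group_def)
  have inC: "pres_cong X R `` {u} \<in> carrier ?G" if "u \<in> group_words X" for u
    using that by (auto simp: presented_group_def intro: quotientI)
  have C: "\<exists>u\<in>group_words X. A = pres_cong X R `` {u}" if "A \<in> carrier ?G" for A
    using that by (auto simp: presented_group_def elim: quotientE)
  show ?thesis
  proof (rule groupI)
    fix A B assume "A \<in> carrier ?G" "B \<in> carrier ?G"
    then show "A \<otimes>\<^bsub>?G\<^esub> B \<in> carrier ?G"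
      using C[of A] C[of B] by (auto simp: m intro!: inC app)
  next
    show "\<one>\<^bsub>?G\<^esub> \<in> carrier ?G" using inC nil one by simp
  next
    fix A B D assume "A \<in> carrier ?G" "B \<in> carrier ?G" "D \<in> carrier ?G"
    then obtain u v w where "u \<in> group_words X" "v \<in> group_words X" "w \<in> group_words X"
      "A = pres_cong X R `` {u}" "B = pres_cong X R `` {v}" "D = pres_cong X R `` {w}"
      using C by meson
    then show "A \<otimes>\<^bsub>?G\<^esub> B \<otimes>\<^bsub>?G\<^esub> D = A \<otimes>\<^bsub>?G\<^esub> (B \<otimes>\<^bsub>?G\<^esub> D)"
      by (simp add: m app)
  next
    fix A assume "A \<in> carrier ?G"
    then show "\<one>\<^bsub>?G\<^esub> \<otimes>\<^bsub>?G\<^esub> A = A"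
      using C[of A] nil by (auto simp: one m)
  next
    fix A assume "A \<in> carrier ?G"
    then obtain u where u: "u \<in> group_words X" "A = pres_cong X R `` {u}"
      using C by meson
    let ?r = "rev (map (\<lambda>(x, e). (x, \<not> e)) u)"
    have r: "?r \<in> group_words X"
      using u(1) by (auto simp: group_words_def in_lists_conv_set)
    have "pres_cong X R `` {?r} \<otimes>\<^bsub>?G\<^esub> A = \<one>\<^bsub>?G\<^esub>"
      using equiv_class_eq[OF equiv_pres_cong[OF R] word_inverse_cong[OF u(1)]]
      by (simp add: u(2) m[OF r u(1)] one)
    then show "\<exists>B\<in>carrier ?G. B \<otimes>\<^bsub>?G\<^esub> A = \<one>\<^bsub>?G\<^esub>"
      using inC[OF r] by blast
  qed
qed


section \<open>Set-theoretic solutions \<open>(X, S)\<close> and their structure groups\<close>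

text \<open>The components of \<open>S (x, y) = (g\<^sub>x y, f\<^sub>y x)\<close>.\<close>

definition g_map :: "('a \<times> 'a \<Rightarrow> 'a \<times> 'a) \<Rightarrow> 'a \<Rightarrow> 'a \<Rightarrow> 'a" where
  "g_map S x y = fst (S (x, y))"

definition f_map :: "('a \<times> 'a \<Rightarrow> 'a \<times> 'a) \<Rightarrow> 'a \<Rightarrow> 'a \<Rightarrow> 'a" where
  "f_map S y x = snd (S (x, y))"

definition nondegenerate :: "'a set \<Rightarrow> ('a \<times> 'a \<Rightarrow> 'a \<times> 'a) \<Rightarrow> bool" where
  "nondegenerate X S \<longleftrightarrow>
    (\<forall>x\<in>X. bij_betw (g_map S x) X X) \<and> (\<forall>y\<in>X. bij_betw (f_map S y) X X)"

definition S12 :: "('a \<times> 'a \<Rightarrow> 'a \<times> 'a) \<Rightarrow> 'a \<times> 'a \<times> 'a \<Rightarrow> 'a \<times> 'a \<times> 'a" where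
  "S12 S = (\<lambda>(x, y, z). let (x', y') = S (x, y) in (x', y', z))"

definition S23 :: "('a \<times> 'a \<Rightarrow> 'a \<times> 'a) \<Rightarrow> 'a \<times> 'a \<times> 'a \<Rightarrow> 'a \<times> 'a \<times> 'a" where
  "S23 S = (\<lambda>(x, y, z). (x, S (y, z)))"

definition braided :: "'a set \<Rightarrow> ('a \<times> 'a \<Rightarrow> 'a \<times> 'a) \<Rightarrow> bool" where
  "braided X S \<longleftrightarrow>
    (\<forall>p \<in> X \<times> X \<times> X. S12 S (S23 S (S12 S p)) = S23 S (S12 S (S23 S p)))"

definition involutive :: "'a set \<Rightarrow> ('a \<times> 'a \<Rightarrow> 'a \<times> 'a) \<Rightarrow> bool" where
  "involutive X S \<longleftrightarrow> (\<forall>p \<in> X \<times> X. S (S p) = p)"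

definition symmetric_set :: "'a set \<Rightarrow> ('a \<times> 'a \<Rightarrow> 'a \<times> 'a) \<Rightarrow> bool" where
  "symmetric_set X S \<longleftrightarrow> braided X S \<and> involutive X S"

definition structure_relations ::
    "'a set \<Rightarrow> ('a \<times> 'a \<Rightarrow> 'a \<times> 'a) \<Rightarrow> (('a \<times> bool) list \<times> ('a \<times> bool) list) set" where
  "structure_relations X S =
    {([(x, True), (y, True)], [(t, True), (z, True)]) | x y t z.
      x \<in> X \<and> y \<in> X \<and> S (x, y) = (t, z)}"

definition structure_group ::
    "'a set \<Rightarrow> ('a \<times> 'a \<Rightarrow> 'a \<times> 'a) \<Rightarrow> ('a \<times> bool) list set monoid" where
  "structure_group X S = presented_group X (structure_relations X S)"

lemma group_structure_group:
  assumes "bij_betw S (X \<times> X) (X \<times> X)"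
  shows "group (structure_group X S)"
  unfolding structure_group_def
proof (rule group_presented_group)
  show "structure_relations X S \<subseteq> group_words X \<times> group_words X"
  proof
    fix r assume "r \<in> structure_relations X S"
    then obtain x y t z where r: "r = ([(x, True), (y, True)], [(t, True), (z, True)])"
      and xy: "x \<in> X" "y \<in> X" and S: "S (x, y) = (t, z)"
      unfolding structure_relations_def by blast
    have "S (x, y) \<in> X \<times> X"
      by (rule bij_betw_apply[OF assms]) (simp add: xy)
    then show "r \<in> group_words X \<times> group_words X"
      by (simp add: r xy S group_words_def)
  qed
qed

end

theory Submission
  imports Defs "HOL-Algebra.Sylow" "HOL-Algebra.Group_Action" "HOL-Algebra.Weak_Morphisms"
    "HOL-Algebra.Multiplicative_Group" "Jordan_Normal_Form.Jordan_Normal_Form_Existence"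
begin

text \<open>
  The structure group acts on \<open>X\<close> through \<open>x \<mapsto> g\<^sub>x\<close>, and it maps bijectively to the free
  abelian group on \<open>X\<close> by a 1-cocycle for this action: \<open>\<pi> (u v) = \<pi> u + u (\<pi> v)\<close>. For a
  positive word this cocycle is the multiset of its trace, and the only fact needed about words
  is that positive words with the same multiset are equal in the group
  (\<open>equal_pos_if_mset_trace_eq\<close>). Since \<open>X\<close> is finite, there is an \<open>e > 0\<close> such that words
  with multiset in \<open>e \<int>\<^sup>X\<close> act trivially (\<open>common_period\<close>, \<open>lam_trivial\<close>), so the pair of the
  permutation of \<open>X\<close> and the cocycle modulo \<open>e\<close> defines a homomorphism to a finite group,
  realised here by permutations of \<open>X \<times> \<int>/e\<close>. Its kernel acts trivially on \<open>X\<close> and is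
  therefore abelian, because on such elements the cocycle is additive; the central element
  with cocycle \<open>(e, \<dots>, e)\<close> (\<open>garside_element\<close>) turns every group element into a positive word.

  It remains to see that the finite image is solvable. For every divisor \<open>m\<close> of \<open>e\<close> the
  elements with cocycle in \<open>m \<int>\<^sup>X\<close> form a subgroup \<open>H m\<close> of order \<open>(e/m)\<close> to the power
  \<open>|X|\<close>. If \<open>e/m\<close> has at most two prime factors, \<open>H m\<close> is solvable by Burnside's
  theorem. Otherwise the subgroups \<open>H (m p)\<close>, \<open>H (m q)\<close>, \<open>H (m r)\<close> for three of the primes have
  pairwise coprime indices and are solvable by induction, and Wielandt's theorem
  (\<open>coprime_solvable_triple_imp_solvable\<close>) applies. So the family \<open>H\<close> plays the part of Hall
  subgroups in the solvability criterion of P. Hall.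

  Burnside's theorem follows from the fact that a finite simple group has no conjugacy class of
  prime power size \<open>q\<^sup>j > 1\<close>. The proof below is the classical one with irreducible
  characters replaced by the spectral projections of one operator, namely the sum \<open>L\<close> of the
  translations by the elements of the class of \<open>g\<close>. It is a normal operator, so it is diagonalizable,
  and its eigenprojections commute with all left and right translations. The trace of a
  translation on an eigenspace is an algebraic integer, and the eigenvalue of \<open>L\<close> divided by the size of
  the class takes the place of the central character divided by that size. This is carried by
  \<open>spectral_projections\<close>, \<open>class_eigenfunction_constant\<close> and
  \<open>simple_group_class_not_prime_power\<close>.
\<close>

section \<open>Algebraic integers\<close>

lemma mat_vec_reindex:
  fixes f :: "'a \<Rightarrow> 'a \<Rightarrow> 'b::comm_ring_1"
  assumes h: "bij_betw h {0..<n} I" and i: "i < n"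
  shows "(mat n n (\<lambda>(i,j). f (h i) (h j)) *\<^sub>v vec n (\<lambda>i. v (h i))) $ i = (\<Sum>b\<in>I. f (h i) b * v b)"
  using i sum.reindex_bij_betw[OF h, of "\<lambda>b. f (h i) b * v b"] by (simp add: scalar_prod_def)

text \<open>
  The characteristic polynomial, for matrices indexed by an arbitrary finite set and with
  eigenvectors written as functions. Groups will serve as index sets.
\<close>

lemma int_matrix_char_poly:
  fixes A :: "'a \<Rightarrow> 'a \<Rightarrow> int"
  assumes "finite I"
  obtains p :: "int poly" where "lead_coeff p = 1"
    "\<And>z::complex. poly (map_poly of_int p) z = 0 \<longleftrightarrow>
      (\<exists>v. (\<exists>i\<in>I. v i \<noteq> 0) \<and> (\<forall>i\<in>I. (\<Sum>j\<in>I. of_int (A i j) * v j) = z * v i))"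
proof -
  define n where "n = card I"
  obtain h where h: "bij_betw h {0..<n} I"
    using ex_bij_betw_nat_finite[OF assms] unfolding n_def by blast
  define M :: "int mat" where "M = mat n n (\<lambda>(i,j). A (h i) (h j))"
  have M: "M \<in> carrier_mat n n" by (simp add: M_def)
  let ?M = "map_mat of_int M :: complex mat"
  have M': "?M = mat n n (\<lambda>(i,j). of_int (A (h i) (h j)))"
    by (rule eq_matI) (auto simp: M_def)
  have cp: "char_poly ?M = map_poly of_int (char_poly M)"
    by (rule of_int_hom.char_poly_hom[OF M])
  have root: "poly (map_poly of_int (char_poly M)) z = 0 \<longleftrightarrow>
      (\<exists>v. (\<exists>i\<in>I. v i \<noteq> 0) \<and> (\<forall>i\<in>I. (\<Sum>j\<in>I. of_int (A i j) * v j) = z * v i))" for z :: complex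
  proof -
    have car: "?M \<in> carrier_mat n n" using M by simp
    have "poly (map_poly of_int (char_poly M)) z = 0 \<longleftrightarrow> eigenvalue ?M z"
      using eigenvalue_root_char_poly[OF car] by (simp add: cp)
    also have "\<dots> \<longleftrightarrow> (\<exists>v. (\<exists>i\<in>I. v i \<noteq> 0) \<and> (\<forall>i\<in>I. (\<Sum>j\<in>I. of_int (A i j) * v j) = z * v i))"
    proof
      assume "eigenvalue ?M z"
      then obtain u where u: "u \<in> carrier_vec n" "u \<noteq> 0\<^sub>v n" "?M *\<^sub>v u = z \<cdot>\<^sub>v u"
        using car unfolding eigenvalue_def eigenvector_def by auto
      define v where "v = (\<lambda>a. u $ (inv_into {0..<n} h a))"
      have vh: "v (h i) = u $ i" if "i < n" for i
        using h that by (simp add: v_def bij_betw_def inv_into_f_f)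
      have uv: "u = vec n (\<lambda>i. v (h i))"
        using u(1) by (intro eq_vecI) (auto simp: vh)
      have "\<exists>i\<in>I. v i \<noteq> 0"
      proof (rule ccontr)
        assume "\<not> ?thesis"
        then have "v (h i) = 0" if "i < n" for i using h that by (auto simp: bij_betw_def)
        then have "u = 0\<^sub>v n" using u(1) by (intro eq_vecI) (auto simp: vh)
        with u(2) show False by simp
      qed
      moreover have "(\<Sum>j\<in>I. of_int (A i j) * v j) = z * v i" if iI: "i \<in> I" for i
      proof -
        obtain k where k: "k < n" "i = h k" using h iI by (force simp: bij_betw_def)
        have "(?M *\<^sub>v u) $ k = (\<Sum>j\<in>I. of_int (A i j) * v j)"
          unfolding M' using mat_vec_reindex[OF h k(1), of "\<lambda>a b. of_int (A a b)" v]
          by (simp add: uv k(2))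
        then show ?thesis using u k by (simp add: vh)
      qed
      ultimately show "\<exists>v. (\<exists>i\<in>I. v i \<noteq> 0) \<and> (\<forall>i\<in>I. (\<Sum>j\<in>I. of_int (A i j) * v j) = z * v i)" by blast
    next
      assume "\<exists>v. (\<exists>i\<in>I. v i \<noteq> 0) \<and> (\<forall>i\<in>I. (\<Sum>j\<in>I. of_int (A i j) * v j) = z * v i)"
      then obtain v i0 where v: "i0 \<in> I" "v i0 \<noteq> 0"
        "\<And>i. i \<in> I \<Longrightarrow> (\<Sum>j\<in>I. of_int (A i j) * v j) = z * v i" by blast
      define u where "u = vec n (\<lambda>i. v (h i))"
      have "?M *\<^sub>v u = z \<cdot>\<^sub>v u"
      proof (rule eq_vecI)
        fix i assume "i < dim_vec (z \<cdot>\<^sub>v u)"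
        then have i: "i < n" by (simp add: u_def)
        then have "h i \<in> I" using h by (auto simp: bij_betw_def)
        then show "(?M *\<^sub>v u) $ i = (z \<cdot>\<^sub>v u) $ i"
          unfolding M' u_def using mat_vec_reindex[OF h i, of "\<lambda>a b. of_int (A a b)" v] v(3) i
          by simp
      qed (simp add: u_def M_def)
      moreover have "u \<noteq> 0\<^sub>v n"
      proof -
        obtain k where "k < n" "i0 = h k" using h v(1) by (force simp: bij_betw_def)
        then have "u $ k \<noteq> 0\<^sub>v n $ k" using v(2) by (simp add: u_def)
        then show ?thesis by auto
      qed
      ultimately show "eigenvalue ?M z"
        unfolding eigenvalue_def eigenvector_def by (intro exI[of _ u]) (simp add: u_def M_def)
    qed
    finally show ?thesis .
  qed
  from that[of "char_poly M"] root degree_monic_char_poly[OF M] show ?thesis by blast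
qed

lemma algebraic_int_eigenvalue:
  fixes x :: complex and A :: "'a \<Rightarrow> 'a \<Rightarrow> int"
  assumes "finite I" "i0 \<in> I" "v i0 \<noteq> 0"
    and "\<And>i. i \<in> I \<Longrightarrow> (\<Sum>j\<in>I. of_int (A i j) * v j) = x * v i"
  shows "algebraic_int x"
proof -
  obtain p where "lead_coeff p = 1" "poly (map_poly of_int p) x = 0"
    using int_matrix_char_poly[OF assms(1), of A] assms(2-4) by metis
  then show ?thesis by (auto simp: algebraic_int_altdef_ipoly)
qed

lemma algebraic_int_power_relation:
  fixes x :: complex
  assumes "algebraic_int x"
  obtains n and c :: "nat \<Rightarrow> int" where "n > 0" "x ^ n = (\<Sum>k<n. of_int (c k) * x ^ k)"
proof -
  obtain p where p: "poly (map_poly of_int p) x = 0" "lead_coeff p = 1"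
    using assms by (auto simp: algebraic_int_altdef_ipoly)
  let ?n = "degree p"
  have "?n > 0"
  proof (rule ccontr)
    assume "\<not> ?n > 0"
    then have "p = 1" using p(2) by (metis degree_eq_zeroE lead_coeff_pCons(2) neq0_conv one_pCons)
    then show False using p(1) by simp
  qed
  have "0 = (\<Sum>k\<le>?n. of_int (coeff p k) * x ^ k)"
    using p(1) by (simp add: poly_altdef coeff_map_poly degree_map_poly)
  also have "\<dots> = (\<Sum>k<?n. of_int (coeff p k) * x ^ k) + x ^ ?n"
    using p(2) by (simp add: lessThan_Suc_atMost[symmetric])
  finally have "x ^ ?n = - (\<Sum>k<?n. of_int (coeff p k) * x ^ k)"
    by (simp add: eq_neg_iff_add_eq_0 add.commute)
  also have "\<dots> = (\<Sum>k<?n. of_int (- coeff p k) * x ^ k)" by (simp add: sum_negf)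
  finally show thesis using that[of ?n "\<lambda>k. - coeff p k"] \<open>?n > 0\<close> by blast
qed

text \<open>
  Both \<open>x\<close> and \<open>y\<close> act by integer matrices on the module spanned by the products
  \<open>x\<^sup>i y\<^sup>j\<close> with \<open>i, j\<close> below the degrees of monic equations. The vector of these products
  is thus a common eigenvector, and it remains one for the sum and the product of the matrices.
\<close>

lemma algebraic_int_joint_module:
  fixes x y :: complex
  assumes "algebraic_int x" "algebraic_int y"
  obtains I :: "(nat \<times> nat) set" and v A B i0 where
    "finite I" "i0 \<in> I" "v i0 = (1::complex)"
    "\<And>i. i \<in> I \<Longrightarrow> (\<Sum>j\<in>I. of_int (A i j :: int) * v j) = x * v i"
    "\<And>i. i \<in> I \<Longrightarrow> (\<Sum>j\<in>I. of_int (B i j :: int) * v j) = y * v i"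
proof -
  obtain n c where n: "n > 0" "x ^ n = (\<Sum>k<n. of_int (c k :: int) * x ^ k)"
    using algebraic_int_power_relation[OF assms(1)] by metis
  obtain m d where m: "m > 0" "y ^ m = (\<Sum>k<m. of_int (d k :: int) * y ^ k)"
    using algebraic_int_power_relation[OF assms(2)] by metis
  \<comment> \<open>Row \<open>i\<close> of the companion matrix: it sends the \<open>i\<close>-th power to the next one, and the last
    power is rewritten with the monic equation.\<close>
  define s where "s = (\<lambda>n c i k. if Suc i < n then of_bool (k = Suc i) else (c k :: int))" for n :: nat
  have step: "(\<Sum>k<n. of_int (s n c i k) * x ^ k) = x * x ^ i"
    if "i < n" "x ^ n = (\<Sum>k<n. of_int (c k :: int) * x ^ k)" for n i c and x :: complex
  proof (cases "Suc i < n")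
    case True
    then have "(\<Sum>k<n. of_int (s n c i k) * x ^ k) = (\<Sum>k<n. if k = Suc i then x ^ k else 0)"
      by (intro sum.cong) (auto simp: s_def)
    then show ?thesis using True by simp
  next
    case False
    then have "n = Suc i" using that by simp
    then show ?thesis using False that(2) by (simp add: s_def)
  qed
  let ?I = "{..<n} \<times> {..<m}"
  let ?v = "\<lambda>(i,j). x ^ i * y ^ j"
  let ?A = "\<lambda>(i,j) (k,l). if l = j then s n c i k else 0"
  let ?B = "\<lambda>(i,j) (k,l). if k = i then s m d j l else 0"
  show thesis
  proof (rule that[of ?I "(0,0)" ?v ?A ?B])
    fix i assume "i \<in> ?I"
    then obtain a b where i: "i = (a,b)" "a < n" "b < m" by auto
    have "(\<Sum>j\<in>?I. of_int (?A i j) * ?v j)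
        = (\<Sum>k<n. \<Sum>l<m. if l = b then of_int (s n c a k) * (x ^ k * y ^ l) else 0)"
      unfolding sum.cartesian_product by (intro sum.cong) (auto simp: i)
    also have "\<dots> = (\<Sum>k<n. of_int (s n c a k) * x ^ k) * y ^ b"
      using i by (simp add: sum_distrib_right mult.assoc)
    finally show "(\<Sum>j\<in>?I. of_int (?A i j) * ?v j) = x * ?v i"
      using step[OF i(2) n(2)] by (simp add: i mult.assoc)
    have "(\<Sum>j\<in>?I. of_int (?B i j) * ?v j)
        = (\<Sum>k<n. \<Sum>l<m. if k = a then of_int (s m d b l) * (x ^ k * y ^ l) else 0)"
      unfolding sum.cartesian_product by (intro sum.cong) (auto simp: i)
    also have "\<dots> = (\<Sum>l<m. \<Sum>k<n. if k = a then of_int (s m d b l) * (x ^ k * y ^ l) else 0)"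
      by (rule sum.swap)
    also have "\<dots> = x ^ a * (\<Sum>l<m. of_int (s m d b l) * y ^ l)"
      using i by (simp add: sum_distrib_left mult.assoc mult.left_commute)
    finally show "(\<Sum>j\<in>?I. of_int (?B i j) * ?v j) = y * ?v i"
      using step[OF i(3) m(2)] by (simp add: i mult.assoc mult.left_commute)
  qed (use n m in auto)
qed

lemma algebraic_int_plus_complex:
  fixes x y :: complex
  assumes "algebraic_int x" "algebraic_int y"
  shows "algebraic_int (x + y)"
proof -
  obtain I :: "(nat \<times> nat) set" and v A B i0 where *: "finite I" "i0 \<in> I" "v i0 = (1::complex)"
    "\<And>i. i \<in> I \<Longrightarrow> (\<Sum>j\<in>I. of_int (A i j :: int) * v j) = x * v i"
    "\<And>i. i \<in> I \<Longrightarrow> (\<Sum>j\<in>I. of_int (B i j :: int) * v j) = y * v i"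
    by (rule algebraic_int_joint_module[OF assms], rule that)
  show ?thesis
    by (rule algebraic_int_eigenvalue[of I i0 v "\<lambda>i j. A i j + B i j"])
      (use * in \<open>auto simp: ring_distribs sum.distrib\<close>)
qed

lemma algebraic_int_times_complex:
  fixes x y :: complex
  assumes "algebraic_int x" "algebraic_int y"
  shows "algebraic_int (x * y)"
proof -
  obtain I :: "(nat \<times> nat) set" and v A B i0 where *: "finite I" "i0 \<in> I" "v i0 = (1::complex)"
    "\<And>i. i \<in> I \<Longrightarrow> (\<Sum>j\<in>I. of_int (A i j :: int) * v j) = x * v i"
    "\<And>i. i \<in> I \<Longrightarrow> (\<Sum>j\<in>I. of_int (B i j :: int) * v j) = y * v i"
    by (rule algebraic_int_joint_module[OF assms], rule that)
  have "(\<Sum>j\<in>I. of_int (\<Sum>k\<in>I. B i k * A k j) * v j) = x * y * v i" if "i \<in> I" for i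
  proof -
    have "(\<Sum>j\<in>I. of_int (\<Sum>k\<in>I. B i k * A k j) * v j)
        = (\<Sum>j\<in>I. \<Sum>k\<in>I. of_int (B i k) * (of_int (A k j) * v j))"
      by (simp add: sum_distrib_right mult.assoc)
    also have "\<dots> = (\<Sum>k\<in>I. of_int (B i k) * (\<Sum>j\<in>I. of_int (A k j) * v j))"
      by (subst sum.swap) (simp add: sum_distrib_left)
    also have "\<dots> = x * (\<Sum>k\<in>I. of_int (B i k) * v k)"
      by (simp add: * sum_distrib_left mult.left_commute)
    finally show ?thesis using that by (simp add: *)
  qed
  then show ?thesis
    by (intro algebraic_int_eigenvalue[of I i0 v "\<lambda>i j. \<Sum>k\<in>I. B i k * A k j"]) (use * in auto)
qed

lemma algebraic_int_sum_complex:
  fixes f :: "'a \<Rightarrow> complex"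
  assumes "\<And>i. i \<in> I \<Longrightarrow> algebraic_int (f i)"
  shows "algebraic_int (\<Sum>i\<in>I. f i)"
  using assms by (induction I rule: infinite_finite_induct) (auto intro: algebraic_int_plus_complex)

lemma algebraic_int_sum_list_complex:
  "(\<And>x. x \<in> set xs \<Longrightarrow> algebraic_int x) \<Longrightarrow> algebraic_int (sum_list xs :: complex)"
  by (induction xs) (auto intro: algebraic_int_plus_complex)

lemma algebraic_int_prod_list_complex:
  "(\<And>x. x \<in> set xs \<Longrightarrow> algebraic_int x) \<Longrightarrow> algebraic_int (prod_list xs :: complex)"
  by (induction xs) (auto intro: algebraic_int_times_complex int_imp_algebraic_int)

lemma algebraic_int_if_power:
  fixes x :: complex
  assumes "algebraic_int (x ^ n)" "n > 0"
  shows "algebraic_int x"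
  by (rule algebraic_int_root[OF assms(1), of "Polynomial.monom 1 n"])
    (use assms(2) in \<open>auto simp: poly_monom degree_monom_eq\<close>)

lemma rat_poly_dvd_root:
  fixes p q :: "rat poly" and z :: complex
  assumes "p dvd q" "poly (map_poly of_rat p) z = 0"
  shows "poly (map_poly of_rat q) z = 0"
proof -
  interpret C: map_poly_idom_hom "of_rat :: rat \<Rightarrow> complex" ..
  show ?thesis using assms by (auto simp: dvd_def C.hom_mult)
qed

text \<open>
  The constant term of the minimal polynomial over the rationals is, up to sign, the product of
  the conjugates of \<open>\<mu>\<close>. It is rational and an algebraic integer, hence an integer, and its absolute
  value is below 1, so it vanishes; a minimal polynomial divisible by the variable
  belongs to 0. The polynomial \<open>f\<close> only serves to bound all conjugates at once.
\<close>

lemma algebraic_int_eq_0_if_conjugates_small: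
  fixes \<mu> :: complex and f :: "int poly"
  assumes int: "algebraic_int \<mu>"
    and f: "f \<noteq> 0" "poly (map_poly of_int f) \<mu> = 0"
    and small: "\<And>z::complex. poly (map_poly of_int f) z = 0 \<Longrightarrow> norm z \<le> 1"
    and lt: "norm \<mu> < 1"
  shows "\<mu> = 0"
proof (rule ccontr)
  assume "\<mu> \<noteq> 0"
  interpret C: map_poly_idom_hom "of_rat :: rat \<Rightarrow> complex" ..
  let ?C = "map_poly (of_rat :: rat \<Rightarrow> complex)"
  let ?Q = "map_poly (of_int :: int \<Rightarrow> rat)"
  have comp: "?C (?Q p) = map_poly of_int p" for p
    by (subst map_poly_map_poly) (auto simp: o_def)
  have smultC: "?C (Polynomial.smult b p) = Polynomial.smult (of_rat b) (?C p)" for b p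
    by (rule poly_eqI) (simp add: coeff_map_poly of_rat_mult)
  \<comment> \<open>A rational polynomial \<open>d\<close> of least degree with root \<open>\<mu>\<close>; its monic multiple \<open>c\<close> is the
    minimal polynomial.\<close>
  define P where "P = (\<lambda>d::rat poly. d \<noteq> 0 \<and> poly (?C d) \<mu> = 0)"
  have "P (?Q f)" using f by (simp add: P_def comp)
  then obtain d where d: "P d" and min: "\<And>d'. P d' \<Longrightarrow> degree d \<le> degree d'"
    by (metis ex_has_least_nat)
  have dvd: "d dvd q" if "poly (?C q) \<mu> = 0" for q
  proof -
    have "poly (?C (q mod d)) \<mu> = 0"
    proof -
      have "?C q = ?C (q div d) * ?C d + ?C (q mod d)"
        by (metis div_mult_mod_eq C.hom_add C.hom_mult)
      then show ?thesis using that d by (simp add: P_def)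
    qed
    then have "q mod d = 0"
      using min[of "q mod d"] d degree_mod_less[of d q] by (auto simp: P_def)
    then show ?thesis by auto
  qed
  obtain h where h: "poly (map_poly of_int h) \<mu> = 0" "lead_coeff h = (1::int)"
    using int by (auto simp: algebraic_int_altdef_ipoly)
  define a where "a = lead_coeff d"
  have a: "a \<noteq> 0" using d by (simp add: a_def P_def)
  define c where "c = Polynomial.smult (inverse a) d"
  have c: "P c" using d a by (simp add: P_def c_def smultC)
  have c1: "lead_coeff c = 1" using a by (simp add: c_def a_def)
  have c_roots: "poly (map_poly of_int q) z = 0"
    if "poly (map_poly of_int q) \<mu> = 0" "poly (?C c) z = 0" for q z
  proof -
    have "d dvd ?Q q" using dvd[of "?Q q"] that(1) by (simp add: comp)
    moreover have "poly (?C d) z = 0"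
      using that(2) a by (simp add: c_def smultC)
    ultimately show ?thesis using rat_poly_dvd_root[of d "?Q q" z] by (simp add: comp)
  qed
  have lc: "lead_coeff (?C c) = 1" using c1 by (simp add: degree_map_poly coeff_map_poly)
  obtain rs where rs: "?C c = (\<Prod>r\<leftarrow>rs. [:- r, 1:])"
    using fundamental_theorem_algebra_factorized[of "?C c"] unfolding lc by (metis smult_1_left)
  have roots: "poly (?C c) r = 0 \<longleftrightarrow> r \<in> set rs" for r
    unfolding rs by (induction rs) auto
  have const: "poly (?C c) 0 = prod_list (map uminus rs)"
    unfolding rs by (induction rs) auto
  have int_rs: "algebraic_int r" if "r \<in> set rs" for r
    using c_roots[OF h(1), of r] roots that h(2) by (auto simp: algebraic_int_altdef_ipoly)
  have le_rs: "norm r \<le> 1" if "r \<in> set rs" for r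
    using small c_roots[OF f(2)] roots that by blast
  have "algebraic_int (poly (?C c) 0)"
    unfolding const by (rule algebraic_int_prod_list_complex) (auto simp: int_rs)
  moreover have "poly (?C c) 0 = of_rat (coeff c 0)"
    by (simp add: poly_0_coeff_0 coeff_map_poly)
  ultimately have "poly (?C c) 0 \<in> \<int>"
    using rational_algebraic_int_is_int by (metis Rats_of_rat)
  moreover have "norm (poly (?C c) 0) < 1"
  proof -
    have le: "norm (prod_list (map uminus xs)) \<le> 1" if "set xs \<subseteq> set rs" for xs
      using that
    proof (induction xs)
      case (Cons x xs)
      then show ?case using le_rs[of x] by (simp add: norm_mult mult_le_one)
    qed simp
    have "\<mu> \<in> set rs" using c roots by (simp add: P_def)
    then obtain xs ys where xy: "rs = xs @ \<mu> # ys" by (meson split_list)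
    have "norm (prod_list (map uminus rs)) =
        norm \<mu> * (norm (prod_list (map uminus xs)) * norm (prod_list (map uminus ys)))"
      by (simp add: xy norm_mult)
    also have "\<dots> \<le> norm \<mu> * 1"
      by (intro mult_left_mono mult_le_one le) (auto simp: xy)
    finally show ?thesis unfolding const using lt by simp
  qed
  ultimately have "poly (?C c) 0 = 0"
  proof -
    assume "poly (?C c) 0 \<in> \<int>" and less: "norm (poly (?C c) 0) < 1"
    then obtain k where k: "poly (?C c) 0 = of_int k" by (elim Ints_cases)
    have "real_of_int \<bar>k\<bar> < 1" using less unfolding k by simp
    then have "k = 0" by linarith
    then show ?thesis using k by simp
  qed
  then have "coeff c 0 = 0" by (simp add: poly_0_coeff_0 coeff_map_poly)
  then obtain e where e: "c = pCons 0 e" by (cases c) auto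
  have "e \<noteq> 0" using c e by (auto simp: P_def)
  have "?C c = pCons 0 (?C e)" unfolding e
    by (rule poly_eqI) (simp add: coeff_map_poly coeff_pCons split: nat.split)
  then have "P e" using c \<open>e \<noteq> 0\<close> \<open>\<mu> \<noteq> 0\<close> by (simp add: P_def)
  then have "degree d \<le> degree e" by (rule min)
  moreover have "degree d = degree c" using a by (simp add: c_def)
  ultimately show False using e \<open>e \<noteq> 0\<close> by simp
qed

section \<open>Diagonalizable matrices and their spectral projections\<close>

lemma jordan_matrix_off_diagonal:
  assumes "i < sum_list (map fst n_as)" "j < sum_list (map fst n_as)" "i \<noteq> j"
    "jordan_matrix n_as $$ (i,j) \<noteq> 0"
  shows "Suc i = j \<and> jordan_matrix n_as $$ (i,j) = 1 \<and>
    jordan_matrix n_as $$ (j,j) = jordan_matrix n_as $$ (i,i)"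
  using assms
proof (induction n_as arbitrary: i j)
  case (Cons na n_as)
  obtain n a where na: "na = (n,a)" by force
  show ?case
  proof (cases "n \<le> i \<and> n \<le> j")
    case True
    then obtain i' j' where "i = n + i'" "j = n + j'" by (metis le_iff_add)
    then show ?thesis using Cons.IH[of i' j'] Cons.prems
      by (auto simp: na jordan_matrix_Cons)
  qed (use Cons.prems in \<open>auto simp: na jordan_matrix_Cons split: if_splits\<close>)
qed simp

text \<open>
  A 1 above the diagonal of the Jordan normal form gives a Jordan chain of length two:
  the columns of \<open>P\<close> at a first such position \<open>k\<close> and at the next one are vectors \<open>w \<noteq> 0\<close> and \<open>v\<close> with
  \<open>A v = \<kappa> v + w\<close> and \<open>A w = \<kappa> w\<close>. Excluding such chains therefore forces the form to be diagonal.
\<close>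

lemma semisimple_diagonalizable:
  fixes A :: "complex mat"
  assumes A: "A \<in> carrier_mat n n"
    and ss: "\<And>\<kappa> v w. v \<in> carrier_vec n \<Longrightarrow> w \<in> carrier_vec n \<Longrightarrow> A *\<^sub>v v = \<kappa> \<cdot>\<^sub>v v + w \<Longrightarrow>
      A *\<^sub>v w = \<kappa> \<cdot>\<^sub>v w \<Longrightarrow> w = 0\<^sub>v n"
  obtains t P Q where "similar_mat_wit A (mat_diag n t) P Q"
proof -
  obtain as where "char_poly A = (\<Prod>a\<leftarrow>as. [:- a, 1:])" using char_poly_factorized[OF A] by blast
  then obtain n_as where "jordan_nf A n_as" using jordan_nf_exists[OF A] by blast
  then obtain P Q where sim: "similar_mat_wit A (jordan_matrix n_as) P Q"
    unfolding jordan_nf_def similar_mat_def by blast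
  define J where "J = jordan_matrix n_as"
  note D = similar_mat_witD2[OF A sim, folded J_def]
  have N: "sum_list (map fst n_as) = n"
    using carrier_matD(1)[OF D(5)] by (simp add: J_def)
  note off = jordan_matrix_off_diagonal[of _ n_as, unfolded N, folded J_def]
  have AP: "A * P = P * J" using D by (simp add: assoc_mult_mat[of _ n n _ n _ n])
  have diag: "J $$ (i, Suc i) = 0" if "Suc i < n" for i
  proof (rule ccontr)
    assume "J $$ (i, Suc i) \<noteq> 0"
    \<comment> \<open>At the first such position column \<open>k\<close> of \<open>J\<close> has no entry above the diagonal, so it belongs
      to an eigenvector.\<close>
    define k where "k = (LEAST i. Suc i < n \<and> J $$ (i, Suc i) \<noteq> 0)"
    have k: "Suc k < n" "J $$ (k, Suc k) \<noteq> 0"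
      using LeastI[of "\<lambda>i. Suc i < n \<and> J $$ (i, Suc i) \<noteq> 0" i] \<open>J $$ (i, Suc i) \<noteq> 0\<close> that
      by (auto simp: k_def)
    have least: "J $$ (i, Suc i) = 0" if "i < k" for i
      using not_less_Least[of i "\<lambda>i. Suc i < n \<and> J $$ (i, Suc i) \<noteq> 0"] that k(1)
      by (auto simp: k_def)
    define \<kappa> where "\<kappa> = J $$ (k,k)"
    have J1: "J $$ (k, Suc k) = 1" "J $$ (Suc k, Suc k) = \<kappa>"
      using off[of k "Suc k"] k by (auto simp: \<kappa>_def)
    have ck: "col J k = \<kappa> \<cdot>\<^sub>v unit_vec n k"
    proof (rule eq_vecI)
      fix i assume "i < dim_vec (\<kappa> \<cdot>\<^sub>v unit_vec n k)"
      then have i: "i < n" by simp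
      show "col J k $ i = (\<kappa> \<cdot>\<^sub>v unit_vec n k) $ i"
        using off[of i k] least[of i] i k D(5) by (cases "i = k") (auto simp: \<kappa>_def)
    qed (use D(5) in auto)
    have csk: "col J (Suc k) = \<kappa> \<cdot>\<^sub>v unit_vec n (Suc k) + unit_vec n k"
    proof (rule eq_vecI)
      fix i assume "i < dim_vec (\<kappa> \<cdot>\<^sub>v unit_vec n (Suc k) + unit_vec n k)"
      then have i: "i < n" by simp
      show "col J (Suc k) $ i = (\<kappa> \<cdot>\<^sub>v unit_vec n (Suc k) + unit_vec n k) $ i"
        using off[of i "Suc k"] i k D(5) J1 by auto
    qed (use D(5) in auto)
    have Pu: "P *\<^sub>v unit_vec n i = col P i" if "i < n" for i
      using that D(6) by (intro eq_vecI) auto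
    have ac: "A *\<^sub>v col P j = P *\<^sub>v col J j" if "j < n" for j
      using col_mult2[OF A D(6) that] col_mult2[OF D(6) D(5) that] AP by simp
    let ?v = "col P (Suc k)" and ?w = "col P k"
    have v: "?v \<in> carrier_vec n" and w: "?w \<in> carrier_vec n" using D(6) by auto
    have "A *\<^sub>v ?v = \<kappa> \<cdot>\<^sub>v ?v + ?w"
      using k D(6) by (simp add: ac csk Pu mult_add_distrib_mat_vec[of _ n n] mult_mat_vec[of _ n n])
    moreover have "A *\<^sub>v ?w = \<kappa> \<cdot>\<^sub>v ?w"
      using k D(6) by (simp add: ac ck Pu mult_mat_vec[of _ n n])
    ultimately have "?w = 0\<^sub>v n" using ss v w by blast
    then have "col (Q * P) k = Q *\<^sub>v 0\<^sub>v n"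
      using col_mult2[OF D(7) D(6), of k] k by simp
    then have "col (1\<^sub>m n) k $ k = (Q *\<^sub>v (0\<^sub>v n)) $ k" by (simp add: D(2))
    then show False using k(1) D(7) by (simp add: scalar_prod_def)
  qed
  define t where "t = (\<lambda>i. J $$ (i,i))"
  have "J = mat_diag n t"
  proof (rule eq_matI)
    fix i j assume "i < dim_row (mat_diag n t)" "j < dim_col (mat_diag n t)"
    then have "i < n" "j < n" by (auto simp: mat_diag_def)
    then show "J $$ (i,j) = mat_diag n t $$ (i,j)"
      using off[of i j] diag[of i] by (auto simp: mat_diag_def t_def)
  qed (use D(5) in \<open>auto simp: mat_diag_def\<close>)
  then show thesis using sim that[of t P Q] by (simp flip: J_def)
qed

definition mat_trace :: "complex mat \<Rightarrow> complex" where
  "mat_trace A = (\<Sum>i<dim_row A. A $$ (i,i))"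

lemma mat_trace_mult_commute:
  assumes "A \<in> carrier_mat n n" "B \<in> carrier_mat n n"
  shows "mat_trace (A * B) = mat_trace (B * A)"
proof -
  have "mat_trace (A * B) = (\<Sum>i<n. \<Sum>k<n. A $$ (i,k) * B $$ (k,i))"
    using assms by (auto simp: mat_trace_def scalar_prod_def atLeast0LessThan intro!: sum.cong)
  also have "\<dots> = (\<Sum>k<n. \<Sum>i<n. B $$ (k,i) * A $$ (i,k))"
    by (subst sum.swap) (simp add: mult.commute)
  also have "\<dots> = mat_trace (B * A)"
    using assms by (auto simp: mat_trace_def scalar_prod_def atLeast0LessThan intro!: sum.cong)
  finally show ?thesis .
qed

lemma mat_trace_similar:
  assumes A: "A \<in> carrier_mat n n" and sim: "similar_mat_wit A B P Q"
  shows "mat_trace A = mat_trace B"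
proof -
  note D = similar_mat_witD2[OF A sim]
  have "mat_trace A = mat_trace (P * (B * Q))" using D by (simp add: assoc_mult_mat[of _ n n _ n _ n])
  also have "\<dots> = mat_trace ((B * Q) * P)" by (rule mat_trace_mult_commute[of _ n]) (use D in auto)
  also have "(B * Q) * P = B" using D by (simp add: assoc_mult_mat[of _ n n _ n _ n])
  finally show ?thesis .
qed

text \<open>
  Every eigenvalue is 0 or an \<open>N\<close>-th root of unity, and the trace is the sum of the eigenvalues.
\<close>

lemma algebraic_int_trace_of_periodic:
  assumes A: "A \<in> carrier_mat n n" and N: "N > 0" and per: "A ^\<^sub>m Suc N = A"
  shows "algebraic_int (mat_trace A)"
proof -
  obtain es where es: "char_poly A = (\<Prod>a\<leftarrow>es. [:- a, 1:])" using char_poly_factorized[OF A] by blast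
  obtain B P Q where s: "schur_decomposition A es = (B,P,Q)" by (metis prod_cases3)
  have sim: "similar_mat_wit A B P Q" and dB: "diag_mat B = es"
    using schur_decomposition[OF A es s] by auto
  have "mat_trace A = sum_list es"
    unfolding mat_trace_similar[OF A sim] dB[symmetric]
    by (simp add: mat_trace_def diag_mat_def sum_list_sum_nth atLeast0LessThan)
  moreover have "algebraic_int e" if "e \<in> set es" for e
  proof -
    have "poly (char_poly A) e = 0" using that unfolding es by (induction es) auto
    then obtain v where ev: "eigenvector A v e"
      using eigenvalue_root_char_poly[OF A] by (auto simp: eigenvalue_def)
    then have v: "v \<in> carrier_vec n" "v \<noteq> 0\<^sub>v n" "A *\<^sub>v v = e \<cdot>\<^sub>v v"
      using A by (auto simp: eigenvector_def)
    then obtain i where i: "i < n" "v $ i \<noteq> 0" by (metis carrier_vecD eq_vecI index_zero_vec)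
    have "e \<cdot>\<^sub>v v = e ^ Suc N \<cdot>\<^sub>v v"
      using eigenvector_pow[OF A ev, of "Suc N"] unfolding per v(3) .
    then have "(e \<cdot>\<^sub>v v) $ i = (e ^ Suc N \<cdot>\<^sub>v v) $ i" by simp
    then have "e = e ^ Suc N" using i v(1) by simp
    then have "e = 0 \<or> e ^ N = 1" by simp
    then show "algebraic_int e"
    proof
      assume e: "e ^ N = 1"
      show ?thesis by (rule algebraic_int_if_power[OF _ N]) (simp add: e int_imp_algebraic_int)
    qed simp
  qed
  ultimately show ?thesis using algebraic_int_sum_list_complex[of es] by simp
qed

text \<open>
  The matrix \<open>R\<close> is the projection to the eigenspace of \<open>\<kappa>\<close>. In the eigenbasis a matrix that
  commutes with \<open>A\<close> is block diagonal, so it commutes with \<open>R\<close>; then \<open>(U R)\<^sup>k = U\<^sup>k R\<close>,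
  and \<open>U R\<close> is periodic because \<open>U\<close> has finite order.
\<close>

lemma commuting_finite_order_trace:
  fixes A U :: "complex mat" and \<kappa> :: complex
  assumes A: "A \<in> carrier_mat n n" and sim: "similar_mat_wit A (mat_diag n t) P Q"
    and U: "U \<in> carrier_mat n n" and comm: "U * A = A * U" and N: "N > 0" and UN: "U ^\<^sub>m N = 1\<^sub>m n"
  defines "R \<equiv> P * mat_diag n (\<lambda>i. of_bool (t i = \<kappa>)) * Q"
  shows "U * R = R * U" "algebraic_int (mat_trace (U * R))"
proof -
  note D = similar_mat_witD2[OF A sim]
  note assoc = assoc_mult_mat[of _ n n _ n _ n]
  let ?D = "mat_diag n t" and ?E = "mat_diag n (\<lambda>i. of_bool (t i = \<kappa>)) :: complex mat"
  have [simp]: "P \<in> carrier_mat n n" "Q \<in> carrier_mat n n" using D by auto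
  note [simp] = U mult_carrier_mat[of _ n n _ n]
  have E: "?E \<in> carrier_mat n n" by simp
  have R: "R \<in> carrier_mat n n" unfolding R_def by (intro mult_carrier_mat[of _ n n]) auto
  define C where "C = Q * U * P"
  have C: "C \<in> carrier_mat n n" unfolding C_def by (intro mult_carrier_mat[of _ n n]) auto
  have cancel1: "P * (Q * X) = X" if "X \<in> carrier_mat n n" for X
    using assoc_mult_mat[of P n n Q n X n] that D(1) by simp
  have cancel2: "Q * (P * X) = X" if "X \<in> carrier_mat n n" for X
    using assoc_mult_mat[of Q n n P n X n] that D(2) by simp
  have AP: "A * P = P * ?D" unfolding D(3) using D(2) by (simp add: assoc right_mult_one_mat[of _ n n])
  have QA: "Q * A = ?D * Q"
    unfolding D(3) by (simp add: assoc cancel2)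
  have "C * ?D = Q * (U * (A * P))" unfolding AP C_def by (simp add: assoc)
  also have "\<dots> = Q * ((U * A) * P)" using A by (simp add: assoc)
  also have "\<dots> = (Q * A) * (U * P)" unfolding comm using A by (simp add: assoc)
  also have "\<dots> = ?D * C" unfolding QA C_def by (simp add: assoc)
  finally have CD: "C * ?D = ?D * C" .
  have CE: "C * ?E = ?E * C"
  proof -
    \<comment> \<open>Entries of \<open>C\<close> vanish between positions with different eigenvalues, and \<open>?E\<close> only
      depends on the eigenvalue.\<close>
    have "C $$ (i,j) * t j = t i * C $$ (i,j)" if "i < n" "j < n" for i j
    proof -
      have "(C * ?D) $$ (i,j) = (?D * C) $$ (i,j)" using CD by simp
      then show ?thesis
        unfolding mat_diag_mult_left[OF C] mat_diag_mult_right[OF C] using that by simp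
    qed
    then show ?thesis
      unfolding mat_diag_mult_left[OF C] mat_diag_mult_right[OF C]
      by (intro eq_matI) (auto simp: of_bool_def, metis)
  qed
  have PC: "P * C = U * P" unfolding C_def by (simp add: assoc cancel1)
  have CQ: "C * Q = Q * U" unfolding C_def using D(1) by (simp add: assoc right_mult_one_mat[of _ n n])
  have "U * R = (U * P) * (?E * Q)" unfolding R_def by (simp add: assoc)
  also have "\<dots> = P * ((C * ?E) * Q)" unfolding PC[symmetric] using C by (simp add: assoc)
  also have "\<dots> = P * (?E * (C * Q))" unfolding CE using C by (simp add: assoc)
  also have "\<dots> = R * U" unfolding CQ R_def by (simp add: assoc)
  finally show UR: "U * R = R * U" .
  have "R * R = P * ((?E * ?E) * Q)" unfolding R_def by (simp add: assoc cancel2 del: mat_diag_diag)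
  also have "?E * ?E = ?E" unfolding mat_diag_diag by (rule arg_cong[of _ _ "mat_diag n"]) auto
  also have "P * (?E * Q) = R" unfolding R_def by (simp add: assoc)
  finally have RR: "R * R = R" .
  have pow: "(U * R) ^\<^sub>m Suc k = U ^\<^sub>m Suc k * R" for k
  proof (induction k)
    case (Suc k)
    have Uk: "U ^\<^sub>m m \<in> carrier_mat n n" for m using U by simp
    have "(U * R) ^\<^sub>m Suc (Suc k) = (U ^\<^sub>m Suc k * R) * (U * R)"
      using Suc by simp
    also have "\<dots> = U ^\<^sub>m Suc k * ((R * U) * R)"
      using R Uk[of "Suc k"] by (simp only: assoc U mult_carrier_mat[of _ n n _ n])
    also have "\<dots> = U ^\<^sub>m Suc k * (U * (R * R))"
      unfolding UR[symmetric] using R by (simp only: assoc U)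
    also have "\<dots> = U ^\<^sub>m Suc (Suc k) * R"
      unfolding RR using R Uk[of "Suc k"] by (simp only: assoc U pow_mat.simps)
    finally show ?case .
  qed (use R U in simp)
  have "(U * R) ^\<^sub>m Suc N = U * R" unfolding pow using UN U R by (simp add: left_mult_one_mat[of _ n n])
  then show "algebraic_int (mat_trace (U * R))"
    by (intro algebraic_int_trace_of_periodic[of _ n N]) (use U R N in auto)
qed

text \<open>
  The preceding results for kernels on an index set instead of matrices. The hypothesis excludes
  Jordan chains; \<open>F \<kappa>\<close> is the kernel of the projection to the eigenspace of \<open>\<kappa>\<close>, and \<open>d \<kappa>\<close> is the
  dimension of this space. The last property concerns permutations \<open>\<tau>\<close> of the index set which
  commute with \<open>L\<close>: \<open>F \<kappa>\<close> is invariant under \<open>\<tau>\<close> and the trace of \<open>\<tau>\<close> on the eigenspace is an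
  algebraic integer.
\<close>

lemma spectral_projections:
  fixes L :: "'a \<Rightarrow> 'a \<Rightarrow> complex"
  assumes fin: "finite I"
    and ss: "\<And>\<kappa> v w. (\<And>a. a \<in> I \<Longrightarrow> (\<Sum>b\<in>I. L a b * v b) = \<kappa> * v a + w a) \<Longrightarrow>
      (\<And>a. a \<in> I \<Longrightarrow> (\<Sum>b\<in>I. L a b * w b) = \<kappa> * w a) \<Longrightarrow> (\<And>a. a \<in> I \<Longrightarrow> w a = 0)"
  obtains K F d where "finite K"
    "\<And>a b. a \<in> I \<Longrightarrow> b \<in> I \<Longrightarrow> (\<Sum>\<kappa>\<in>K. F \<kappa> a b) = of_bool (a = b)"
    "\<And>\<kappa> a b. a \<in> I \<Longrightarrow> b \<in> I \<Longrightarrow> (\<Sum>c\<in>I. L a c * F \<kappa> c b) = \<kappa> * F \<kappa> a b"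
    "\<And>\<kappa>. (\<Sum>a\<in>I. F \<kappa> a a) = of_nat (d \<kappa>)"
    "\<And>\<kappa> \<tau> N. bij_betw \<tau> I I \<Longrightarrow> (\<And>a b. a \<in> I \<Longrightarrow> b \<in> I \<Longrightarrow> L (\<tau> a) (\<tau> b) = L a b) \<Longrightarrow>
      N > 0 \<Longrightarrow> (\<And>a. a \<in> I \<Longrightarrow> (\<tau> ^^ N) a = a) \<Longrightarrow>
      (\<forall>a\<in>I. \<forall>b\<in>I. F \<kappa> (\<tau> a) (\<tau> b) = F \<kappa> a b) \<and> algebraic_int (\<Sum>a\<in>I. F \<kappa> (\<tau> a) a)"
proof -
  define n where "n = card I"
  obtain h where h: "bij_betw h {0..<n} I"
    using ex_bij_betw_nat_finite[OF fin] unfolding n_def by blast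
  have hI: "h i \<in> I" if "i < n" for i using h that by (auto simp: bij_betw_def)
  define g where "g = inv_into {0..<n} h"
  have g: "g a < n" "h (g a) = a" if "a \<in> I" for a
    using h that bij_betw_inv_into_right[OF h that] inv_into_into[of a h "{0..<n}"]
    by (auto simp: g_def bij_betw_def)
  have gh: "g (h i) = i" if "i < n" for i
    using h that by (simp add: g_def bij_betw_def inv_into_f_f)
  have sumh: "(\<Sum>i<n. f (h i)) = (\<Sum>a\<in>I. f a)" for f :: "'a \<Rightarrow> complex"
    using sum.reindex_bij_betw[OF h, of f] by (simp add: atLeast0LessThan)
  \<comment> \<open>The translation between kernels on \<open>I\<close> and matrices, along the numbering \<open>h\<close> with inverse \<open>g\<close>.\<close>
  define M where "M = (\<lambda>f. mat n n (\<lambda>(i,j). f (h i) (h j)) :: complex mat)"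
  have Mc [simp]: "M f \<in> carrier_mat n n" for f by (simp add: M_def)
  have Mi: "M f $$ (i,j) = f (h i) (h j)" if "i < n" "j < n" for f i j
    using that by (simp add: M_def)
  have M_mult: "M f * M f' = M (\<lambda>a b. \<Sum>c\<in>I. f a c * f' c b)" for f f'
    by (rule eq_matI)
      (auto simp: M_def scalar_prod_def atLeast0LessThan sumh[of "\<lambda>c. f (h _) c * f' c (h _)"])
  have M_cong: "M f = M f'" if "\<And>a b. a \<in> I \<Longrightarrow> b \<in> I \<Longrightarrow> f a b = f' a b" for f f'
    using that hI by (intro eq_matI) (auto simp: M_def)
  have M_tr: "mat_trace (M f) = (\<Sum>a\<in>I. f a a)" for f
    using sumh[of "\<lambda>a. f a a"] by (simp add: mat_trace_def M_def)
  have M_vec: "(M f *\<^sub>v u) $ i = (\<Sum>b\<in>I. f (h i) b * u $ (g b))"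
    if "u \<in> carrier_vec n" "i < n" for f u i
  proof -
    have "(M f *\<^sub>v u) $ i = (\<Sum>j<n. f (h i) (h j) * u $ (g (h j)))"
      using that by (auto simp: M_def scalar_prod_def atLeast0LessThan gh intro!: sum.cong)
    then show ?thesis using sumh[of "\<lambda>b. f (h i) b * u $ (g b)"] by simp
  qed
  obtain t P Q where sim: "similar_mat_wit (M L) (mat_diag n t) P Q"
  proof (rule semisimple_diagonalizable[OF Mc[of L]])
    fix \<kappa> v w
    assume v: "v \<in> carrier_vec n" and w: "w \<in> carrier_vec n"
      and Lv: "M L *\<^sub>v v = \<kappa> \<cdot>\<^sub>v v + w" and Lw: "M L *\<^sub>v w = \<kappa> \<cdot>\<^sub>v w"
    have 1: "(\<Sum>b\<in>I. L a b * v $ (g b)) = \<kappa> * v $ (g a) + w $ (g a)" if "a \<in> I" for a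
      using M_vec[OF v g(1)[OF that], of L] v w g[OF that] unfolding Lv by simp
    have 2: "(\<Sum>b\<in>I. L a b * w $ (g b)) = \<kappa> * w $ (g a)" if "a \<in> I" for a
      using M_vec[OF w g(1)[OF that], of L] v w g[OF that] unfolding Lw by simp
    have "w $ (g a) = 0" if "a \<in> I" for a
      using ss[of "\<lambda>a. v $ (g a)" \<kappa> "\<lambda>a. w $ (g a)", OF 1 2 that] .
    then have "w $ i = 0" if "i < n" for i using hI[OF that] gh[OF that] by metis
    then show "w = 0\<^sub>v n" using w by (intro eq_vecI) auto
  qed (rule that)
  note D = similar_mat_witD2[OF Mc[of L] sim]
  note [simp] = mult_carrier_mat[of _ n n _ n]
  note assoc = assoc_mult_mat[of _ n n _ n _ n]
  have PQc [simp]: "P \<in> carrier_mat n n" "Q \<in> carrier_mat n n" using D by auto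
  define E where "E = (\<lambda>\<kappa>. mat_diag n (\<lambda>i. of_bool (t i = \<kappa>)) :: complex mat)"
  have Ec [simp]: "E \<kappa> \<in> carrier_mat n n" for \<kappa> by (simp add: E_def)
  define R where "R = (\<lambda>\<kappa>. P * E \<kappa> * Q)"
  have Rc [simp]: "R \<kappa> \<in> carrier_mat n n" for \<kappa> by (simp add: R_def)
  define F where "F = (\<lambda>\<kappa> a b. R \<kappa> $$ (g a, g b))"
  have R: "R \<kappa> = M (F \<kappa>)" for \<kappa>
    using carrier_matD[OF Rc[of \<kappa>]] by (intro eq_matI) (auto simp: M_def F_def gh)
  have M_eqD: "f a b = f' a b" if "M f = M f'" "a \<in> I" "b \<in> I" for f f' a b
    using Mi[of "g a" "g b" f] Mi[of "g a" "g b" f'] g that by simp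
  define d where "d = (\<lambda>\<kappa>. card {i. i < n \<and> t i = \<kappa>})"
  show thesis
  proof (rule that[of "t ` {..<n}" F d])
    fix a b assume ab: "a \<in> I" "b \<in> I"
    have Rs: "R \<kappa> $$ (i,j) = (\<Sum>k<n. P $$ (i,k) * of_bool (t k = \<kappa>) * Q $$ (k,j))"
      if "i < n" "j < n" for \<kappa> i j
      unfolding R_def E_def mat_diag_mult_right[OF PQc(1)]
      using that carrier_matD[OF PQc(2)] by (simp add: scalar_prod_def atLeast0LessThan)
    have "(\<Sum>\<kappa>\<in>t ` {..<n}. F \<kappa> a b)
        = (\<Sum>k<n. \<Sum>\<kappa>\<in>t ` {..<n}. P $$ (g a,k) * of_bool (t k = \<kappa>) * Q $$ (k,g b))"
      unfolding F_def using g ab by (simp add: Rs sum.swap[of _ "{..<n}"])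
    also have "\<dots> = (\<Sum>k<n. \<Sum>\<kappa>\<in>t ` {..<n}. if \<kappa> = t k then P $$ (g a,k) * Q $$ (k,g b) else 0)"
      by (intro sum.cong) auto
    also have "\<dots> = (\<Sum>k<n. P $$ (g a,k) * Q $$ (k,g b))"
      by (intro sum.cong) auto
    also have "\<dots> = (P * Q) $$ (g a, g b)"
      using g ab carrier_matD[OF PQc(1)] carrier_matD[OF PQc(2)]
      by (simp add: scalar_prod_def atLeast0LessThan)
    also have "\<dots> = of_bool (a = b)"
      unfolding D(1) using g ab by (auto simp: of_bool_def) (metis g(2))
    finally show "(\<Sum>\<kappa>\<in>t ` {..<n}. F \<kappa> a b) = of_bool (a = b)" .
  next
    fix \<kappa> a b assume ab: "a \<in> I" "b \<in> I"
    have "M L * R \<kappa> = P * (mat_diag n t * (Q * P)) * (E \<kappa> * Q)"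
      unfolding R_def by (subst (1) D(3)) (simp add: assoc)
    also have "\<dots> = P * (mat_diag n t * E \<kappa>) * Q"
      unfolding D(2) by (simp add: assoc right_mult_one_mat[of _ n n])
    also have "mat_diag n t * E \<kappa> = \<kappa> \<cdot>\<^sub>m E \<kappa>"
      unfolding E_def mat_diag_diag by (rule eq_matI) (auto simp: mat_diag_def)
    also have "P * (\<kappa> \<cdot>\<^sub>m E \<kappa>) * Q = \<kappa> \<cdot>\<^sub>m R \<kappa>"
      unfolding R_def by (simp add: mult_smult_distrib[of _ n n _ n] mult_smult_assoc_mat[of _ n n _ n])
    also have "\<dots> = M (\<lambda>a b. \<kappa> * F \<kappa> a b)" unfolding R by (rule eq_matI) (auto simp: M_def)
    finally have "M (\<lambda>a b. \<Sum>c\<in>I. L a c * F \<kappa> c b) = M (\<lambda>a b. \<kappa> * F \<kappa> a b)"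
      unfolding R M_mult .
    from M_eqD[OF this ab] show "(\<Sum>c\<in>I. L a c * F \<kappa> c b) = \<kappa> * F \<kappa> a b" .
  next
    fix \<kappa>
    have "(\<Sum>a\<in>I. F \<kappa> a a) = mat_trace (P * (E \<kappa> * Q))"
      unfolding M_tr[symmetric] R[symmetric] by (simp add: R_def assoc)
    also have "\<dots> = mat_trace ((E \<kappa> * Q) * P)" by (rule mat_trace_mult_commute[of _ n]) auto
    also have "(E \<kappa> * Q) * P = E \<kappa>"
      using D(2) by (simp add: assoc right_mult_one_mat[of _ n n])
    also have "mat_trace (E \<kappa>) = (\<Sum>i<n. of_bool (t i = \<kappa>))"
      by (simp add: mat_trace_def E_def mat_diag_def)
    also have "\<dots> = of_nat (d \<kappa>)"
      by (simp add: d_def of_bool_def sum.If_cases Int_def)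
    finally show "(\<Sum>a\<in>I. F \<kappa> a a) = of_nat (d \<kappa>)" .
  next
    fix \<kappa> \<tau> N
    assume \<tau>: "bij_betw \<tau> I I" and L\<tau>: "\<And>a b. a \<in> I \<Longrightarrow> b \<in> I \<Longrightarrow> L (\<tau> a) (\<tau> b) = L a b"
      and N: "N > 0" "\<And>a. a \<in> I \<Longrightarrow> (\<tau> ^^ N) a = a"
    have \<tau>I: "\<tau> a \<in> I" if "a \<in> I" for a using \<tau> that by (auto simp: bij_betw_def)
    have \<tau>pI: "(\<tau> ^^ k) a \<in> I" if "a \<in> I" for k a using that \<tau>I by (induction k) auto
    \<comment> \<open>The permutation matrix of the \<open>k\<close>-th iterate of \<open>\<tau>\<close>.\<close>
    define U where "U = (\<lambda>k. M (\<lambda>a b. of_bool ((\<tau> ^^ k) a = b)))"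
    have left: "U k * M f = M (\<lambda>a b. f ((\<tau> ^^ k) a) b)" for k f
    proof -
      have "(\<Sum>c\<in>I. of_bool ((\<tau> ^^ k) a = c) * f c b) = f ((\<tau> ^^ k) a) b" if "a \<in> I" for a b
        using \<tau>pI[OF that, of k] fin by (simp add: of_bool_def if_distrib[of "\<lambda>x. x * _"] cong: if_cong)
      then show ?thesis unfolding U_def M_mult by (intro M_cong) simp
    qed
    have right: "M f * U 1 = M (\<lambda>a b. f a (inv_into I \<tau> b))" for f
    proof -
      have "(\<Sum>c\<in>I. f a c * of_bool (\<tau> c = b)) = f a (inv_into I \<tau> b)" if b: "b \<in> I" for a b
      proof -
        have "inv_into I \<tau> b \<in> I" "\<And>c. c \<in> I \<Longrightarrow> \<tau> c = b \<longleftrightarrow> c = inv_into I \<tau> b"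
          using \<tau> b by (auto simp: bij_betw_def inv_into_into f_inv_into_f inv_into_f_f)
        then show ?thesis using fin
          by (simp add: of_bool_def if_distrib[of "\<lambda>x. _ * x"] cong: if_cong sum.cong)
      qed
      then show ?thesis unfolding U_def M_mult by (intro M_cong) simp
    qed
    have comm_iff: "U 1 * M f = M f * U 1 \<longleftrightarrow> (\<forall>a\<in>I. \<forall>b\<in>I. f (\<tau> a) (\<tau> b) = f a b)" for f
    proof
      assume "U 1 * M f = M f * U 1"
      then have *: "f (\<tau> a) b = f a (inv_into I \<tau> b)" if "a \<in> I" "b \<in> I" for a b
        using M_eqD[of "\<lambda>a b. f ((\<tau> ^^ 1) a) b" "\<lambda>a b. f a (inv_into I \<tau> b)", OF _ that]
        unfolding left right by simp
      show "\<forall>a\<in>I. \<forall>b\<in>I. f (\<tau> a) (\<tau> b) = f a b"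
        using *[OF _ \<tau>I] \<tau> by (simp add: bij_betw_def inv_into_f_f)
    next
      assume *: "\<forall>a\<in>I. \<forall>b\<in>I. f (\<tau> a) (\<tau> b) = f a b"
      have "f (\<tau> a) b = f a (inv_into I \<tau> b)" if "a \<in> I" "b \<in> I" for a b
        using *[rule_format, of a "inv_into I \<tau> b"] \<tau> that
        by (simp add: bij_betw_def inv_into_into f_inv_into_f)
      then show "U 1 * M f = M f * U 1" unfolding left right by (intro M_cong) simp
    qed
    have pow: "U 1 ^\<^sub>m k = U k" for k
    proof (induction k)
      case 0
      show ?case by (rule eq_matI) (use h in \<open>auto simp: U_def M_def bij_betw_def inj_on_eq_iff\<close>)
    next
      case (Suc k)
      have "U 1 ^\<^sub>m Suc k = U k * M (\<lambda>a b. of_bool (\<tau> a = b))" using Suc by (simp add: U_def)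
      then show ?case unfolding left by (simp add: U_def)
    qed
    have "U N = U 0" unfolding U_def using N(2) by (intro M_cong) simp
    then have UN: "U 1 ^\<^sub>m N = 1\<^sub>m n" using pow[of N] pow[of 0] by (simp add: U_def M_def)
    have Uc: "U 1 \<in> carrier_mat n n" by (simp add: U_def)
    have UL: "U 1 * M L = M L * U 1" unfolding comm_iff using L\<tau> by blast
    note T = commuting_finite_order_trace[OF Mc sim Uc UL N(1) UN, of \<kappa>]
    have RF: "P * mat_diag n (\<lambda>i. of_bool (t i = \<kappa>)) * Q = M (F \<kappa>)"
      using R[of \<kappa>] by (simp add: R_def E_def)
    show "(\<forall>a\<in>I. \<forall>b\<in>I. F \<kappa> (\<tau> a) (\<tau> b) = F \<kappa> a b) \<and> algebraic_int (\<Sum>a\<in>I. F \<kappa> (\<tau> a) a)"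
      using T(1)[unfolded RF comm_iff] T(2)[unfolded RF left M_tr] by simp
  qed simp
qed

section \<open>Class sums acting on the functions on a finite group\<close>

text \<open>
  If the sum has the largest norm that the bound on its terms permits, all terms point in the
  direction \<open>u\<close> of the sum and have the same length, so each of them is the average.
\<close>

lemma equality_in_triangle_sum:
  fixes z :: "'b \<Rightarrow> complex" and M :: real
  assumes fin: "finite C" and le: "\<And>x. x \<in> C \<Longrightarrow> norm (z x) \<le> M"
    and eq: "norm (\<Sum>x\<in>C. z x) = card C * M" and x: "x \<in> C" and M: "M > 0"
  shows "of_nat (card C) * z x = (\<Sum>x\<in>C. z x)"
proof -
  define S where "S = (\<Sum>x\<in>C. z x)"
  have cpos: "card C > 0" using fin x card_gt_0_iff by blast
  then have S0: "norm S > 0" using eq M by (simp add: S_def)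
  \<comment> \<open>Multiplication with \<open>cnj u\<close> turns the sum into a positive real number, so the real parts of
    the terms must all reach the bound \<open>M\<close>.\<close>
  define u where "u = S / norm S"
  have u: "norm u = 1" "u * cnj u = 1" using S0
    by (auto simp: u_def norm_divide complex_norm_square[symmetric] power2_eq_square)
  have r: "Re (z y * cnj u) \<le> M" if "y \<in> C" for y
    using complex_Re_le_cmod[of "z y * cnj u"] le[OF that] u(1) by (simp add: norm_mult)
  have "(\<Sum>y\<in>C. Re (z y * cnj u)) = Re (S * cnj u)"
    by (simp add: S_def sum_distrib_right)
  also have "S * cnj u = norm S"
  proof -
    have "S = norm S * u" using S0 by (simp add: u_def)
    then show ?thesis using u(2) by (metis mult.assoc mult.right_neutral)
  qed
  also have "Re (norm S) = (\<Sum>y\<in>C. M)" using eq by (simp add: S_def)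
  finally have "(\<Sum>y\<in>C. M - Re (z y * cnj u)) = 0" by (simp add: sum_subtractf)
  then have Re: "Re (z x * cnj u) = M"
    using sum_nonneg_eq_0_iff[of C "\<lambda>y. M - Re (z y * cnj u)"] fin x r by auto
  have "norm (z x * cnj u) \<le> M" using le[OF x] u(1) by (simp add: norm_mult)
  then have "(Im (z x * cnj u))\<^sup>2 \<le> 0"
    using Re M power_mono[of "norm (z x * cnj u)" M 2] by (simp add: cmod_power2)
  then have "z x * cnj u = M" using Re by (simp add: complex_eq_iff)
  then have "z x = M * u" using u(2)
    by (metis mult.assoc mult.commute mult.right_neutral)
  then show ?thesis using eq M cpos by (simp add: u_def S_def)
qed

definition (in monoid) conj_class :: "'a \<Rightarrow> 'a set" where
  "conj_class g = (\<lambda>x. x \<otimes> g \<otimes> inv x) ` carrier G"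

context group
begin

lemma conj_class_closed: "g \<in> carrier G \<Longrightarrow> x \<in> conj_class g \<Longrightarrow> x \<in> carrier G"
  by (auto simp: conj_class_def)

lemma cancel_inv_left:
  assumes "x \<in> carrier G" "y \<in> carrier G"
  shows "inv x \<otimes> (x \<otimes> y) = y" "x \<otimes> (inv x \<otimes> y) = y"
  using assms by (simp_all flip: m_assoc)

lemma conj_class_conj:
  assumes "g \<in> carrier G" "x \<in> conj_class g" "y \<in> carrier G"
  shows "y \<otimes> x \<otimes> inv y \<in> conj_class g"
proof -
  obtain z where z: "z \<in> carrier G" "x = z \<otimes> g \<otimes> inv z" using assms by (auto simp: conj_class_def)
  have "y \<otimes> x \<otimes> inv y = (y \<otimes> z) \<otimes> g \<otimes> inv (y \<otimes> z)"
    using z assms by (simp add: m_assoc inv_mult_group)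
  then show ?thesis using z assms by (auto simp: conj_class_def)
qed

lemma bij_betw_conj_class:
  assumes g: "g \<in> carrier G" and y: "y \<in> carrier G"
  shows "bij_betw (\<lambda>x. y \<otimes> x \<otimes> inv y) (conj_class g) (conj_class g)"
proof (rule bij_betw_byWitness[where f' = "\<lambda>x. inv y \<otimes> x \<otimes> inv (inv y)"])
  show "(\<lambda>x. y \<otimes> x \<otimes> inv y) ` conj_class g \<subseteq> conj_class g"
    "(\<lambda>x. inv y \<otimes> x \<otimes> inv (inv y)) ` conj_class g \<subseteq> conj_class g"
    using conj_class_conj[OF g _ y] conj_class_conj[OF g _ inv_closed[OF y]] by blast+
qed (use conj_class_closed[OF g] y in \<open>auto simp: m_assoc cancel_inv_left\<close>)

lemma bij_betw_translation:
  assumes y: "y \<in> carrier G" and z: "z \<in> carrier G"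
  shows "bij_betw (\<lambda>a. y \<otimes> a \<otimes> z) (carrier G) (carrier G)"
  by (rule bij_betw_byWitness[where f' = "\<lambda>a. inv y \<otimes> a \<otimes> inv z"])
    (use y z in \<open>auto simp: m_assoc cancel_inv_left\<close>)

lemma sum_translation:
  assumes "y \<in> carrier G" "z \<in> carrier G"
  shows "(\<Sum>a\<in>carrier G. f (y \<otimes> a \<otimes> z)) = (\<Sum>a\<in>carrier G. f a)"
  using sum.reindex_bij_betw[OF bij_betw_translation[OF assms], of f] by simp

lemma sum_left_translation:
  assumes "y \<in> carrier G"
  shows "(\<Sum>a\<in>carrier G. f (y \<otimes> a)) = (\<Sum>a\<in>carrier G. f a)"
  using sum_translation[OF assms one_closed, of f] assms by simp

text \<open>
  Both sides count the pairs of an \<open>a\<close> in the group and an \<open>x\<close> in the class, weighted with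
  \<open>f (a x a\<inverse>)\<close>: for fixed \<open>x\<close> one averages over the group, for fixed \<open>a\<close> conjugation permutes
  the class.
\<close>

lemma sum_conjugates:
  fixes f :: "'a \<Rightarrow> complex"
  assumes fin: "finite (carrier G)" and g: "g \<in> carrier G"
  shows "of_nat (card (conj_class g)) * (\<Sum>a\<in>carrier G. f (a \<otimes> g \<otimes> inv a))
    = of_nat (Coset.order G) * (\<Sum>x\<in>conj_class g. f x)"
proof -
  have "(\<Sum>a\<in>carrier G. f (a \<otimes> x \<otimes> inv a)) = (\<Sum>a\<in>carrier G. f (a \<otimes> g \<otimes> inv a))"
    if "x \<in> conj_class g" for x
  proof -
    from \<open>x \<in> conj_class g\<close> obtain b where b: "b \<in> carrier G" "x = b \<otimes> g \<otimes> inv b"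
      by (auto simp: conj_class_def)
    have "(\<Sum>a\<in>carrier G. f (a \<otimes> x \<otimes> inv a))
        = (\<Sum>a\<in>carrier G. f ((\<one> \<otimes> a \<otimes> b) \<otimes> g \<otimes> inv (\<one> \<otimes> a \<otimes> b)))"
      using b g by (intro sum.cong) (auto simp: m_assoc inv_mult_group)
    also have "\<dots> = (\<Sum>a\<in>carrier G. f (a \<otimes> g \<otimes> inv a))"
      by (rule sum_translation) (use b in auto)
    finally show ?thesis .
  qed
  then have "of_nat (card (conj_class g)) * (\<Sum>a\<in>carrier G. f (a \<otimes> g \<otimes> inv a))
      = (\<Sum>x\<in>conj_class g. \<Sum>a\<in>carrier G. f (a \<otimes> x \<otimes> inv a))" by simp
  also have "\<dots> = (\<Sum>a\<in>carrier G. \<Sum>x\<in>conj_class g. f (a \<otimes> x \<otimes> inv a))" by (rule sum.swap)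
  also have "\<dots> = (\<Sum>a\<in>carrier G. \<Sum>x\<in>conj_class g. f x)"
    by (intro sum.cong HOL.refl sum.reindex_bij_betw[OF bij_betw_conj_class[OF g]])
  finally show ?thesis by (simp add: Coset.order_def)
qed

text \<open>
  The class operator sends \<open>v\<close> to the sum of its left translates by the elements of the class.
  As a matrix indexed by the group it has entries 0 and 1, which makes its eigenvalues
  algebraic integers.
\<close>

lemma class_operator_as_matrix:
  fixes v :: "'a \<Rightarrow> complex"
  assumes fin: "finite (carrier G)" and g: "g \<in> carrier G" and a: "a \<in> carrier G"
  shows "(\<Sum>b\<in>carrier G. of_bool (a \<otimes> inv b \<in> conj_class g) * v b)
    = (\<Sum>x\<in>conj_class g. v (inv x \<otimes> a))"
proof -
  have bij: "bij_betw (\<lambda>x. inv x \<otimes> a) (conj_class g) {b \<in> carrier G. a \<otimes> inv b \<in> conj_class g}"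
    by (rule bij_betw_byWitness[where f' = "\<lambda>b. a \<otimes> inv b"])
      (use conj_class_closed[OF g] a in \<open>auto simp: inv_mult_group m_assoc cancel_inv_left\<close>)
  have "(\<Sum>b\<in>carrier G. of_bool (a \<otimes> inv b \<in> conj_class g) * v b)
      = (\<Sum>b\<in>{b \<in> carrier G. a \<otimes> inv b \<in> conj_class g}. v b)"
    using fin by (intro sum.mono_neutral_cong_right) auto
  then show ?thesis using sum.reindex_bij_betw[OF bij, of v] by simp
qed

text \<open>
  The adjoint of the class operator is the class operator of the inverse class, and class operators
  commute. So \<open>T\<close>, the class operator minus \<open>\<kappa>\<close>, is normal; a normal operator and its adjoint
  \<open>T'\<close> have the same kernel. From \<open>T w = 0\<close> follows \<open>T' w = 0\<close>, and then
  \<open>w = T v\<close> is orthogonal to itself.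
\<close>

lemma class_operator_semisimple:
  fixes v w :: "'a \<Rightarrow> complex"
  assumes fin: "finite (carrier G)" and g: "g \<in> carrier G"
    and v: "\<And>a. a \<in> carrier G \<Longrightarrow> (\<Sum>x\<in>conj_class g. v (inv x \<otimes> a)) = \<kappa> * v a + w a"
    and w: "\<And>a. a \<in> carrier G \<Longrightarrow> (\<Sum>x\<in>conj_class g. w (inv x \<otimes> a)) = \<kappa> * w a"
    and a: "a \<in> carrier G"
  shows "w a = 0"
proof -
  let ?C = "conj_class g"
  have C: "x \<in> carrier G" if "x \<in> ?C" for x using conj_class_closed[OF g that] .
  define ip where "ip = (\<lambda>f h :: 'a \<Rightarrow> complex. \<Sum>a\<in>carrier G. f a * cnj (h a))"
  define T where "T = (\<lambda>f a. (\<Sum>x\<in>?C. f (inv x \<otimes> a)) - \<kappa> * f a)"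
  define T' where "T' = (\<lambda>f a. (\<Sum>x\<in>?C. f (x \<otimes> a)) - cnj \<kappa> * f a)"
  have adj: "ip (T f) h = ip f (T' h)" for f h
  proof -
    have "(\<Sum>a\<in>carrier G. f (inv x \<otimes> a) * cnj (h a)) = (\<Sum>a\<in>carrier G. f a * cnj (h (x \<otimes> a)))"
      if "x \<in> ?C" for x
    proof -
      have "(\<Sum>a\<in>carrier G. f (inv x \<otimes> a) * cnj (h a))
          = (\<Sum>a\<in>carrier G. f (inv x \<otimes> (x \<otimes> a)) * cnj (h (x \<otimes> a)))"
        using sum_left_translation[OF C[OF that], of "\<lambda>a. f (inv x \<otimes> a) * cnj (h a)"] by simp
      then show ?thesis using C[OF that] by (simp add: cancel_inv_left)
    qed
    then have "(\<Sum>x\<in>?C. \<Sum>a\<in>carrier G. f (inv x \<otimes> a) * cnj (h a))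
        = (\<Sum>x\<in>?C. \<Sum>a\<in>carrier G. f a * cnj (h (x \<otimes> a)))" by simp
    then have "(\<Sum>a\<in>carrier G. \<Sum>x\<in>?C. f (inv x \<otimes> a) * cnj (h a))
        = (\<Sum>a\<in>carrier G. \<Sum>x\<in>?C. f a * cnj (h (x \<otimes> a)))"
      by (simp only: sum.swap[of _ "carrier G" ?C])
    then show ?thesis
      unfolding ip_def T_def T'_def
      by (simp add: algebra_simps sum_subtractf sum_distrib_left)
  qed
  have ipc: "ip h f = cnj (ip f h)" for f h by (simp add: ip_def mult.commute)
  have comm: "T (T' f) a = T' (T f) a" if a: "a \<in> carrier G" for f a
  proof -
    have "(\<Sum>x\<in>?C. \<Sum>y\<in>?C. f (y \<otimes> (inv x \<otimes> a))) = (\<Sum>x\<in>?C. \<Sum>y\<in>?C. f (inv x \<otimes> (y \<otimes> a)))"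
    proof (rule sum.cong)
      fix x assume x: "x \<in> ?C"
      have "(\<Sum>y\<in>?C. f (y \<otimes> (inv x \<otimes> a))) = (\<Sum>y\<in>?C. f (inv x \<otimes> ((x \<otimes> y \<otimes> inv x) \<otimes> a)))"
        using x C a by (intro sum.cong) (auto simp: m_assoc cancel_inv_left)
      also have "\<dots> = (\<Sum>y\<in>?C. f (inv x \<otimes> (y \<otimes> a)))"
        using sum.reindex_bij_betw[OF bij_betw_conj_class[OF g C[OF x]], of "\<lambda>y. f (inv x \<otimes> (y \<otimes> a))"] .
      finally show "(\<Sum>y\<in>?C. f (y \<otimes> (inv x \<otimes> a))) = (\<Sum>y\<in>?C. f (inv x \<otimes> (y \<otimes> a)))" .
    qed simp
    also have "\<dots> = (\<Sum>y\<in>?C. \<Sum>x\<in>?C. f (inv x \<otimes> (y \<otimes> a)))" by (rule sum.swap)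
    finally show ?thesis
      unfolding T_def T'_def by (simp add: algebra_simps sum_subtractf sum_distrib_left)
  qed
  have ip0: "f a = 0" if "ip f f = 0" "a \<in> carrier G" for f a
  proof -
    have "(\<Sum>a\<in>carrier G. (norm (f a))\<^sup>2) = 0"
      using that(1) unfolding ip_def complex_norm_square[symmetric] of_real_sum[symmetric] of_real_eq_0_iff .
    then show ?thesis using that(2) fin by (simp add: sum_nonneg_eq_0_iff)
  qed
  have ip_cong: "ip f h = ip f' h'"
    if "\<And>a. a \<in> carrier G \<Longrightarrow> f a = f' a" "\<And>a. a \<in> carrier G \<Longrightarrow> h a = h' a" for f h f' h'
    using that by (simp add: ip_def)
  have Tw: "T w a = 0" if "a \<in> carrier G" for a using w[OF that] by (simp add: T_def)
  have Tv: "T v a = w a" if "a \<in> carrier G" for a using v[OF that] by (simp add: T_def)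
  have zero: "T' (T w) a = 0" if "a \<in> carrier G" for a
    using Tw C that by (simp add: T'_def)
  have "ip (T' w) (T' w) = ip (T (T' w)) w" by (simp add: adj)
  also have "\<dots> = ip (\<lambda>_. 0) w" by (rule ip_cong) (simp_all add: comm zero)
  finally have "ip (T' w) (T' w) = 0" by (simp add: ip_def)
  then have T'w: "T' w a = 0" if "a \<in> carrier G" for a using ip0 that by blast
  have "ip w w = ip (T v) w" by (rule ip_cong) (simp_all add: Tv)
  also have "\<dots> = ip v (\<lambda>_. 0)" unfolding adj by (rule ip_cong) (simp_all add: T'w)
  finally have "ip w w = 0" by (simp add: ip_def)
  then show ?thesis using ip0 a by blast
qed

text \<open>
  Evaluate the eigenvalue equation at a point where \<open>v\<close> has the largest norm.
\<close>

lemma class_eigenfunction_norm_le: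
  fixes v :: "'a \<Rightarrow> complex"
  assumes fin: "finite (carrier G)" and g: "g \<in> carrier G"
    and v: "\<And>a. a \<in> carrier G \<Longrightarrow> (\<Sum>x\<in>conj_class g. v (inv x \<otimes> a)) = \<kappa> * v a"
    and nz: "z \<in> carrier G" "v z \<noteq> 0"
  shows "norm \<kappa> \<le> card (conj_class g)"
proof -
  define M where "M = Max ((\<lambda>a. norm (v a)) ` carrier G)"
  have M: "norm (v a) \<le> M" if "a \<in> carrier G" for a using fin that by (auto simp: M_def)
  have "M \<in> (\<lambda>a. norm (v a)) ` carrier G" unfolding M_def using fin nz by (intro Max_in) auto
  then obtain b where b: "b \<in> carrier G" "norm (v b) = M" by auto
  have M0: "M > 0" using M[OF nz(1)] nz(2) by (smt (verit) zero_less_norm_iff)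
  have "norm \<kappa> * M = norm (\<Sum>x\<in>conj_class g. v (inv x \<otimes> b))" using v[OF b(1)] b(2) by (simp add: norm_mult)
  also have "\<dots> \<le> (\<Sum>x\<in>conj_class g. M)"
    using conj_class_closed[OF g] b(1) by (intro sum_norm_le M) auto
  finally show ?thesis using M0 by simp
qed

text \<open>
  Let \<open>T\<close> be the set of points where the norm of \<open>v\<close> is maximal. If \<open>\<kappa>\<close> has the maximal norm,
  there is equality in the triangle inequality at each point of \<open>T\<close>, so translation by the inverse of a class
  element preserves \<open>T\<close> and multiplies \<open>v\<close> by a scalar there. The elements with this
  property form a subgroup \<open>A\<close>, which contains the normal subgroup generated by the class and thus is the
  whole group. Hence \<open>T\<close> is everything and \<open>v / v \<one>\<close> is a homomorphism to the scalars. Its kernel \<open>Z\<close>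
  is normal; if it were trivial, the group would be commutative and the class a single point.
\<close>

lemma class_eigenfunction_constant:
  fixes v :: "'a \<Rightarrow> complex"
  assumes fin: "finite (carrier G)" and g: "g \<in> carrier G"
    and simple: "\<And>N. N \<lhd> G \<Longrightarrow> N = {\<one>} \<or> N = carrier G"
    and big: "card (conj_class g) > 1"
    and v: "\<And>a. a \<in> carrier G \<Longrightarrow> (\<Sum>x\<in>conj_class g. v (inv x \<otimes> a)) = \<kappa> * v a"
    and nz: "z \<in> carrier G" "v z \<noteq> 0"
    and \<kappa>: "norm \<kappa> = card (conj_class g)"
    and a: "a \<in> carrier G"
  shows "v a = v \<one>" "v \<one> \<noteq> 0"
proof -
  let ?C = "conj_class g" and ?m = "of_nat (card (conj_class g)) :: complex"
  have C: "x \<in> carrier G" if "x \<in> ?C" for x using conj_class_closed[OF g that] .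
  have finC: "finite ?C" using fin by (simp add: conj_class_def)
  define M where "M = Max ((\<lambda>a. norm (v a)) ` carrier G)"
  have M: "norm (v a) \<le> M" if "a \<in> carrier G" for a using fin that by (auto simp: M_def)
  have "M \<in> (\<lambda>a. norm (v a)) ` carrier G" unfolding M_def using fin nz by (intro Max_in) auto
  then obtain b where b: "b \<in> carrier G" "norm (v b) = M" by auto
  have M0: "M > 0" using M[OF nz(1)] nz(2) by (smt (verit) zero_less_norm_iff)
  have m0: "?m \<noteq> 0" using big by auto
  define T where "T = {h \<in> carrier G. norm (v h) = M}"
  have finT: "finite T" using fin by (simp add: T_def)
  define A where "A = {y \<in> carrier G. \<exists>c. \<forall>h\<in>T. y \<otimes> h \<in> T \<and> v (y \<otimes> h) = c * v h}"
  have T0: "v h \<noteq> 0" if "h \<in> T" for h using that M0 by (auto simp: T_def)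
  have TG: "h \<in> carrier G" if "h \<in> T" for h using that by (simp add: T_def)
  have gen: "inv x \<in> A" if x: "x \<in> ?C" for x
  proof -
    have "v (inv x \<otimes> h) = \<kappa> / ?m * v h" if h: "h \<in> T" for h
    proof -
      have "?m * v (inv x \<otimes> h) = (\<Sum>x\<in>?C. v (inv x \<otimes> h))"
      proof (rule equality_in_triangle_sum[OF finC _ _ x M0])
        show "norm (v (inv y \<otimes> h)) \<le> M" if "y \<in> ?C" for y
          using M C[OF that] TG[OF h] by simp
        show "norm (\<Sum>x\<in>?C. v (inv x \<otimes> h)) = card ?C * M"
          using v[OF TG[OF h]] h \<kappa> by (simp add: norm_mult T_def)
      qed
      then show ?thesis using v[OF TG[OF h]] m0 by (simp add: field_simps)
    qed
    moreover from this have "inv x \<otimes> h \<in> T" if "h \<in> T" for h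
      using that \<kappa> m0 C[OF x] by (auto simp: T_def norm_mult norm_divide)
    ultimately have "\<forall>h\<in>T. inv x \<otimes> h \<in> T \<and> v (inv x \<otimes> h) = \<kappa> / ?m * v h" by blast
    then show ?thesis using C[OF x] unfolding A_def by blast
  qed
  have A: "subgroup A G"
  proof (rule subgroupI)
    show "A \<subseteq> carrier G" by (auto simp: A_def)
    have "\<one> \<in> A" using TG by (auto simp: A_def intro!: exI[of _ 1])
    then show "A \<noteq> {}" by auto
  next
    fix y assume y: "y \<in> A"
    then obtain c where yG: "y \<in> carrier G" and c: "\<And>h. h \<in> T \<Longrightarrow> y \<otimes> h \<in> T \<and> v (y \<otimes> h) = c * v h"
      by (auto simp: A_def)
    have "inj_on (\<lambda>h. y \<otimes> h) T" using yG TG by (auto simp: inj_on_def)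
    moreover have "(\<lambda>h. y \<otimes> h) ` T \<subseteq> T" using c by auto
    ultimately have surj: "(\<lambda>h. y \<otimes> h) ` T = T" using finT endo_inj_surj by blast
    have "inv y \<otimes> h \<in> T \<and> v (inv y \<otimes> h) = (1 / c) * v h" if h: "h \<in> T" for h
    proof -
      obtain k where k: "k \<in> T" "h = y \<otimes> k" using surj h by auto
      have "inv y \<otimes> h = k" using k yG TG by (simp add: cancel_inv_left)
      moreover have "c \<noteq> 0" using c[OF k(1)] T0 by force
      ultimately show ?thesis using k c[OF k(1)] by simp
    qed
    then have "\<forall>h\<in>T. inv y \<otimes> h \<in> T \<and> v (inv y \<otimes> h) = (1 / c) * v h" by blast
    then show "inv y \<in> A" using yG unfolding A_def by blast
  next
    fix y z assume "y \<in> A" "z \<in> A"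
    then obtain c d where yz: "y \<in> carrier G" "z \<in> carrier G"
      and c: "\<And>h. h \<in> T \<Longrightarrow> y \<otimes> h \<in> T \<and> v (y \<otimes> h) = c * v h"
      and d: "\<And>h. h \<in> T \<Longrightarrow> z \<otimes> h \<in> T \<and> v (z \<otimes> h) = d * v h"
      by (auto simp: A_def)
    have "(y \<otimes> z) \<otimes> h \<in> T \<and> v ((y \<otimes> z) \<otimes> h) = (c * d) * v h" if "h \<in> T" for h
      using c[of "z \<otimes> h"] d[OF that] yz TG[OF that] by (simp add: m_assoc)
    then have "\<forall>h\<in>T. (y \<otimes> z) \<otimes> h \<in> T \<and> v ((y \<otimes> z) \<otimes> h) = (c * d) * v h" by blast
    then show "y \<otimes> z \<in> A" using yz unfolding A_def by blast
  qed
  define N where "N = generate G ((\<lambda>x. inv x) ` ?C)"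
  have N: "N \<lhd> G" unfolding N_def
  proof (rule normal_generateI)
    show "(\<lambda>x. inv x) ` ?C \<subseteq> carrier G" using C by auto
    fix h y assume h: "h \<in> (\<lambda>x. inv x) ` ?C" and y: "y \<in> carrier G"
    then obtain x where x: "x \<in> ?C" "h = inv x" by auto
    have "y \<otimes> h \<otimes> inv y = inv (y \<otimes> x \<otimes> inv y)"
      using x C y by (simp add: inv_mult_group m_assoc)
    then show "y \<otimes> h \<otimes> inv y \<in> (\<lambda>x. inv x) ` ?C" using conj_class_conj[OF g x(1) y] by blast
  qed
  have N1: "N \<noteq> {\<one>}"
  proof
    assume N: "N = {\<one>}"
    have "x = \<one>" if "x \<in> ?C" for x
    proof -
      have "inv x \<in> N" using that by (auto simp: N_def intro: generate.incl)
      then show ?thesis using N C[OF that] by (simp add: inv_eq_1_iff)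
    qed
    then have "?C \<subseteq> {\<one>}" by blast
    then have "card ?C \<le> 1" using card_mono[of "{\<one>}" ?C] by simp
    then show False using big by simp
  qed
  have "N \<subseteq> A" unfolding N_def using generate_subgroup_incl[OF _ A] gen by blast
  then have AG: "A = carrier G" using simple[OF N] N1 by (auto simp: A_def)
  have "b \<in> T" using b by (simp add: T_def)
  have T: "h \<in> T" if h: "h \<in> carrier G" for h
  proof -
    have "h \<otimes> inv b \<in> A" using AG h b by simp
    then have "(h \<otimes> inv b) \<otimes> b \<in> T" using \<open>b \<in> T\<close> by (auto simp: A_def)
    then show ?thesis using h b by (simp add: m_assoc)
  qed
  have mult: "v (y \<otimes> h) * v \<one> = v y * v h" if y: "y \<in> carrier G" and h: "h \<in> carrier G" for y h
  proof -
    have "y \<in> A" using y AG by simp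
    then obtain c where c: "\<And>h. h \<in> T \<Longrightarrow> v (y \<otimes> h) = c * v h" unfolding A_def by blast
    show ?thesis using c[OF T[OF h]] c[OF T[OF one_closed]] y by simp
  qed
  show v1: "v \<one> \<noteq> 0" using T0 T one_closed by blast
  define Z where "Z = {y \<in> carrier G. v y = v \<one>}"
  have "subgroup Z G"
  proof (rule subgroupI)
    fix y assume "y \<in> Z"
    then have y: "y \<in> carrier G" "v y = v \<one>" by (auto simp: Z_def)
    have "v \<one> * v \<one> = v \<one> * v (inv y)" using mult[of y "inv y"] y by simp
    then show "inv y \<in> Z" using v1 y by (simp add: Z_def)
  next
    fix y z assume "y \<in> Z" "z \<in> Z"
    then show "y \<otimes> z \<in> Z" using mult[of y z] v1 by (auto simp: Z_def)
  qed (auto simp: Z_def)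
  moreover have "y \<otimes> z \<otimes> inv y \<in> Z" if "y \<in> carrier G" "z \<in> Z" for y z
  proof -
    have z: "z \<in> carrier G" "v z = v \<one>" using that by (auto simp: Z_def)
    have "v (y \<otimes> z) = v y" using mult[of y z] that z v1 by simp
    then have "v (y \<otimes> z \<otimes> inv y) * v \<one> = v \<one> * v \<one>"
      using mult[of "y \<otimes> z" "inv y"] mult[of y "inv y"] that z by simp
    then show ?thesis using v1 that z by (simp add: Z_def)
  qed
  ultimately have "Z \<lhd> G" by (auto simp: normal_inv_iff)
  then consider "Z = {\<one>}" | "Z = carrier G" using simple by blast
  then show "v a = v \<one>"
  proof cases
    case 1
    have "y \<otimes> g \<otimes> inv y = g" if y: "y \<in> carrier G" for y
    proof -
      have "v (y \<otimes> g) = v (g \<otimes> y)"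
        using mult[OF y g] mult[OF g y] v1 by (metis mult.commute mult_right_cancel)
      then have "v (y \<otimes> g \<otimes> inv (g \<otimes> y)) * v \<one> = v ((g \<otimes> y) \<otimes> inv (g \<otimes> y)) * v \<one>"
        using mult[of "y \<otimes> g" "inv (g \<otimes> y)"] mult[of "g \<otimes> y" "inv (g \<otimes> y)"] y g by simp
      then have "v (y \<otimes> g \<otimes> inv (g \<otimes> y)) = v \<one>" using v1 y g by simp
      then have "y \<otimes> g \<otimes> inv (g \<otimes> y) \<in> Z" using y g by (simp add: Z_def)
      then have "y \<otimes> g \<otimes> inv (g \<otimes> y) = \<one>" using 1 by simp
      then have "y \<otimes> g = g \<otimes> y" using y g by (metis inv_closed inv_equality inv_inv m_closed)
      then show ?thesis using y g by (simp add: m_assoc)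
    qed
    then have "?C \<subseteq> {g}" by (auto simp: conj_class_def)
    then have "card ?C \<le> 1" using card_mono[of "{g}" ?C] by simp
    then show ?thesis using big by simp
  next
    case 2
    then show ?thesis using a by (auto simp: Z_def)
  qed
qed

text \<open>
  Burnside's theorem on conjugacy classes. The eigenprojection kernels \<open>F \<kappa>\<close> are invariant under left and right
  translations, so they come from class functions \<open>p \<kappa>\<close> with \<open>F \<kappa> a b = p \<kappa> (a b\<inverse>)\<close>. With \<open>n\<close> the
  order of the group, \<open>m\<close> the size of the class and \<open>d \<kappa>\<close> the dimension of the
  eigenspace, the traces \<open>D \<kappa>\<close> of \<open>a \<mapsto> g\<inverse> a\<close> and \<open>E \<kappa>\<close> of \<open>a \<mapsto> g\<inverse> a g\<inverse>\<close> on the eigenspace are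
  algebraic integers with \<open>m D = \<kappa> d\<close> and \<open>m E = \<kappa> D\<close>, so \<open>D\<^sup>2 = d E\<close>.
  
  Let \<open>\<kappa> \<noteq> m\<close>. If \<open>q\<close> does not divide \<open>d \<kappa>\<close>, a Bezout combination shows that \<open>\<kappa> / m\<close> is an algebraic
  integer; by simplicity its norm is below 1, and its conjugates have norm at most 1, hence it is 0, and
  \<open>D \<kappa> = 0\<close>. If \<open>q\<close> divides \<open>d \<kappa>\<close>, then \<open>D\<^sup>2 / q = (d / q) E\<close> is an algebraic integer. In both
  cases \<open>D \<kappa>\<close> is \<open>\<surd>q\<close> times an algebraic integer. For \<open>\<kappa> = m\<close> the eigenspace consists of the
  constants and \<open>D m = 1\<close>. As the traces \<open>D \<kappa>\<close> add up to the trace of a translation without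
  fixed points, which is 0, this gives \<open>-1 = \<surd>q s\<close> with \<open>s\<close> an algebraic integer; then
  \<open>1 / q = s\<^sup>2\<close> is one too, which is absurd.
\<close>

theorem simple_group_class_not_prime_power:
  assumes fin: "finite (carrier G)" and g: "g \<in> carrier G"
    and simple: "\<And>N. N \<lhd> G \<Longrightarrow> N = {\<one>} \<or> N = carrier G"
    and q: "prime q" and card: "card (conj_class g) = q ^ j" and j: "j > 0"
  shows False
proof -
  let ?C = "conj_class g"
  define m where "m = card ?C"
  define n where "n = Coset.order G"
  have C: "x \<in> carrier G" if "x \<in> ?C" for x using conj_class_closed[OF g that] .
  have m1: "m > 1" using q j unfolding m_def card by (metis one_less_power prime_gt_1_nat)
  have n0: "n > 0" using fin by (auto simp: n_def order_gt_0_iff_finite)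
  define L where "L = (\<lambda>a b. of_bool (a \<otimes> inv b \<in> ?C) :: complex)"
  have Lsum: "(\<Sum>b\<in>carrier G. L a b * v b) = (\<Sum>x\<in>?C. v (inv x \<otimes> a))"
    if "a \<in> carrier G" for a and v :: "'a \<Rightarrow> complex"
    unfolding L_def by (rule class_operator_as_matrix[OF fin g that])
  have ss: "w a = 0"
    if "\<And>a. a \<in> carrier G \<Longrightarrow> (\<Sum>b\<in>carrier G. L a b * v b) = \<kappa> * v a + w a"
      "\<And>a. a \<in> carrier G \<Longrightarrow> (\<Sum>b\<in>carrier G. L a b * w b) = \<kappa> * w a" "a \<in> carrier G"
    for \<kappa> v w a
    by (rule class_operator_semisimple[OF fin g, of v \<kappa> w]) (use that Lsum in auto)
  obtain K F d where finK: "finite K"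
    and F_one: "\<And>a b. a \<in> carrier G \<Longrightarrow> b \<in> carrier G \<Longrightarrow> (\<Sum>\<kappa>\<in>K. F \<kappa> a b) = of_bool (a = b)"
    and F_eig: "\<And>\<kappa> a b. a \<in> carrier G \<Longrightarrow> b \<in> carrier G \<Longrightarrow>
      (\<Sum>c\<in>carrier G. L a c * F \<kappa> c b) = \<kappa> * F \<kappa> a b"
    and F_tr: "\<And>\<kappa>. (\<Sum>a\<in>carrier G. F \<kappa> a a) = of_nat (d \<kappa>)"
    and F_inv: "\<And>\<kappa> \<tau> N. bij_betw \<tau> (carrier G) (carrier G) \<Longrightarrow>
      (\<And>a b. a \<in> carrier G \<Longrightarrow> b \<in> carrier G \<Longrightarrow> L (\<tau> a) (\<tau> b) = L a b) \<Longrightarrow>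
      N > 0 \<Longrightarrow> (\<And>a. a \<in> carrier G \<Longrightarrow> (\<tau> ^^ N) a = a) \<Longrightarrow>
      (\<forall>a\<in>carrier G. \<forall>b\<in>carrier G. F \<kappa> (\<tau> a) (\<tau> b) = F \<kappa> a b) \<and>
      algebraic_int (\<Sum>a\<in>carrier G. F \<kappa> (\<tau> a) a)"
  proof (rule spectral_projections[OF fin, of L], goal_cases)
    case (1 \<kappa> v w a)
    show ?case by (rule ss[of v \<kappa> w, OF 1(2-4)])
  next
    case (2 K F d)
    show ?case by (rule that[OF 2(2-6)])
  qed
  have trans: "(\<forall>a\<in>carrier G. \<forall>b\<in>carrier G. F \<kappa> (y \<otimes> a \<otimes> z) (y \<otimes> b \<otimes> z) = F \<kappa> a b) \<and>
      algebraic_int (\<Sum>a\<in>carrier G. F \<kappa> (y \<otimes> a \<otimes> z) a)"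
    if y: "y \<in> carrier G" and z: "z \<in> carrier G" for \<kappa> y z
  proof (rule F_inv[OF bij_betw_translation[OF y z] _ n0])
    fix a b assume ab: "a \<in> carrier G" "b \<in> carrier G"
    have eq: "(y \<otimes> a \<otimes> z) \<otimes> inv (y \<otimes> b \<otimes> z) = y \<otimes> (a \<otimes> inv b) \<otimes> inv y"
      using ab y z by (simp add: inv_mult_group m_assoc cancel_inv_left)
    have "a \<otimes> inv b \<in> ?C" if "y \<otimes> (a \<otimes> inv b) \<otimes> inv y \<in> ?C"
    proof -
      have "inv y \<otimes> (y \<otimes> (a \<otimes> inv b) \<otimes> inv y) \<otimes> inv (inv y) \<in> ?C"
        using conj_class_conj[OF g that, of "inv y"] y by simp
      then show ?thesis using ab y by (simp add: m_assoc cancel_inv_left)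
    qed
    then show "L (y \<otimes> a \<otimes> z) (y \<otimes> b \<otimes> z) = L a b"
      unfolding L_def eq using conj_class_conj[OF g _ y, of "a \<otimes> inv b"] by auto
  next
    fix a assume a: "a \<in> carrier G"
    have "((\<lambda>a. y \<otimes> a \<otimes> z) ^^ k) a = y [^] k \<otimes> a \<otimes> z [^] k" for k
    proof (induction k)
      case (Suc k)
      have "y \<otimes> y [^] k = y [^] Suc k" using y by (metis nat_pow_Suc2)
      then show ?case using Suc y z a by (simp add: m_assoc[symmetric])
    qed (use a in simp)
    then show "((\<lambda>a. y \<otimes> a \<otimes> z) ^^ n) a = a"
      using pow_order_eq_1[OF y] pow_order_eq_1[OF z] a by (simp add: n_def)
  qed
  define p where "p = (\<lambda>\<kappa> h. F \<kappa> h \<one>)"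
  have F_p: "F \<kappa> a b = p \<kappa> (a \<otimes> inv b)" if "a \<in> carrier G" "b \<in> carrier G" for \<kappa> a b
  proof -
    have "F \<kappa> (\<one> \<otimes> a \<otimes> inv b) (\<one> \<otimes> b \<otimes> inv b) = F \<kappa> a b"
      using trans[OF one_closed inv_closed[OF that(2)], of \<kappa>] that by blast
    then show ?thesis using that by (simp add: p_def)
  qed
  have p_conj: "p \<kappa> (y \<otimes> h \<otimes> inv y) = p \<kappa> h" if "y \<in> carrier G" "h \<in> carrier G" for \<kappa> y h
  proof -
    have "F \<kappa> (y \<otimes> h \<otimes> inv y) (y \<otimes> \<one> \<otimes> inv y) = F \<kappa> h \<one>"
      using trans[OF that(1) inv_closed[OF that(1)], of \<kappa>] that by blast
    then show ?thesis using that by (simp add: p_def)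
  qed
  have p_comm: "p \<kappa> (y \<otimes> z) = p \<kappa> (z \<otimes> y)" if "y \<in> carrier G" "z \<in> carrier G" for \<kappa> y z
    using p_conj[of z "y \<otimes> z" \<kappa>] that by (simp add: m_assoc)
  have p_eig: "(\<Sum>x\<in>?C. p \<kappa> (inv x \<otimes> h)) = \<kappa> * p \<kappa> h" if "h \<in> carrier G" for \<kappa> h
    using F_eig[OF that one_closed, of \<kappa>] Lsum[OF that, of "\<lambda>c. F \<kappa> c \<one>"] by (simp add: p_def)
  have p_one: "(\<Sum>\<kappa>\<in>K. p \<kappa> h) = of_bool (h = \<one>)" if "h \<in> carrier G" for h
    using F_one[OF that one_closed] by (simp add: p_def)
  have p_tr: "of_nat n * p \<kappa> \<one> = of_nat (d \<kappa>)" for \<kappa>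
    using F_tr[of \<kappa>] by (simp add: F_p n_def Coset.order_def)
  have p_int: "algebraic_int (\<Sum>a\<in>carrier G. p \<kappa> (y \<otimes> a \<otimes> z \<otimes> inv a))"
    if "y \<in> carrier G" "z \<in> carrier G" for \<kappa> y z
    using trans[OF that, of \<kappa>] that by (simp add: F_p)
  \<comment> \<open>In terms of the irreducible characters \<open>\<chi>\<close> that occur in the eigenspace, these are the sums of
    \<open>\<chi> 1 * \<chi> g\<close> and of \<open>(\<chi> g)\<^sup>2\<close>, up to complex conjugation.\<close>
  define D where "D = (\<lambda>\<kappa>. of_nat n * p \<kappa> (inv g))"
  define E where "E = (\<lambda>\<kappa>. \<Sum>a\<in>carrier G. p \<kappa> (inv g \<otimes> a \<otimes> inv g \<otimes> inv a))"
  have D_int: "algebraic_int (D \<kappa>)" for \<kappa>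
    using p_int[OF inv_closed[OF g] one_closed, of \<kappa>] g
    by (simp add: D_def n_def Coset.order_def m_assoc)
  have E_int: "algebraic_int (E \<kappa>)" for \<kappa> unfolding E_def using p_int g by simp
  have p_class: "p \<kappa> (inv x) = p \<kappa> (inv g)" if x: "x \<in> ?C" for \<kappa> x
  proof -
    obtain b where b: "b \<in> carrier G" "x = b \<otimes> g \<otimes> inv b" using x by (auto simp: conj_class_def)
    then have "inv x = b \<otimes> inv g \<otimes> inv b" using g by (simp add: inv_mult_group m_assoc)
    then show ?thesis using p_conj[OF b(1)] g by simp
  qed
  have mD: "of_nat m * D \<kappa> = \<kappa> * of_nat (d \<kappa>)" for \<kappa>
  proof -
    have "of_nat m * p \<kappa> (inv g) = (\<Sum>x\<in>?C. p \<kappa> (inv x \<otimes> \<one>))"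
      using C p_class by (simp add: m_def)
    then have "of_nat m * p \<kappa> (inv g) = \<kappa> * p \<kappa> \<one>" using p_eig[of \<one> \<kappa>] by simp
    then have "of_nat n * (of_nat m * p \<kappa> (inv g)) = \<kappa> * (of_nat n * p \<kappa> \<one>)" by simp
    then show ?thesis unfolding p_tr by (simp add: D_def mult.left_commute)
  qed
  have mE: "of_nat m * E \<kappa> = \<kappa> * D \<kappa>" for \<kappa>
  proof -
    have "E \<kappa> = (\<Sum>a\<in>carrier G. p \<kappa> (inv (a \<otimes> g \<otimes> inv a) \<otimes> inv g))"
      unfolding E_def
    proof (rule sum.cong)
      fix a assume a: "a \<in> carrier G"
      have "inv g \<otimes> a \<otimes> inv g \<otimes> inv a = inv g \<otimes> inv (a \<otimes> g \<otimes> inv a)"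
        using a g by (simp add: inv_mult_group m_assoc)
      then show "p \<kappa> (inv g \<otimes> a \<otimes> inv g \<otimes> inv a) = p \<kappa> (inv (a \<otimes> g \<otimes> inv a) \<otimes> inv g)"
        using p_comm[of "inv g" "inv (a \<otimes> g \<otimes> inv a)" \<kappa>] a g by simp
    qed simp
    then have "of_nat m * E \<kappa> = of_nat n * (\<Sum>x\<in>?C. p \<kappa> (inv x \<otimes> inv g))"
      using sum_conjugates[OF fin g, of "\<lambda>x. p \<kappa> (inv x \<otimes> inv g)"] by (simp add: m_def n_def)
    then show ?thesis using p_eig[of "inv g" \<kappa>] g by (simp add: D_def mult.left_commute)
  qed
  have m0: "(of_nat m :: complex) \<noteq> 0" using m1 by auto
  have DE: "D \<kappa> ^ 2 = of_nat (d \<kappa>) * E \<kappa>" for \<kappa>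
  proof -
    have "of_nat m * D \<kappa> ^ 2 = (of_nat m * D \<kappa>) * D \<kappa>" by (simp add: power2_eq_square)
    also have "\<dots> = of_nat (d \<kappa>) * (\<kappa> * D \<kappa>)" by (simp add: mD)
    also have "\<dots> = of_nat m * (of_nat (d \<kappa>) * E \<kappa>)" by (simp flip: mE)
    finally show ?thesis using m0 by simp
  qed
  \<comment> \<open>A monic integer polynomial whose roots are exactly the eigenvalues of the class operator.
    It bounds all conjugates of \<open>\<kappa>\<close> by \<open>m\<close>.\<close>
  obtain c :: "int poly" where c: "lead_coeff c = 1"
    "\<And>z::complex. poly (map_poly of_int c) z = 0 \<longleftrightarrow> (\<exists>v. (\<exists>i\<in>carrier G. v i \<noteq> 0) \<and>
      (\<forall>i\<in>carrier G. (\<Sum>j\<in>carrier G. of_int (of_bool (i \<otimes> inv j \<in> ?C)) * v j) = z * v i))"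
    by (rule int_matrix_char_poly[OF fin, of "\<lambda>i j. of_bool (i \<otimes> inv j \<in> ?C)"], rule that)
  have c_root: "poly (map_poly of_int c) z = 0 \<longleftrightarrow> (\<exists>v. (\<exists>a\<in>carrier G. v a \<noteq> 0) \<and>
      (\<forall>a\<in>carrier G. (\<Sum>x\<in>?C. v (inv x \<otimes> a)) = z * v a))" for z :: complex
    unfolding c(2) using Lsum by (simp add: L_def)
  have root_le: "norm z \<le> m" if "poly (map_poly of_int c) z = 0" for z :: complex
    using that class_eigenfunction_norm_le[OF fin g, of _ z] unfolding c_root m_def by blast
  have D_cases: "D \<kappa> = 0 \<or> q dvd d \<kappa>"
    if \<kappa>: "\<kappa> \<noteq> of_nat m" and nz: "h \<in> carrier G" "p \<kappa> h \<noteq> 0" for \<kappa> h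
  proof (rule ccontr)
    assume "\<not> ?thesis"
    then have D0: "D \<kappa> \<noteq> 0" and ndvd: "\<not> q dvd d \<kappa>" by auto
    have root: "poly (map_poly of_int c) \<kappa> = 0"
      unfolding c_root by (intro exI[of _ "p \<kappa>"] conjI ballI p_eig bexI[of _ h] nz)
    have "norm \<kappa> \<noteq> m"
    proof
      assume \<kappa>m: "norm \<kappa> = m"
      have const: "p \<kappa> a = p \<kappa> \<one>" "p \<kappa> \<one> \<noteq> 0" if "a \<in> carrier G" for a
        using class_eigenfunction_constant[where v = "p \<kappa>" and \<kappa> = \<kappa>, OF fin g simple
            m1[unfolded m_def] p_eig nz \<kappa>m[unfolded m_def] that] by blast+
      have "(\<Sum>x\<in>?C. p \<kappa> (inv x \<otimes> \<one>)) = of_nat m * p \<kappa> \<one>"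
        using sum.cong[OF HOL.refl const(1), of ?C "\<lambda>x. inv x \<otimes> \<one>"] C by (simp add: m_def)
      then show False using p_eig[of \<one> \<kappa>] const(2)[OF one_closed] \<kappa> by simp
    qed
    then have lt: "norm \<kappa> < m" using root_le[OF root] by simp
    define \<mu> where "\<mu> = \<kappa> / of_nat m"
    have \<mu>D: "of_nat (d \<kappa>) * \<mu> = D \<kappa>" using mD[of \<kappa>] m0 by (simp add: \<mu>_def field_simps)
    have "coprime (int (d \<kappa>)) (int m)"
      using ndvd q unfolding m_def card by (simp add: prime_imp_coprime coprime_commute)
    then obtain u w where uw: "u * int (d \<kappa>) + w * int m = 1"
      using bezout_int[of "int (d \<kappa>)" "int m"] by auto
    have "\<mu> = of_int (u * int (d \<kappa>) + w * int m) * \<mu>" unfolding uw by simp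
    also have "\<dots> = of_int u * D \<kappa> + of_int w * \<kappa>"
      using m0 by (simp add: algebra_simps \<mu>D[symmetric]) (simp add: \<mu>_def)
    finally have "\<mu> = of_int u * D \<kappa> + of_int w * \<kappa>" .
    moreover have "algebraic_int \<kappa>" using root c(1) by (auto simp: algebraic_int_altdef_ipoly)
    ultimately have "algebraic_int \<mu>"
      using algebraic_int_plus_complex[OF
          algebraic_int_times_complex[OF int_imp_algebraic_int[OF Ints_of_int] D_int]
          algebraic_int_times_complex[OF int_imp_algebraic_int[OF Ints_of_int]]] by metis
    \<comment> \<open>The substitution \<open>X \<mapsto> m X\<close> gives a polynomial with the conjugates of \<open>\<kappa> / m\<close> among its roots.\<close>
    have scaled: "poly (map_poly of_int (pcompose c [:0, int m:])) z = poly (map_poly of_int c) (of_nat m * z)"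
      for z :: complex
    proof -
      have "map_poly of_int [:0, int m:] = [:0, of_nat m :: complex:]"
        by (rule poly_eqI) (simp add: coeff_map_poly coeff_pCons split: nat.split)
      then show ?thesis by (simp only: of_int_hom.map_poly_pcompose poly_pcompose) (simp add: mult.commute)
    qed
    have "\<mu> = 0"
    proof (rule algebraic_int_eq_0_if_conjugates_small[OF \<open>algebraic_int \<mu>\<close>])
      show "pcompose c [:0, int m:] \<noteq> 0" using c(1) m1 by (auto simp: pcompose_eq_0_iff)
      show "poly (map_poly of_int (pcompose c [:0, int m:])) \<mu> = 0"
        unfolding scaled using root m0 by (simp add: \<mu>_def)
      show "norm z \<le> 1" if "poly (map_poly of_int (pcompose c [:0, int m:])) z = 0" for z :: complex
        using root_le[OF that[unfolded scaled]] m1 by (simp add: norm_mult)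
      show "norm \<mu> < 1" using lt m1 by (simp add: \<mu>_def norm_divide)
    qed
    then show False using \<mu>D D0 by simp
  qed
  \<comment> \<open>The scalar \<open>r\<close> is a square root of \<open>q\<close>. Only \<open>D\<^sup>2\<close> is known to be divisible
    by \<open>q\<close>, so \<open>r\<close> is what can be split off from \<open>D\<close>.\<close>
  define r where "r = csqrt (of_nat q)"
  have r2: "r\<^sup>2 = of_nat q" unfolding r_def by (rule power2_csqrt)
  have r0: "r \<noteq> 0" using r2 prime_gt_0_nat[OF q] by auto
  define s where "s = (\<lambda>\<kappa>. D \<kappa> / r)"
  have s_int: "algebraic_int (s \<kappa>)" if \<kappa>: "\<kappa> \<noteq> of_nat m" for \<kappa>
  proof (cases "D \<kappa> = 0")
    case False
    then have "p \<kappa> (inv g) \<noteq> 0" by (auto simp: D_def)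
    then obtain k where k: "d \<kappa> = q * k" using D_cases[OF \<kappa> inv_closed[OF g]] False by auto
    have "s \<kappa> ^ 2 = of_nat k * E \<kappa>"
      using DE[of \<kappa>] r0 prime_gt_0_nat[OF q] by (simp add: s_def power_divide r2 k)
    moreover have "algebraic_int (of_nat k * E \<kappa>)"
      by (intro algebraic_int_times_complex E_int int_imp_algebraic_int) auto
    ultimately have "algebraic_int (s \<kappa> ^ 2)" by (simp only:)
    then show ?thesis by (rule algebraic_int_if_power) simp
  qed (simp add: s_def)
  have sum0: "(\<Sum>h\<in>carrier G. p \<kappa> h) = 0" if \<kappa>: "\<kappa> \<noteq> of_nat m" for \<kappa>
  proof -
    have "\<kappa> * (\<Sum>h\<in>carrier G. p \<kappa> h) = (\<Sum>h\<in>carrier G. \<Sum>x\<in>?C. p \<kappa> (inv x \<otimes> h))"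
      by (simp add: p_eig sum_distrib_left)
    also have "\<dots> = (\<Sum>x\<in>?C. \<Sum>h\<in>carrier G. p \<kappa> (inv x \<otimes> h))" by (rule sum.swap)
    also have "\<dots> = of_nat m * (\<Sum>h\<in>carrier G. p \<kappa> h)"
      using C by (simp add: sum_left_translation m_def)
    finally show ?thesis using \<kappa> by auto
  qed
  \<comment> \<open>Summing over the group kills all \<open>p \<kappa>\<close> with \<open>\<kappa> \<noteq> m\<close>. This shows that \<open>m\<close> is an eigenvalue
    and normalises its projection.\<close>
  have "1 = (\<Sum>h\<in>carrier G. \<Sum>\<kappa>\<in>K. p \<kappa> h)" using fin by (simp add: p_one of_bool_def)
  also have "\<dots> = (\<Sum>\<kappa>\<in>K. \<Sum>h\<in>carrier G. p \<kappa> h)" by (rule sum.swap)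
  also have "\<dots> = (\<Sum>\<kappa>\<in>K. if \<kappa> = of_nat m then \<Sum>h\<in>carrier G. p (of_nat m) h else 0)"
    by (intro sum.cong) (auto simp: sum0)
  finally have mK: "of_nat m \<in> K" and one: "(\<Sum>h\<in>carrier G. p (of_nat m) h) = 1"
    using finK by (auto split: if_splits)
  obtain h where h: "h \<in> carrier G" "p (of_nat m) h \<noteq> 0"
    using one by (metis sum.neutral zero_neq_one)
  have norm_m: "norm (of_nat m :: complex) = real (card ?C)" unfolding m_def by (rule norm_of_nat)
  have const: "p (of_nat m) a = p (of_nat m) \<one>" if "a \<in> carrier G" for a
    by (rule class_eigenfunction_constant(1)[where v = "p (of_nat m)" and \<kappa> = "of_nat m",
          OF fin g simple m1[unfolded m_def] p_eig h norm_m that])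
  have "D (of_nat m) = (\<Sum>h\<in>carrier G. p (of_nat m) (inv g))"
    by (simp add: D_def n_def Coset.order_def)
  also have "\<dots> = (\<Sum>h\<in>carrier G. p (of_nat m) h)" by (intro sum.cong HOL.refl) (metis const g inv_closed)
  finally have Dm: "D (of_nat m) = 1" using one by simp
  have "g \<noteq> \<one>"
  proof
    assume "g = \<one>"
    then have "?C \<subseteq> {\<one>}" by (auto simp: conj_class_def)
    then show False using card_mono[of "{\<one>}" ?C] m1 by (simp add: m_def)
  qed
  then have "0 = of_nat n * (\<Sum>\<kappa>\<in>K. p \<kappa> (inv g))" using g by (simp add: p_one inv_eq_1_iff)
  also have "\<dots> = (\<Sum>\<kappa>\<in>K. D \<kappa>)" by (simp add: D_def sum_distrib_left)
  also have "\<dots> = 1 + (\<Sum>\<kappa>\<in>K - {of_nat m}. D \<kappa>)" using finK mK Dm by (simp add: sum.remove)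
  also have "(\<Sum>\<kappa>\<in>K - {of_nat m}. D \<kappa>) = r * (\<Sum>\<kappa>\<in>K - {of_nat m}. s \<kappa>)"
    using r0 by (simp add: s_def sum_distrib_left)
  finally have "r * (\<Sum>\<kappa>\<in>K - {of_nat m}. s \<kappa>) = - 1"
    by (simp add: eq_neg_iff_add_eq_0 add.commute)
  then have "(r * (\<Sum>\<kappa>\<in>K - {of_nat m}. s \<kappa>)) ^ 2 = 1" by simp
  then have "of_nat q * (\<Sum>\<kappa>\<in>K - {of_nat m}. s \<kappa>) ^ 2 = 1" by (simp add: power_mult_distrib r2)
  then have sq: "(\<Sum>\<kappa>\<in>K - {of_nat m}. s \<kappa>) ^ 2 = 1 / of_nat q"
    using q prime_gt_0_nat by (simp add: field_simps)
  have S: "algebraic_int (\<Sum>\<kappa>\<in>K - {of_nat m}. s \<kappa>)"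
  proof (rule algebraic_int_sum_complex)
    fix \<kappa> assume "\<kappa> \<in> K - {of_nat m}"
    then show "algebraic_int (s \<kappa>)" using s_int by blast
  qed
  have "algebraic_int (1 / of_nat q :: complex)"
    unfolding sq[symmetric] power2_eq_square by (rule algebraic_int_times_complex[OF S S])
  then have "(1 / of_nat q :: complex) \<in> \<int>" by (rule rational_algebraic_int_is_int) auto
  then obtain k where k: "(1 / of_nat q :: complex) = of_int k" by (elim Ints_cases)
  have "(of_int (k * int q) :: complex) = of_int k * of_nat q" by simp
  also have "\<dots> = of_int 1" using prime_gt_0_nat[OF q] by (simp flip: k)
  finally have "k * int q = 1" by (simp only: of_int_eq_iff)
  then have "int q dvd 1" by (metis dvd_triv_right)
  then show False using prime_gt_1_nat[OF q] by simp
qed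

end

section \<open>Solvability and homomorphisms\<close>

lemma (in group) solvable_subgroup_iff:
  assumes "subgroup H G"
  shows "solvable (G\<lparr>carrier := H\<rparr>) \<longleftrightarrow> solvable_seq G H"
proof -
  interpret H: group "G\<lparr>carrier := H\<rparr>" by (rule subgroup_imp_group[OF assms])
  have hom: "group_hom (G\<lparr>carrier := H\<rparr>) G id"
    using subgroup.mem_carrier[OF assms]
    by (auto simp: group_hom_def group_hom_axioms_def hom_def is_group H.is_group)
  show ?thesis
    using group_hom.solvable_imp_solvable_img[OF hom, of H]
      group_hom.solvable_img_imp_solvable[OF hom, of H] H.subgroup_self
    by (auto simp: solvable_def)
qed

lemma (in group) solvable_seq_mono:
  assumes "subgroup M G" "subgroup H G" "M \<subseteq> H" "solvable_seq G H"
  shows "solvable_seq G M"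
proof -
  interpret H: group "G\<lparr>carrier := H\<rparr>" by (rule subgroup_imp_group[OF assms(2)])
  have M: "subgroup M (G\<lparr>carrier := H\<rparr>)" by (rule subgroup_incl[OF assms(1,2,3)])
  have "solvable_seq (G\<lparr>carrier := H\<rparr>) M"
    using H.solvable_subgroup[OF M] solvable_subgroup_iff[OF assms(2)] assms(4) by blast
  then have "solvable ((G\<lparr>carrier := H\<rparr>)\<lparr>carrier := M\<rparr>)" using H.solvable_subgroup_iff[OF M] by blast
  then show ?thesis using solvable_subgroup_iff[OF assms(1)] by simp
qed

lemma (in group) solvable_if_commutative:
  assumes "\<And>x y. x \<in> carrier G \<Longrightarrow> y \<in> carrier G \<Longrightarrow> x \<otimes> y = y \<otimes> x"
  shows "solvable G"
proof -
  interpret comm_group G by (rule group_comm_groupI) (use assms in auto)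
  show ?thesis unfolding solvable_iff_trivial_derived_seq
    using derived_eq_singleton[of "carrier G"] by (intro exI[of _ 1]) simp
qed

lemma (in group_hom) solvable_if_kernel_and_image:
  assumes "solvable_seq G (kernel G H h)" "h ` carrier G = carrier H" "solvable H"
  shows "solvable G"
proof (rule solvable_condition[of "G\<lparr>carrier := kernel G H h\<rparr>" G id H h])
  show "group_hom (G\<lparr>carrier := kernel G H h\<rparr>) G id"
    using G.subgroup_imp_group[OF subgroup_kernel]
    by (auto simp: group_hom_def group_hom_axioms_def hom_def kernel_def)
  show "solvable (G\<lparr>carrier := kernel G H h\<rparr>)"
    using G.solvable_subgroup_iff[OF subgroup_kernel] assms(1) by blast
qed (use assms group_hom_axioms in auto)

text \<open>
  The quotient \<open>G Mod M\<close> has sets of group elements as its elements, so an induction on the order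
  of groups of one fixed type cannot pass to it. A copy of the quotient on the natural numbers
  allows such inductions.
\<close>

lemma (in group) hom_onto_nat_group:
  assumes "M \<lhd> G" "finite (carrier G)"
  obtains K :: "nat monoid" and f where "group_hom G K f" "f ` carrier G = carrier K"
    "kernel G K f = M" "finite (carrier K)"
proof -
  interpret M: normal M G by fact
  interpret Q: group "G Mod M" by (rule M.factorgroup_is_group)
  have "finite (carrier (G Mod M))" using assms(2) by (simp add: carrier_FactGroup)
  then obtain h :: "'a set \<Rightarrow> nat" where h: "inj_on h (carrier (G Mod M))"
    using finite_imp_inj_to_nat_seg by metis
  define K where "K = image_group h (G Mod M)"
  have K: "group K" unfolding K_def by (rule Q.inj_imp_image_group_is_group[OF h])
  have iso: "h \<in> iso (G Mod M) K" unfolding K_def by (rule inj_imp_image_group_iso[OF h])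
  define f where "f = (\<lambda>x. h (M #> x))"
  have hom: "f \<in> hom G K"
  proof (rule homI)
    have C: "M #> x \<in> carrier (G Mod M)" if "x \<in> carrier G" for x
      using that by (auto simp: carrier_FactGroup)
    show "f x \<in> carrier K" if "x \<in> carrier G" for x
      using iso C[OF that] by (auto simp: f_def iso_def hom_def)
    fix x y assume xy: "x \<in> carrier G" "y \<in> carrier G"
    have "h ((M #> x) \<otimes>\<^bsub>G Mod M\<^esub> (M #> y)) = h (M #> x) \<otimes>\<^bsub>K\<^esub> h (M #> y)"
      using iso C[OF xy(1)] C[OF xy(2)] by (simp add: iso_def hom_def del: mult_FactGroup)
    then show "f (x \<otimes> y) = f x \<otimes>\<^bsub>K\<^esub> f y" using xy by (simp add: f_def M.rcos_sum)
  qed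
  have carK: "carrier K = h ` carrier (G Mod M)" by (simp add: K_def image_group_carrier)
  show thesis
  proof (rule that[of K f])
    show "group_hom G K f" using hom K by (simp add: group_hom_def group_hom_axioms_def is_group)
    show "f ` carrier G = carrier K" by (auto simp: carK f_def carrier_FactGroup)
    then show "finite (carrier K)" using assms(2) by (metis finite_imageI)
    have f_one: "f x = \<one>\<^bsub>K\<^esub> \<longleftrightarrow> x \<in> M" if x: "x \<in> carrier G" for x
    proof -
      have "M \<in> carrier (G Mod M)" using Q.one_closed by simp
      moreover have "M #> x \<in> carrier (G Mod M)" using x by (auto simp: carrier_FactGroup)
      moreover have "\<one>\<^bsub>K\<^esub> = h M" by (simp add: K_def image_group_one)
      ultimately have "f x = \<one>\<^bsub>K\<^esub> \<longleftrightarrow> M #> x = M" using h by (auto simp: f_def inj_on_def)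
      then show ?thesis
        using coset_join1[OF _ x M.subgroup_axioms] coset_join2[OF x M.subgroup_axioms] by blast
    qed
    show "kernel G K f = M"
    proof (intro equalityI subsetI)
      show "x \<in> M" if "x \<in> kernel G K f" for x using that f_one[of x] by (simp add: kernel_def)
      show "x \<in> kernel G K f" if "x \<in> M" for x
        using that f_one[of x] M.mem_carrier[of x] by (simp add: kernel_def)
    qed
  qed
qed

section \<open>Subgroups of finite groups and their orders\<close>

lemma (in group) card_subgroup_dvd:
  assumes "subgroup H G" "subgroup J G" "H \<subseteq> J"
  shows "card H dvd card J"
proof -
  have "card (rcosets\<^bsub>G\<lparr>carrier := J\<rparr>\<^esub> H) * card H = card J"
    using group.lagrange[OF subgroup_imp_group[OF assms(2)] subgroup_incl[OF assms]]
    by (simp add: Coset.order_def)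
  then show ?thesis by (metis dvd_triv_right)
qed

lemma (in group_hom) order_eq_image_kernel:
  "Coset.order G = card (h ` carrier G) * card (kernel G H h)"
proof -
  let ?H = "H\<lparr>carrier := h ` carrier G\<rparr>"
  have sub: "subgroup (h ` carrier G) H" by (rule img_is_subgroup)
  interpret K: group_hom G ?H h
    using H.subgroup_imp_group[OF sub]
    by (auto simp: group_hom_def group_hom_axioms_def hom_def)
  have ker: "kernel G ?H h = kernel G H h" by (simp add: kernel_def)
  have "card (carrier (G Mod kernel G H h)) = card (h ` carrier G)"
    using iso_same_card[of "G Mod kernel G ?H h" ?H] K.FactGroup_iso by (simp add: ker)
  then show ?thesis using G.lagrange[OF subgroup_kernel] by (simp add: FactGroup_def)
qed

text \<open>
  If \<open>J\<close> has index \<open>a\<close>, the index of its image is \<open>a\<close> divided by the index of \<open>kernel \<inter> J\<close> in the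
  kernel. An equation \<open>order = a * card J\<close> expresses an index throughout.
\<close>

lemma (in group_hom) image_index_dvd:
  assumes onto: "h ` carrier G = carrier H" and fin: "finite (carrier G)"
    and J: "subgroup J G" and a: "Coset.order G = a * card J"
  obtains a' where "a' dvd a" "Coset.order H = a' * card (h ` J)"
proof -
  have J': "group (G\<lparr>carrier := J\<rparr>)" by (rule G.subgroup_imp_group[OF J])
  have homJ: "group_hom (G\<lparr>carrier := J\<rparr>) H h"
    using J' subgroup.mem_carrier[OF J] by (auto simp: group_hom_def group_hom_axioms_def hom_def)
  have kJ: "kernel (G\<lparr>carrier := J\<rparr>) H h = kernel G H h \<inter> J"
    using subgroup.mem_carrier[OF J] by (auto simp: kernel_def)
  have 1: "card J = card (h ` J) * card (kernel G H h \<inter> J)"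
    using group_hom.order_eq_image_kernel[OF homJ] by (simp add: kJ Coset.order_def)
  have 2: "Coset.order G = Coset.order H * card (kernel G H h)"
    using order_eq_image_kernel by (simp add: onto Coset.order_def)
  have "subgroup (kernel G H h \<inter> J) G" by (rule G.subgroups_Inter_pair[OF subgroup_kernel J])
  then obtain t where t: "card (kernel G H h) = card (kernel G H h \<inter> J) * t"
    using G.card_subgroup_dvd[OF _ subgroup_kernel] by (metis dvdE inf_le1)
  obtain a' where a': "Coset.order H = a' * card (h ` J)"
    using H.lagrange[OF subgroup_img_is_subgroup[OF J]] by metis
  have pos: "card (kernel G H h \<inter> J) > 0" "card (h ` J) > 0"
  proof -
    have "finite J" "J \<noteq> {}"
      using fin subgroup.subset[OF J] subgroup.one_closed[OF J] finite_subset by auto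
    then have "card J > 0" by (simp add: card_gt_0_iff)
    then show "card (kernel G H h \<inter> J) > 0" "card (h ` J) > 0" unfolding 1 by simp_all
  qed
  have "a' * t * (card (h ` J) * card (kernel G H h \<inter> J)) = a * (card (h ` J) * card (kernel G H h \<inter> J))"
    using a unfolding 2 1 a' t by (simp add: ac_simps)
  then have "a' * t = a" using pos by simp
  then show thesis using that a' by (metis dvd_triv_left)
qed

text \<open>
  Multiplication by an element of \<open>A\<close> is injective on \<open>A\<close>, hence onto \<open>A\<close>, which yields the unit
  and the inverses.
\<close>

lemma (in group) finite_closed_imp_subgroup:
  assumes fin: "finite A" and A: "A \<subseteq> carrier G" "A \<noteq> {}"
    and mult: "\<And>x y. x \<in> A \<Longrightarrow> y \<in> A \<Longrightarrow> x \<otimes> y \<in> A"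
  shows "subgroup A G"
proof (rule subgroupI)
  have surj: "(\<otimes>) x ` A = A" if "x \<in> A" for x
  proof (rule endo_inj_surj[OF fin])
    show "(\<otimes>) x ` A \<subseteq> A" using mult that by auto
    show "inj_on ((\<otimes>) x) A" using A(1) that by (auto simp: inj_on_def subset_iff)
  qed
  fix x assume x: "x \<in> A"
  then have xG: "x \<in> carrier G" using A(1) by blast
  have "x \<in> (\<otimes>) x ` A" using surj[OF x] x by simp
  then obtain y where y: "y \<in> A" "x \<otimes> y = x" by auto
  then have "y = \<one>" using xG A(1) l_cancel_one[of x y] by auto
  then have one: "\<one> \<in> A" using y(1) by simp
  then have "\<one> \<in> (\<otimes>) x ` A" using surj[OF x] by simp
  then obtain z where z: "z \<in> A" "x \<otimes> z = \<one>" by auto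
  then have "z \<in> carrier G" using A(1) by blast
  then have "z = inv x \<otimes> (x \<otimes> z)" using xG by (simp flip: m_assoc)
  then show "inv x \<in> A" using z xG by simp
qed (use A mult in auto)

section \<open>Actions of groups of prime power order\<close>

lemma (in group) group_action_of_function:
  assumes cl: "\<And>g x. g \<in> carrier G \<Longrightarrow> x \<in> E \<Longrightarrow> act g x \<in> E"
    and one: "\<And>x. x \<in> E \<Longrightarrow> act \<one> x = x"
    and mult: "\<And>g h x. g \<in> carrier G \<Longrightarrow> h \<in> carrier G \<Longrightarrow> x \<in> E \<Longrightarrow> act (g \<otimes> h) x = act g (act h x)"
  shows "group_action G E (\<lambda>g. restrict (act g) E)"
proof -
  have inv: "act (inv g) (act g x) = x" "act g (act (inv g) x) = x"
    if "g \<in> carrier G" "x \<in> E" for g x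
    using mult[of "inv g" g x] mult[of g "inv g" x] one that by simp_all
  have bij: "restrict (act g) E \<in> Bij E" if g: "g \<in> carrier G" for g
  proof -
    have "bij_betw (act g) E E"
      by (rule bij_betw_byWitness[where f' = "act (inv g)"]) (use g inv cl in auto)
    then show ?thesis by (simp add: Bij_def bij_betw_restrict_eq)
  qed
  have "(\<lambda>g. restrict (act g) E) \<in> hom G (BijGroup E)"
  proof (rule homI)
    fix g h assume gh: "g \<in> carrier G" "h \<in> carrier G"
    have "restrict (act (g \<otimes> h)) E = compose E (restrict (act g) E) (restrict (act h) E)"
      by (rule ext) (use gh mult cl in \<open>auto simp: compose_def\<close>)
    then show "restrict (act (g \<otimes> h)) E = restrict (act g) E \<otimes>\<^bsub>BijGroup E\<^esub> restrict (act h) E"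
      using bij gh by (simp add: BijGroup_def)
  qed (use bij in \<open>simp add: BijGroup_def\<close>)
  then show ?thesis
    by (simp add: group_action_def group_hom_def group_hom_axioms_def group_BijGroup is_group)
qed

text \<open>
  The points that are not fixed fall into orbits whose size is a power of \<open>p\<close> greater than 1.
\<close>

lemma (in group_action) prime_power_fixed_points:
  assumes p: "prime p" and ord: "Coset.order G = p ^ k" and E: "finite E"
  shows "p dvd card (E - {x \<in> E. \<forall>g\<in>carrier G. \<phi> g x = x})"
proof -
  interpret G: group G using group_hom group_hom.axioms(1) by blast
  let ?F = "{x \<in> E. \<forall>g\<in>carrier G. \<phi> g x = x}"
  let ?C = "orbit G \<phi> ` (E - ?F)"
  have orbE: "orbit G \<phi> x \<subseteq> E" if "x \<in> E" for x
    using element_image that by (auto simp: orbit_def)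
  have same: "orbit G \<phi> y = orbit G \<phi> x" if "x \<in> E" "y \<in> orbit G \<phi> x" for x y
  proof -
    have y: "y \<in> E" using that orbE by blast
    have xy: "x \<in> orbit G \<phi> y" by (rule orbit_sym[OF that(1) y that(2)])
    show ?thesis
    proof (intro equalityI subsetI)
      show "z \<in> orbit G \<phi> x" if "z \<in> orbit G \<phi> y" for z
        using orbit_trans[OF \<open>x \<in> E\<close> y _ \<open>y \<in> orbit G \<phi> x\<close> that] orbE[OF y] that by blast
      show "z \<in> orbit G \<phi> y" if "z \<in> orbit G \<phi> x" for z
        using orbit_trans[OF y \<open>x \<in> E\<close> _ xy that] orbE[OF \<open>x \<in> E\<close>] that by blast
    qed
  qed
  have big: "p dvd card (orbit G \<phi> x)" if x: "x \<in> E - ?F" for x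
  proof -
    have "card (orbit G \<phi> x) dvd p ^ k"
      unfolding ord[symmetric] using orbit_stabilizer_theorem[of x] x
        dvd_triv_left[of "card (orbit G \<phi> x)" "card (stabilizer G \<phi> x)"] by simp
    then obtain i where i: "card (orbit G \<phi> x) = p ^ i" using p by (auto simp: divides_primepow_nat)
    have "card (orbit G \<phi> x) \<noteq> 1"
    proof
      assume "card (orbit G \<phi> x) = 1"
      then obtain z where z: "orbit G \<phi> x = {z}" by (auto simp: card_1_singleton_iff)
      then have "z = x" using orbit_refl[of x] x by auto
      then have "\<phi> g x = x" if "g \<in> carrier G" for g
        using z that unfolding orbit_def by blast
      then show False using x by auto
    qed
    then show ?thesis using i by (cases i) auto
  qed
  have U: "\<Union>?C = E - ?F"
  proof
    show "\<Union>?C \<subseteq> E - ?F"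
    proof
      fix y assume "y \<in> \<Union>?C"
      then obtain x where x: "x \<in> E - ?F" "y \<in> orbit G \<phi> x" by blast
      then have y: "y \<in> E" using orbE by blast
      moreover have "y \<notin> ?F"
      proof
        assume "y \<in> ?F"
        then have "orbit G \<phi> y \<subseteq> {y}" by (auto simp: orbit_def)
        then have "x = y" using same[of x y] x orbit_refl[of x] by auto
        then show False using x \<open>y \<in> ?F\<close> by blast
      qed
      ultimately show "y \<in> E - ?F" by blast
    qed
    show "E - ?F \<subseteq> \<Union>?C" using orbit_refl by blast
  qed
  have "p dvd card (\<Union>?C)"
  proof (rule dvd_partition)
    show "finite (\<Union>?C)" unfolding U using E by simp
    show "\<forall>c\<in>?C. p dvd card c" using big by blast
    show "\<forall>c1\<in>?C. \<forall>c2\<in>?C. c1 \<noteq> c2 \<longrightarrow> c1 \<inter> c2 = {}"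
    proof (intro ballI impI, rule ccontr)
      fix c1 c2 assume "c1 \<in> ?C" "c2 \<in> ?C" and ne: "c1 \<noteq> c2" and "c1 \<inter> c2 \<noteq> {}"
      then obtain x1 x2 z where "x1 \<in> E" "c1 = orbit G \<phi> x1" "x2 \<in> E" "c2 = orbit G \<phi> x2"
        "z \<in> orbit G \<phi> x1" "z \<in> orbit G \<phi> x2" by blast
      then show False using ne same[of x1 z] same[of x2 z] by simp
    qed
  qed
  then show ?thesis unfolding U .
qed

text \<open>
  The fixed points of the conjugation action of \<open>P\<close> on itself are its central elements. Their
  number is divisible by \<open>p\<close>, and the unit is one of them.
\<close>

lemma (in group) prime_power_subgroup_centre:
  assumes fin: "finite (carrier G)" and P: "subgroup P G" and p: "prime p" and card: "card P = p ^ k" and k: "k > 0"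
  obtains g where "g \<in> P" "g \<noteq> \<one>" "\<And>x. x \<in> P \<Longrightarrow> x \<otimes> g = g \<otimes> x"
proof -
  interpret P: subgroup P G by fact
  interpret PG: group "G\<lparr>carrier := P\<rparr>" by (rule subgroup_imp_group[OF P])
  have finP: "finite P" using fin P.subset finite_subset by blast
  interpret A: group_action "G\<lparr>carrier := P\<rparr>" P "\<lambda>g. restrict (\<lambda>x. g \<otimes> x \<otimes> inv g) P"
    by (rule PG.group_action_of_function) (auto simp: inv_mult_group m_assoc)
  define F where "F = {x \<in> P. \<forall>g\<in>carrier (G\<lparr>carrier := P\<rparr>). restrict (\<lambda>x. g \<otimes> x \<otimes> inv g) P x = x}"
  have FP: "F \<subseteq> P" by (auto simp: F_def)
  have "p dvd card (P - F)" unfolding F_def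
    by (rule A.prime_power_fixed_points[OF p _ finP]) (simp add: Coset.order_def card)
  moreover have "card P = card (P - F) + card F"
    using card_Diff_subset[OF finite_subset[OF FP finP] FP] card_mono[OF finP FP] by simp
  moreover have "p dvd card P" using card k by simp
  ultimately have "p dvd card F" by (metis dvd_add_right_iff)
  moreover have "\<one> \<in> F" by (simp add: F_def)
  then have "card F > 0" using finite_subset[OF FP finP] by (auto simp: card_gt_0_iff)
  ultimately have "card F > 1" using prime_gt_1_nat[OF p] dvd_imp_le[of p "card F"] by linarith
  then have "\<not> F \<subseteq> {\<one>}" using card_mono[of "{\<one>}" F] by auto
  then obtain g where g: "g \<in> F" "g \<noteq> \<one>" by blast
  have "x \<otimes> g = g \<otimes> x" if x: "x \<in> P" for x
  proof -
    have gP: "g \<in> carrier G" and xG: "x \<in> carrier G" using g x FP by auto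
    have "x \<otimes> g \<otimes> inv x = g" using g x by (auto simp: F_def)
    then have "(x \<otimes> g \<otimes> inv x) \<otimes> x = g \<otimes> x" by simp
    then show ?thesis using gP xG by (simp add: m_assoc)
  qed
  then show thesis using that g FP by blast
qed

text \<open>
  The size of the class is the index of the centralizer of \<open>g\<close>, which contains \<open>P\<close>.
\<close>

lemma (in group) class_card_dvd_index_of_centralizing:
  assumes g: "g \<in> carrier G" and P: "subgroup P G" and comm: "\<And>x. x \<in> P \<Longrightarrow> x \<otimes> g = g \<otimes> x"
  obtains c where "Coset.order G = card (conj_class g) * (card P * c)"
proof -
  interpret A: group_action G "carrier G" "\<lambda>g. \<lambda>h\<in>carrier G. g \<otimes> h \<otimes> inv g"
    by (rule action_by_conjugation)
  let ?\<phi> = "\<lambda>g. \<lambda>h\<in>carrier G. g \<otimes> h \<otimes> inv g"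
  have orb: "orbit G ?\<phi> g = conj_class g" using g by (auto simp: orbit_def conj_class_def)
  have sub: "subgroup (stabilizer G ?\<phi> g) G" by (rule A.stabilizer_subgroup[OF g])
  have "P \<subseteq> stabilizer G ?\<phi> g"
  proof
    fix x assume x: "x \<in> P"
    then have xG: "x \<in> carrier G" by (rule subgroup.mem_carrier[OF P])
    have "x \<otimes> g \<otimes> inv x = g" using comm[OF x] xG g by (simp add: m_assoc)
    then show "x \<in> stabilizer G ?\<phi> g" using xG g by (simp add: stabilizer_def)
  qed
  then have "card P dvd card (stabilizer G ?\<phi> g)" by (rule card_subgroup_dvd[OF P sub])
  then obtain c where "card (stabilizer G ?\<phi> g) = card P * c" by (rule dvdE)
  then show thesis using that[of c] A.orbit_stabilizer_theorem[OF g] by (simp add: orb)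
qed

section \<open>Burnside's theorem on groups of order divisible by two primes\<close>

text \<open>
  A central element \<open>g \<noteq> \<one>\<close> of a Sylow \<open>p\<close>-subgroup has a class of size a power of \<open>q\<close>. In a simple
  group this size must be 1, so the centre is not trivial and hence is the whole group.
\<close>

lemma (in group) simple_two_prime_order_solvable:
  assumes fin: "finite (carrier G)"
    and simple: "\<And>N. N \<lhd> G \<Longrightarrow> N = {\<one>} \<or> N = carrier G"
    and p: "prime p" and q: "prime q" and ord: "Coset.order G = p ^ a * q ^ b" and a: "a > 0"
  shows "solvable G"
proof -
  obtain P where P: "subgroup P G" "card P = p ^ a"
    using sylow_thm[OF p is_group ord fin] by blast
  obtain g where g: "g \<in> P" "g \<noteq> \<one>" "\<And>x. x \<in> P \<Longrightarrow> x \<otimes> g = g \<otimes> x"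
    by (rule prime_power_subgroup_centre[OF fin P(1) p P(2) a], rule that)
  have gG: "g \<in> carrier G" by (rule subgroup.mem_carrier[OF P(1) g(1)])
  obtain c where c: "Coset.order G = card (conj_class g) * (card P * c)"
    by (rule class_card_dvd_index_of_centralizing[OF gG P(1)], erule g(3), rule that)
  have "p ^ a * q ^ b = p ^ a * (card (conj_class g) * c)" using c unfolding P(2) ord by (simp add: ac_simps)
  then have "card (conj_class g) dvd q ^ b" using prime_gt_0_nat[OF p] by simp
  then obtain j where j: "card (conj_class g) = q ^ j" using q by (auto simp: divides_primepow_nat)
  show ?thesis
  proof (cases "j > 0")
    case True
    then show ?thesis using simple_group_class_not_prime_power[OF fin gG simple q j] by blast
  next
    case False
    then have "card (conj_class g) = 1" using j by simp
    then obtain z where z: "conj_class g = {z}" by (auto simp: card_1_singleton_iff)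
    have cl: "y \<otimes> g \<otimes> inv y = z" if "y \<in> carrier G" for y using z that by (auto simp: conj_class_def)
    have "z = g" using cl[OF one_closed] gG by simp
    have central: "y \<otimes> g = g \<otimes> y" if y: "y \<in> carrier G" for y
    proof -
      have "(y \<otimes> g \<otimes> inv y) \<otimes> y = g \<otimes> y" using cl[OF y] \<open>z = g\<close> by simp
      then show ?thesis using y gG by (simp add: m_assoc)
    qed
    define Z where "Z = {x \<in> carrier G. \<forall>y\<in>carrier G. y \<otimes> x = x \<otimes> y}"
    have "subgroup Z G"
    proof (rule subgroupI)
      fix x assume x: "x \<in> Z"
      have "y \<otimes> inv x = inv x \<otimes> y" if y: "y \<in> carrier G" for y
      proof -
        have "x \<in> carrier G" "inv y \<otimes> x = x \<otimes> inv y"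
          using x inv_closed[OF y] unfolding Z_def by blast+
        then have "inv (inv y \<otimes> x) = inv (x \<otimes> inv y)" "x \<in> carrier G" by auto
        then show ?thesis using y by (simp add: inv_mult_group)
      qed
      moreover have "inv x \<in> carrier G" using x unfolding Z_def by blast
      ultimately show "inv x \<in> Z" unfolding Z_def by blast
    next
      fix x y assume x: "x \<in> Z" and y: "y \<in> Z"
      have "u \<otimes> (x \<otimes> y) = (x \<otimes> y) \<otimes> u" if u: "u \<in> carrier G" for u
      proof -
        have xy: "x \<in> carrier G" "y \<in> carrier G" "u \<otimes> x = x \<otimes> u" "u \<otimes> y = y \<otimes> u"
          using x y u unfolding Z_def by blast+
        have "u \<otimes> (x \<otimes> y) = (u \<otimes> x) \<otimes> y" using xy(1,2) u by (simp add: m_assoc)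
        also have "\<dots> = x \<otimes> (u \<otimes> y)" unfolding xy(3) using xy(1,2) u by (simp add: m_assoc)
        also have "\<dots> = (x \<otimes> y) \<otimes> u" unfolding xy(4) using xy(1,2) u by (simp add: m_assoc)
        finally show ?thesis .
      qed
      moreover have "x \<otimes> y \<in> carrier G" using x y unfolding Z_def by blast
      ultimately show "x \<otimes> y \<in> Z" unfolding Z_def by blast
    qed (auto simp: Z_def)
    moreover have "y \<otimes> x \<otimes> inv y \<in> Z" if "y \<in> carrier G" "x \<in> Z" for x y
    proof -
      have "x \<in> carrier G" "y \<otimes> x = x \<otimes> y" using that unfolding Z_def by blast+
      then have "y \<otimes> x \<otimes> inv y = x" using that(1) by (simp add: m_assoc)
      then show ?thesis using that by simp
    qed
    ultimately have "Z \<lhd> G" by (simp add: normal_inv_iff)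
    moreover have "g \<in> Z" using gG central unfolding Z_def by blast
    ultimately have "Z = carrier G" using simple[of Z] g(2) by auto
    then have "x \<otimes> y = y \<otimes> x" if "x \<in> carrier G" "y \<in> carrier G" for x y
      using that unfolding Z_def by blast
    then show ?thesis by (rule solvable_if_commutative)
  qed
qed

text \<open>
  Induction on the order: a proper normal subgroup and its quotient have orders of the same kind, and
  without one the group is simple. It takes place on natural numbers because of
  the quotient.
\<close>

lemma two_prime_order_solvable_nat:
  fixes G :: "nat monoid"
  assumes "group G" "finite (carrier G)" "prime p" "prime q" "Coset.order G = p ^ a * q ^ b"
  shows "solvable G"
  using assms
proof (induction "Coset.order G" arbitrary: G a b rule: less_induct)
  case less
  interpret group G by fact
  have divisor: "\<exists>i j. d = p ^ i * q ^ j" if d: "d dvd Coset.order G" for d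
  proof -
    obtain u v where "d = u * v" "u dvd p ^ a" "v dvd q ^ b"
      using division_decomp[of d "p ^ a" "q ^ b"] d less.prems(5) by auto
    then show ?thesis using less.prems(3,4) by (auto simp: divides_primepow_nat)
  qed
  show ?case
  proof (cases "\<exists>N. N \<lhd> G \<and> N \<noteq> {\<one>\<^bsub>G\<^esub>} \<and> N \<noteq> carrier G")
    case True
    then obtain N where N: "N \<lhd> G" "N \<noteq> {\<one>\<^bsub>G\<^esub>}" "N \<noteq> carrier G" by blast
    interpret N: normal N G by fact
    have sub: "subgroup N G" by (rule N.subgroup_axioms)
    have finN: "finite N" using less.prems(2) N.subset finite_subset by blast
    have lt: "card N < Coset.order G"
      using psubset_card_mono[OF less.prems(2)] N.subset N(3) by (simp add: Coset.order_def psubset_eq)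
    have dvd: "card N dvd Coset.order G" using lagrange[OF sub] by (metis dvd_triv_right)
    have gt: "card N > 1"
    proof -
      have "{\<one>\<^bsub>G\<^esub>} \<subset> N" using N(2) N.one_closed by auto
      then have "card {\<one>\<^bsub>G\<^esub>} < card N" by (rule psubset_card_mono[OF finN])
      then show ?thesis by simp
    qed
    have "solvable (G\<lparr>carrier := N\<rparr>)"
    proof -
      obtain i j where "card N = p ^ i * q ^ j" using divisor[OF dvd] by blast
      then show ?thesis
        using less.hyps[of "G\<lparr>carrier := N\<rparr>" i j] subgroup_imp_group[OF sub] lt finN less.prems(3,4)
        by (simp add: Coset.order_def)
    qed
    then have solvN: "solvable_seq G N" using solvable_subgroup_iff[OF sub] by blast
    obtain K :: "nat monoid" and f where f: "group_hom G K f" "f ` carrier G = carrier K"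
      "kernel G K f = N" "finite (carrier K)"
      by (rule hom_onto_nat_group[OF N(1) less.prems(2)])
    have ordK: "Coset.order G = Coset.order K * card N"
      using group_hom.order_eq_image_kernel[OF f(1)] by (simp add: f Coset.order_def)
    have "Coset.order K > 0" using ordK lt by (cases "Coset.order K") auto
    then have "Coset.order K < Coset.order G" using ordK gt by simp
    moreover obtain i j where "Coset.order K = p ^ i * q ^ j" using divisor ordK by (metis dvd_triv_left)
    ultimately have "solvable K"
      using less.hyps[of K i j] f(1,4) less.prems(3,4) by (simp add: group_hom_def)
    then show ?thesis using group_hom.solvable_if_kernel_and_image[OF f(1)] f(2,3) solvN by simp
  next
    case False
    then have simple: "N = {\<one>\<^bsub>G\<^esub>} \<or> N = carrier G" if "N \<lhd> G" for N using that by blast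
    consider "a > 0" | "b > 0" | "a = 0" "b = 0" by auto
    then show ?thesis
    proof cases
      case 1
      show ?thesis
        by (rule simple_two_prime_order_solvable[OF less.prems(2) simple less.prems(3,4,5) 1])
    next
      case 2
      have ord: "Coset.order G = q ^ b * p ^ a" using less.prems(5) by simp
      show ?thesis
        by (rule simple_two_prime_order_solvable[OF less.prems(2) simple less.prems(4,3) ord 2])
    next
      case 3
      then have "Coset.order G = 1" using less.prems(5) by simp
      then obtain z where "carrier G = {z}" by (auto simp: Coset.order_def card_1_singleton_iff)
      then show ?thesis by (intro solvable_if_commutative) auto
    qed
  qed
qed

lemma (in group) solvable_via_nat_group:
  assumes fin: "finite (carrier G)" and K: "\<And>(K :: nat monoid) f. group_hom G K f \<Longrightarrow>
    f ` carrier G = carrier K \<Longrightarrow> finite (carrier K) \<Longrightarrow> Coset.order K = Coset.order G \<Longrightarrow> solvable K"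
  shows "solvable G"
proof -
  obtain K :: "nat monoid" and f where f: "group_hom G K f" "f ` carrier G = carrier K"
    "kernel G K f = {\<one>}" "finite (carrier K)"
    by (rule hom_onto_nat_group[OF one_is_normal fin])
  have "Coset.order K = Coset.order G"
    using group_hom.order_eq_image_kernel[OF f(1)] by (simp add: f Coset.order_def)
  then have "solvable K" using K f by blast
  moreover have "solvable_seq G {\<one>}" by (rule solvable_seq.unity)
  ultimately show ?thesis using group_hom.solvable_if_kernel_and_image[OF f(1)] f(2,3) by simp
qed

theorem (in group) two_prime_order_solvable:
  assumes "finite (carrier G)" "prime p" "prime q" "Coset.order G = p ^ a * q ^ b"
  shows "solvable G"
  using assms(1)
proof (rule solvable_via_nat_group)
  fix K :: "nat monoid" and f
  assume "group_hom G K f" "finite (carrier K)" "Coset.order K = Coset.order G"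
  then show "solvable K"
    using two_prime_order_solvable_nat[of K p q a b] assms by (simp add: group_hom_def)
qed

section \<open>Wielandt's theorem on three solvable subgroups\<close>

lemma (in group) rcosets_translation_action:
  assumes H: "subgroup H G"
  shows "group_action G (rcosets H) (\<lambda>x. restrict (\<lambda>R. R #> inv x) (rcosets H))"
proof (rule group_action_of_function)
  have HG: "H \<subseteq> carrier G" by (rule subgroup.subset[OF H])
  have sub: "R \<subseteq> carrier G" if "R \<in> rcosets H" for R
    using that HG r_coset_subset_G by (auto simp: RCOSETS_def)
  show "R #> inv x \<in> rcosets H" if x: "x \<in> carrier G" and R: "R \<in> rcosets H" for x R
  proof -
    obtain y where y: "y \<in> carrier G" "R = H #> y" using R by (auto simp: RCOSETS_def)
    have "R #> inv x = H #> (y \<otimes> inv x)" using y x HG by (simp add: coset_mult_assoc)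
    then show ?thesis using y x by (auto simp: RCOSETS_def)
  qed
  show "R #> inv \<one> = R" if "R \<in> rcosets H" for R using sub[OF that] by simp
  show "R #> inv (x \<otimes> y) = R #> inv y #> inv x"
    if "x \<in> carrier G" "y \<in> carrier G" "R \<in> rcosets H" for x y R
    using that sub[OF that(3)] by (simp add: inv_mult_group coset_mult_assoc)
qed

lemma (in group) rcoset_fixed_iff:
  assumes H: "subgroup H G" and g: "g \<in> carrier G" and x: "x \<in> carrier G"
  shows "(H #> g) #> inv x = H #> g \<longleftrightarrow> g \<otimes> x \<otimes> inv g \<in> H"
proof -
  have HG: "H \<subseteq> carrier G" by (rule subgroup.subset[OF H])
  have "(H #> g) #> inv x = H #> g \<longleftrightarrow> ((H #> g) #> inv x) #> (x \<otimes> inv g) = (H #> g) #> (x \<otimes> inv g)"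
  proof
    assume "((H #> g) #> inv x) #> (x \<otimes> inv g) = (H #> g) #> (x \<otimes> inv g)"
    then have "((H #> g) #> inv x) #> (x \<otimes> inv g) #> (g \<otimes> inv x) = (H #> g) #> (x \<otimes> inv g) #> (g \<otimes> inv x)"
      by simp
    then show "(H #> g) #> inv x = H #> g"
      using HG g x by (simp add: coset_mult_assoc m_assoc cancel_inv_left)
  qed simp
  also have "\<dots> \<longleftrightarrow> H = H #> (g \<otimes> x \<otimes> inv g)"
    using HG g x by (simp add: coset_mult_assoc m_assoc cancel_inv_left)
  also have "\<dots> \<longleftrightarrow> g \<otimes> x \<otimes> inv g \<in> H"
  proof
    assume "H = H #> (g \<otimes> x \<otimes> inv g)"
    then show "g \<otimes> x \<otimes> inv g \<in> H" using coset_join1[OF _ _ H] g x by simp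
  next
    assume "g \<otimes> x \<otimes> inv g \<in> H"
    then show "H = H #> (g \<otimes> x \<otimes> inv g)" using coset_join2[OF _ H] g x by simp
  qed
  finally show ?thesis .
qed

text \<open>
  As the indices of \<open>H\<close> and \<open>J\<close> are coprime, \<open>H\<close> acts transitively on the cosets of \<open>J\<close>. The number \<open>b\<close>
  of these cosets is prime to \<open>r\<close>, so the \<open>r\<close>-group \<open>N\<close> fixes one of them, \<open>J g\<close>, which means
  \<open>g N g\<inverse> \<subseteq> J\<close>. By transitivity each element of the group is of the form \<open>j g x\<inverse>\<close> with \<open>j \<in> J\<close> and
  \<open>x \<in> H\<close>; since \<open>H\<close> normalises \<open>N\<close>, it conjugates \<open>N\<close> into \<open>J\<close>. Hence the normal closure of
  \<open>N\<close> lies in \<open>J\<close>.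
\<close>

lemma (in group) normal_closure_in_coprime_subgroup:
  assumes fin: "finite (carrier G)"
    and H: "subgroup H G" "Coset.order G = a * card H"
    and J: "subgroup J G" "Coset.order G = b * card J"
    and cop: "coprime a b"
    and N: "subgroup N G" "N \<noteq> {\<one>}" "card N = r ^ k" and r: "prime r" "\<not> r dvd b"
    and inv: "\<And>h n. h \<in> H \<Longrightarrow> n \<in> N \<Longrightarrow> h \<otimes> n \<otimes> inv h \<in> N"
  obtains M where "M \<lhd> G" "M \<noteq> {\<one>}" "M \<subseteq> J"
proof -
  let ?E = "rcosets J" and ?\<phi> = "\<lambda>x. restrict (\<lambda>R. R #> inv x) (rcosets J)"
  interpret H: subgroup H G by fact
  interpret J: subgroup J G by fact
  interpret N: subgroup N G by fact
  interpret A: group_action G ?E ?\<phi> by (rule rcosets_translation_action[OF J(1)])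
  have finJ: "finite J" and finH: "finite H"
    using fin J.subset H.subset finite_subset by blast+
  have posJ: "card J > 0" and posH: "card H > 0"
    using finJ finH J.one_closed H.one_closed by (metis card_gt_0_iff empty_iff)+
  have cardE: "card ?E = b" using lagrange[OF J(1)] J(2) posJ by simp
  have finE: "finite ?E" using rcosets_subset_PowG[OF J(1)] fin by (meson finite_Pow_iff finite_subset)
  define F where "F = {R \<in> ?E. \<forall>x\<in>carrier (G\<lparr>carrier := N\<rparr>). ?\<phi> x R = R}"
  interpret AN: group_action "G\<lparr>carrier := N\<rparr>" ?E ?\<phi> by (rule A.induced_action[OF N(1)])
  have "r dvd card (?E - F)" unfolding F_def
    by (rule AN.prime_power_fixed_points[OF r(1) _ finE]) (simp add: Coset.order_def N(3))
  then have "F \<noteq> {}" using r(2) cardE by auto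
  then obtain R where R: "R \<in> F" by blast
  then obtain g where g: "g \<in> carrier G" "R = J #> g" by (auto simp: F_def RCOSETS_def)
  have RE: "R \<in> ?E" using R by (simp add: F_def)
  have gN: "g \<otimes> n \<otimes> inv g \<in> J" if n: "n \<in> N" for n
  proof -
    have "(J #> g) #> inv n = J #> g" using R n RE by (auto simp: F_def g(2))
    then show ?thesis using rcoset_fixed_iff[OF J(1) g(1)] n by simp
  qed
  interpret AH: group_action "G\<lparr>carrier := H\<rparr>" ?E ?\<phi> by (rule A.induced_action[OF H(1)])
  interpret GH: group "G\<lparr>carrier := H\<rparr>" by (rule subgroup_imp_group[OF H(1)])
  define S where "S = stabilizer (G\<lparr>carrier := H\<rparr>) ?\<phi> R"
  define s where "s = card (orbit (G\<lparr>carrier := H\<rparr>) ?\<phi> R)"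
  have sS: "s * card S = card H"
    using AH.orbit_stabilizer_theorem[OF RE] by (simp add: s_def S_def Coset.order_def)
  define T where "T = {x \<in> carrier G. g \<otimes> x \<otimes> inv g \<in> J}"
  have subS: "subgroup S G"
    unfolding S_def by (rule incl_subgroup[OF H(1) AH.stabilizer_subgroup[OF RE]])
  have bijT: "bij_betw (\<lambda>x. g \<otimes> x \<otimes> inv g) T J"
    by (rule bij_betw_byWitness[where f' = "\<lambda>y. inv g \<otimes> y \<otimes> g"])
      (use g(1) in \<open>auto simp: T_def m_assoc cancel_inv_left\<close>)
  have subT: "subgroup T G"
  proof (rule subgroupI)
    have "\<one> \<in> T" using g(1) by (simp add: T_def)
    then show "T \<noteq> {}" by blast
    fix x assume x: "x \<in> T"
    then have "inv (g \<otimes> x \<otimes> inv g) \<in> J" by (simp add: T_def)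
    then show "inv x \<in> T" using x g(1) by (simp add: T_def inv_mult_group m_assoc)
    fix y assume y: "y \<in> T"
    have "(g \<otimes> x \<otimes> inv g) \<otimes> (g \<otimes> y \<otimes> inv g) \<in> J" using x y by (simp add: T_def)
    moreover have "(g \<otimes> x \<otimes> inv g) \<otimes> (g \<otimes> y \<otimes> inv g) = g \<otimes> (x \<otimes> y) \<otimes> inv g"
      using x y g(1) by (simp add: T_def m_assoc cancel_inv_left)
    ultimately show "x \<otimes> y \<in> T" using x y by (simp add: T_def)
  qed (simp add: T_def subset_iff)
  have "S \<subseteq> T"
  proof
    fix x assume "x \<in> S"
    then have x: "x \<in> H" "?\<phi> x R = R" by (auto simp: S_def stabilizer_def)
    then have "(J #> g) #> inv x = J #> g" using RE by (simp add: g(2))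
    then show "x \<in> T" using rcoset_fixed_iff[OF J(1) g(1)] x(1) by (simp add: T_def)
  qed
  then have "card S dvd card T" by (rule card_subgroup_dvd[OF subS subT])
  moreover have "card T = card J" by (rule bij_betw_same_card[OF bijT])
  ultimately obtain t where t: "card J = card S * t" by auto
  have posS: "card S > 0" using sS posH by (cases "card S") auto
  \<comment> \<open>The orbit of \<open>J g\<close> under \<open>H\<close> has \<open>s\<close> elements. Comparing orders shows that \<open>b\<close>
    divides \<open>a * s\<close> and so \<open>s\<close>, hence the orbit contains all \<open>b\<close> cosets.\<close>
  have "a * s * card S = b * t * card S" using H(2) J(2) t sS by (simp add: ac_simps)
  then have "a * s = b * t" using posS by simp
  then have "b dvd s" using cop by (metis coprime_commute coprime_dvd_mult_right_iff dvd_triv_left)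
  moreover have "s > 0" using sS posH by (cases s) auto
  ultimately have "b \<le> s" by (rule dvd_imp_le)
  moreover have orbE: "orbit (G\<lparr>carrier := H\<rparr>) ?\<phi> R \<subseteq> ?E"
    using AH.element_image RE by (auto simp: orbit_def)
  ultimately have orb: "orbit (G\<lparr>carrier := H\<rparr>) ?\<phi> R = ?E"
    using card_seteq[OF finE orbE] by (simp add: cardE s_def)
  let ?C = "{y \<otimes> n \<otimes> inv y | y n. y \<in> carrier G \<and> n \<in> N}"
  define M where "M = generate G ?C"
  have "M \<lhd> G" unfolding M_def
  proof (rule normal_generateI)
    fix h x assume "h \<in> ?C" and x: "x \<in> carrier G"
    then obtain y n where y: "y \<in> carrier G" "n \<in> N" "h = y \<otimes> n \<otimes> inv y" by blast
    have "x \<otimes> h \<otimes> inv x = (x \<otimes> y) \<otimes> n \<otimes> inv (x \<otimes> y)"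
      using x y by (simp add: m_assoc inv_mult_group)
    then show "x \<otimes> h \<otimes> inv x \<in> ?C" using x y by blast
  qed auto
  moreover have "?C \<subseteq> J"
  proof
    fix h assume "h \<in> ?C"
    then obtain y n where y: "y \<in> carrier G" "n \<in> N" "h = y \<otimes> n \<otimes> inv y" by blast
    have "J #> y \<in> orbit (G\<lparr>carrier := H\<rparr>) ?\<phi> R" unfolding orb using y(1) by (auto simp: RCOSETS_def)
    then obtain x where x: "x \<in> H" "J #> y = (J #> g) #> inv x"
      using RE by (auto simp: orbit_def g(2))
    have "y \<in> (J #> g) #> inv x" using rcos_self[OF y(1) J(1)] x(2) by simp
    then have "y \<in> J #> (g \<otimes> inv x)" using J.subset g(1) x(1) by (simp add: coset_mult_assoc)
    then obtain j where j: "j \<in> J" "y = j \<otimes> (g \<otimes> inv x)" by (auto simp: r_coset_def)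
    have "inv x \<otimes> n \<otimes> inv (inv x) \<in> N" using inv[of "inv x" n] x(1) y(2) by simp
    then have "j \<otimes> (g \<otimes> (inv x \<otimes> n \<otimes> inv (inv x)) \<otimes> inv g) \<otimes> inv j \<in> J"
      using gN j(1) by simp
    moreover have "j \<otimes> (g \<otimes> (inv x \<otimes> n \<otimes> inv (inv x)) \<otimes> inv g) \<otimes> inv j = h"
      unfolding y(3) j(2) using j(1) g(1) x(1) y(2) by (simp add: m_assoc inv_mult_group)
    ultimately show "h \<in> J" by simp
  qed
  then have "M \<subseteq> J" unfolding M_def by (rule generate_subgroup_incl[OF _ J(1)])
  moreover have "M \<noteq> {\<one>}"
  proof -
    obtain n where n: "n \<in> N" "n \<noteq> \<one>" using N(2) N.one_closed by auto
    then have "n = \<one> \<otimes> n \<otimes> inv \<one>" by simp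
    then have "n \<in> ?C" using n(1) by blast
    then have "n \<in> M" unfolding M_def by (rule generate.incl)
    then show ?thesis using n(2) by blast
  qed
  ultimately show thesis using that by blast
qed

text \<open>
  The last nontrivial term of the derived series.
\<close>

lemma (in group) solvable_imp_abelian_normal:
  assumes "solvable G" "carrier G \<noteq> {\<one>}"
  obtains D where "D \<lhd> G" "D \<noteq> {\<one>}" "\<And>x y. x \<in> D \<Longrightarrow> y \<in> D \<Longrightarrow> x \<otimes> y = y \<otimes> x"
proof -
  let ?d = "\<lambda>n. (derived G ^^ n) (carrier G)"
  obtain n0 where "?d n0 = {\<one>}" using assms(1) solvable_iff_trivial_derived_seq by blast
  then have ex: "\<exists>n. ?d n = {\<one>}" by blast
  define n where "n = (LEAST n. ?d n = {\<one>})"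
  have n: "?d n = {\<one>}" unfolding n_def by (rule LeastI_ex[OF ex])
  have "n \<noteq> 0"
  proof
    assume "n = 0"
    then show False using n assms(2) by simp
  qed
  then obtain m where m: "n = Suc m" by (cases n) auto
  have normal: "?d k \<lhd> G" for k
  proof (induction k)
    case 0
    show ?case using normal_self by simp
  next
    case (Suc k)
    then show ?case using derived_is_normal by simp
  qed
  show thesis
  proof (rule that[OF normal[of m]])
    show "?d m \<noteq> {\<one>}" using not_less_Least[of m "\<lambda>n. ?d n = {\<one>}"] m by (simp add: n_def)
    fix x y assume xy: "x \<in> ?d m" "y \<in> ?d m"
    have sub: "?d m \<subseteq> carrier G" by (rule subgroup.subset[OF normal_imp_subgroup[OF normal[of m]]])
    have G: "x \<in> carrier G" "y \<in> carrier G" using xy sub by blast+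
    have "x \<otimes> y \<otimes> inv x \<otimes> inv y \<in> derived G (?d m)"
      unfolding derived_def[of G "?d m"]
      by (rule generate.incl, rule UN_I[OF xy(1)], rule UN_I[OF xy(2)], rule singletonI)
    then have "x \<otimes> y \<otimes> inv x \<otimes> inv y = \<one>" using n m by simp
    then have "x \<otimes> y \<otimes> inv x \<otimes> inv y \<otimes> (y \<otimes> x) = y \<otimes> x" using G by simp
    then show "x \<otimes> y = y \<otimes> x" using G by (simp add: m_assoc cancel_inv_left)
  qed
qed

lemma (in group) cauchy_element:
  assumes fin: "finite (carrier G)" and p: "prime p" "p dvd Coset.order G"
  obtains x where "x \<in> carrier G" "x \<noteq> \<one>" "x [^] p = \<one>"
proof -
  obtain m where "Coset.order G = p ^ 1 * m" using p(2) by auto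
  then obtain Q where Q: "subgroup Q G" "card Q = p ^ 1" using sylow_thm[OF p(1) is_group _ fin] by blast
  then have "card Q > 1" using prime_gt_1_nat[OF p(1)] by simp
  then have "\<not> Q \<subseteq> {\<one>}" using card_mono[of "{\<one>}" Q] by auto
  then obtain x where x: "x \<in> Q" "x \<noteq> \<one>" by blast
  interpret Q: group "G\<lparr>carrier := Q\<rparr>" by (rule subgroup_imp_group[OF Q(1)])
  have "x [^]\<^bsub>G\<lparr>carrier := Q\<rparr>\<^esub> p = \<one>\<^bsub>G\<lparr>carrier := Q\<rparr>\<^esub>"
    using Q.pow_order_eq_1[of x] x(1) Q(2) by (simp add: Coset.order_def)
  then have "x [^] p = \<one>" by (simp flip: nat_pow_consistent)
  then show thesis using that x subgroup.mem_carrier[OF Q(1) x(1)] by blast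
qed

text \<open>
  In an abelian normal subgroup \<open>D\<close> the elements of order dividing a prime \<open>r\<close> form a subgroup that is
  again normal, and by Cauchy's theorem no other prime divides its order.
\<close>

lemma (in group) solvable_imp_normal_prime_power:
  assumes fin: "finite (carrier G)" and solv: "solvable G" and nt: "carrier G \<noteq> {\<one>}"
  obtains r k N where "prime r" "subgroup N G" "N \<noteq> {\<one>}" "card N = r ^ k"
    "\<And>h n. h \<in> carrier G \<Longrightarrow> n \<in> N \<Longrightarrow> h \<otimes> n \<otimes> inv h \<in> N"
proof -
  obtain D where D: "D \<lhd> G" "D \<noteq> {\<one>}" "\<And>x y. x \<in> D \<Longrightarrow> y \<in> D \<Longrightarrow> x \<otimes> y = y \<otimes> x"
    by (rule solvable_imp_abelian_normal[OF solv nt], rule that)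
  interpret D: normal D G by fact
  have subD: "subgroup D G" by (rule D.subgroup_axioms)
  interpret GD: group "G\<lparr>carrier := D\<rparr>" by (rule subgroup_imp_group[OF subD])
  have finD: "finite D" using fin D.subset finite_subset by blast
  have "card D \<noteq> 1"
  proof
    assume "card D = 1"
    then obtain z where "D = {z}" by (auto simp: card_1_singleton_iff)
    then show False using D(2) D.one_closed by auto
  qed
  then obtain r where r: "prime r" "r dvd card D" using prime_factor_nat by blast
  define N where "N = {x \<in> D. x [^] r = \<one>}"
  have DG: "x \<in> carrier G" if "x \<in> D" for x using that D.mem_carrier by blast
  have pow_inv: "(inv x) [^] r = inv (x [^] r)" if "x \<in> carrier G" for x
    using that by (simp add: nat_pow_inv)
  have subN: "subgroup N G"
  proof (rule subgroupI)
    have "\<one> \<in> N" by (simp add: N_def)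
    then show "N \<noteq> {}" by blast
    fix x assume x: "x \<in> N"
    then show "inv x \<in> N" using DG pow_inv by (simp add: N_def)
    fix y assume y: "y \<in> N"
    then have "(x \<otimes> y) [^] r = x [^] r \<otimes> y [^] r"
      using x D(3) DG by (intro pow_mult_distrib) (auto simp: N_def)
    then show "x \<otimes> y \<in> N" using x y by (simp add: N_def)
  qed (use DG in \<open>auto simp: N_def\<close>)
  have finN: "finite N" using finD by (simp add: N_def)
  interpret GN: group "G\<lparr>carrier := N\<rparr>" by (rule subgroup_imp_group[OF subN])
  have nontriv: "N \<noteq> {\<one>}"
  proof -
    obtain x where "x \<in> D" "x \<noteq> \<one>" "x [^]\<^bsub>G\<lparr>carrier := D\<rparr>\<^esub> r = \<one>"
      using GD.cauchy_element[of r] finD r by (auto simp: Coset.order_def)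
    then have "x \<in> N" by (simp add: N_def flip: nat_pow_consistent)
    then show ?thesis using \<open>x \<noteq> \<one>\<close> by blast
  qed
  have only_r: "s = r" if s: "prime s" "s dvd card N" for s
  proof (rule ccontr)
    assume ne: "s \<noteq> r"
    obtain x where x: "x \<in> N" "x \<noteq> \<one>" "x [^]\<^bsub>G\<lparr>carrier := N\<rparr>\<^esub> s = \<one>"
      using GN.cauchy_element[of s] finN s by (auto simp: Coset.order_def)
    then have "x [^] s = \<one>" "x [^] r = \<one>" by (auto simp: N_def simp flip: nat_pow_consistent)
    then have "ord x dvd s" "ord x dvd r" using pow_eq_id x(1) DG by (auto simp: N_def)
    moreover have "coprime s r" using primes_coprime s(1) r(1) ne by blast
    ultimately have "ord x = 1" using coprime_common_divisor_nat by blast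
    then show False using ord_eq_1 x(1,2) DG by (simp add: N_def)
  qed
  have "card N \<noteq> 0" using finN subgroup.one_closed[OF subN] by auto
  then obtain m where m: "card N = r ^ multiplicity r (card N) * m" "\<not> r dvd m"
    using multiplicity_decompose'[of "card N" r] r(1) by (metis not_prime_unit)
  have "m = 1"
  proof (rule ccontr)
    assume "m \<noteq> 1"
    then obtain s where s: "prime s" "s dvd m" using prime_factor_nat by blast
    then have "s = r" using only_r m(1) by (metis dvd_mult)
    then show False using s m(2) by simp
  qed
  then have card: "card N = r ^ multiplicity r (card N)" using m(1) by simp
  have conj: "h \<otimes> n \<otimes> inv h \<in> N" if h: "h \<in> carrier G" and n: "n \<in> N" for h n
  proof -
    have nG: "n \<in> carrier G" using n DG by (simp add: N_def)
    have "(h \<otimes> n \<otimes> inv h) [^] i = h \<otimes> n [^] i \<otimes> inv h" for i :: nat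
    proof (induction i)
      case (Suc i)
      then show ?case using h nG by (simp add: m_assoc cancel_inv_left)
    qed (use h in simp)
    then show ?thesis using n h D.inv_op_closed2[OF h] by (simp add: N_def)
  qed
  show thesis by (rule that[OF r(1) subN nontriv card conj])
qed

text \<open>
  The hypothesis of Wielandt's theorem, with the indices \<open>a\<close>, \<open>b\<close>, \<open>c\<close>. As a property of the group
  alone it can be carried through an induction over quotients.
\<close>

definition coprime_solvable_triple :: "('a, 'b) monoid_scheme \<Rightarrow> bool" where
  "coprime_solvable_triple G \<longleftrightarrow> (\<exists>H1 H2 H3 a b c.
    subgroup H1 G \<and> subgroup H2 G \<and> subgroup H3 G \<and>
    solvable_seq G H1 \<and> solvable_seq G H2 \<and> solvable_seq G H3 \<and>
    Coset.order G = a * card H1 \<and> Coset.order G = b * card H2 \<and> Coset.order G = c * card H3 \<and>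
    coprime a b \<and> coprime a c \<and> coprime b c)"

lemma (in group_hom) coprime_solvable_triple_image:
  assumes onto: "h ` carrier G = carrier H" and fin: "finite (carrier G)"
    and G: "coprime_solvable_triple G"
  shows "coprime_solvable_triple H"
proof -
  obtain H1 H2 H3 a b c where *: "subgroup H1 G" "subgroup H2 G" "subgroup H3 G"
    "solvable_seq G H1" "solvable_seq G H2" "solvable_seq G H3"
    "Coset.order G = a * card H1" "Coset.order G = b * card H2" "Coset.order G = c * card H3"
    "coprime a b" "coprime a c" "coprime b c"
    using G unfolding coprime_solvable_triple_def by blast
  obtain a' where a: "a' dvd a" "Coset.order H = a' * card (h ` H1)"
    by (rule image_index_dvd[OF onto fin *(1,7)])
  obtain b' where b: "b' dvd b" "Coset.order H = b' * card (h ` H2)"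
    by (rule image_index_dvd[OF onto fin *(2,8)])
  obtain c' where c: "c' dvd c" "Coset.order H = c' * card (h ` H3)"
    by (rule image_index_dvd[OF onto fin *(3,9)])
  have "coprime a' b'" "coprime a' c'" "coprime b' c'"
    using *(10-12) a(1) b(1) c(1) coprime_divisors by blast+
  then show ?thesis unfolding coprime_solvable_triple_def
    using subgroup_img_is_subgroup[OF *(1)] subgroup_img_is_subgroup[OF *(2)]
      subgroup_img_is_subgroup[OF *(3)] solvable_imp_solvable_img[OF *(4)]
      solvable_imp_solvable_img[OF *(5)] solvable_imp_solvable_img[OF *(6)] a(2) b(2) c(2)
    by blast
qed

text \<open>
  Take a nontrivial normal subgroup of prime power order \<open>r\<^sup>k\<close> in \<open>H1\<close>. The prime \<open>r\<close> cannot divide both \<open>b\<close> and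
  \<open>c\<close>, so the normal closure of this subgroup lies in one of the solvable groups \<open>H2\<close>, \<open>H3\<close>. If \<open>H1\<close> is trivial,
  coprimality of \<open>a\<close> and \<open>b\<close> gives \<open>H2 = G\<close>.
\<close>

lemma (in group) coprime_solvable_triple_step:
  assumes fin: "finite (carrier G)" and triple: "coprime_solvable_triple G"
  shows "solvable G \<or> (\<exists>M. M \<lhd> G \<and> M \<noteq> {\<one>} \<and> solvable_seq G M)"
proof -
  obtain H1 H2 H3 a b c where sub: "subgroup H1 G" "subgroup H2 G" "subgroup H3 G"
    and solv: "solvable_seq G H1" "solvable_seq G H2" "solvable_seq G H3"
    and ord: "Coset.order G = a * card H1" "Coset.order G = b * card H2" "Coset.order G = c * card H3"
    and cop: "coprime a b" "coprime a c" "coprime b c"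
    using triple unfolding coprime_solvable_triple_def by blast
  show ?thesis
  proof (cases "H1 = {\<one>}")
    case True
    then have "a = b * card H2" using ord(1,2) by simp
    then have "b dvd a" by simp
    then have "b = 1" using cop(1) by (metis coprime_common_divisor_nat dvd_refl)
    then have "card H2 = card (carrier G)" using ord(2) by (simp add: Coset.order_def)
    then have "H2 = carrier G" using card_subset_eq[OF fin subgroup.subset[OF sub(2)]] by simp
    then show ?thesis using solv(2) by (simp add: solvable_def)
  next
    case False
    interpret H1: group "G\<lparr>carrier := H1\<rparr>" by (rule subgroup_imp_group[OF sub(1)])
    have finH: "finite (carrier (G\<lparr>carrier := H1\<rparr>))"
      using fin subgroup.subset[OF sub(1)] finite_subset by auto
    have solvH: "solvable (G\<lparr>carrier := H1\<rparr>)" using solvable_subgroup_iff[OF sub(1)] solv(1) by blast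
    have nt: "carrier (G\<lparr>carrier := H1\<rparr>) \<noteq> {\<one>\<^bsub>G\<lparr>carrier := H1\<rparr>\<^esub>}" using False by simp
    obtain r k N where N: "prime r" "subgroup N (G\<lparr>carrier := H1\<rparr>)" "N \<noteq> {\<one>\<^bsub>G\<lparr>carrier := H1\<rparr>\<^esub>}"
      "card N = r ^ k"
      and conj: "\<And>h n. h \<in> carrier (G\<lparr>carrier := H1\<rparr>) \<Longrightarrow> n \<in> N \<Longrightarrow>
        h \<otimes>\<^bsub>G\<lparr>carrier := H1\<rparr>\<^esub> n \<otimes>\<^bsub>G\<lparr>carrier := H1\<rparr>\<^esub> inv\<^bsub>G\<lparr>carrier := H1\<rparr>\<^esub> h \<in> N"
      by (rule H1.solvable_imp_normal_prime_power[OF finH solvH nt], rule that)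
    have subN: "subgroup N G" by (rule incl_subgroup[OF sub(1) N(2)])
    have ntN: "N \<noteq> {\<one>}" using N(3) by simp
    have conjN: "h \<otimes> n \<otimes> inv h \<in> N" if "h \<in> H1" "n \<in> N" for h n
      using conj[of h n] that by (simp add: m_inv_consistent[OF sub(1)])
    have "\<not> r dvd b \<or> \<not> r dvd c"
      using cop(3) N(1) coprime_common_divisor_nat[of b c r] by auto
    then obtain J d where J: "subgroup J G" "solvable_seq G J" "Coset.order G = d * card J" "coprime a d"
      "\<not> r dvd d"
      using sub solv ord cop by blast
    obtain M where M: "M \<lhd> G" "M \<noteq> {\<one>}" "M \<subseteq> J"
      by (rule normal_closure_in_coprime_subgroup[OF fin sub(1) ord(1) J(1,3,4) subN ntN N(4,1) J(5) conjN])
    have "solvable_seq G M"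
      by (rule solvable_seq_mono[OF normal_imp_subgroup[OF M(1)] J(1) M(3) J(2)])
    then show ?thesis using M by blast
  qed
qed

lemma coprime_solvable_triple_imp_solvable_nat:
  fixes G :: "nat monoid"
  assumes "group G" "finite (carrier G)" "coprime_solvable_triple G"
  shows "solvable G"
  using assms
proof (induction "Coset.order G" arbitrary: G rule: less_induct)
  case less
  interpret group G by fact
  show ?case
  proof (cases "solvable G")
    case False
    then obtain M where M: "M \<lhd> G" "M \<noteq> {\<one>\<^bsub>G\<^esub>}" "solvable_seq G M"
      using coprime_solvable_triple_step[OF less.prems(2,3)] by blast
    have subM: "subgroup M G" by (rule normal_imp_subgroup[OF M(1)])
    obtain K :: "nat monoid" and f where f: "group_hom G K f" "f ` carrier G = carrier K"
      "kernel G K f = M" "finite (carrier K)"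
      by (rule hom_onto_nat_group[OF M(1) less.prems(2)])
    have ordK: "Coset.order G = Coset.order K * card M"
      using group_hom.order_eq_image_kernel[OF f(1)] by (simp add: f Coset.order_def)
    have finM: "finite M" using less.prems(2) subgroup.subset[OF subM] finite_subset by blast
    have "{\<one>\<^bsub>G\<^esub>} \<subset> M" using M(2) subgroup.one_closed[OF subM] by auto
    then have "card {\<one>\<^bsub>G\<^esub>} < card M" by (rule psubset_card_mono[OF finM])
    then have "card M > 1" by simp
    moreover have "Coset.order K > 0"
      using f(1,4) monoid.order_gt_0_iff_finite[of K] by (simp add: group_hom_def group_def)
    ultimately have "Coset.order K < Coset.order G" using ordK by simp
    then have "solvable K"
      using less.hyps[of K] f(1,4) group_hom.coprime_solvable_triple_image[OF f(1,2) less.prems(2,3)]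
      by (simp add: group_hom_def)
    then show ?thesis using group_hom.solvable_if_kernel_and_image[OF f(1)] f(2,3) M(3) by simp
  qed
qed

text \<open>
  Wielandt's theorem. The solvable normal subgroup of \<open>coprime_solvable_triple_step\<close> is
  divided out, and the three subgroups are replaced by their images.
\<close>

theorem (in group) coprime_solvable_triple_imp_solvable:
  assumes "finite (carrier G)" "coprime_solvable_triple G"
  shows "solvable G"
  using assms(1)
proof (rule solvable_via_nat_group)
  fix K :: "nat monoid" and f
  assume "group_hom G K f" "f ` carrier G = carrier K" "finite (carrier K)"
  then show "solvable K"
    using coprime_solvable_triple_imp_solvable_nat[of K] assms
      group_hom.coprime_solvable_triple_image[of G K f] by (simp add: group_hom_def)
qed

section \<open>Positive words of a symmetric set\<close>

locale symmetric_solution =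
  fixes X :: "'a set" and S :: "'a \<times> 'a \<Rightarrow> 'a \<times> 'a"
  assumes fin: "finite X" and bij_S: "bij_betw S (X \<times> X) (X \<times> X)"
    and nondeg: "nondegenerate X S" and symm: "symmetric_set X S"
begin

abbreviation g where "g \<equiv> g_map S"
abbreviation f where "f \<equiv> f_map S"

lemma S_eq: "S (x, y) = (g x y, f y x)"
  by (simp add: g_map_def f_map_def)

lemma g_bij: "x \<in> X \<Longrightarrow> bij_betw (g x) X X" and f_bij: "x \<in> X \<Longrightarrow> bij_betw (f x) X X"
  using nondeg by (auto simp: nondegenerate_def)

lemma g_closed: "x \<in> X \<Longrightarrow> y \<in> X \<Longrightarrow> g x y \<in> X" and f_closed: "x \<in> X \<Longrightarrow> y \<in> X \<Longrightarrow> f x y \<in> X"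
  using g_bij f_bij bij_betwE by blast+

lemma g_g_f: "x \<in> X \<Longrightarrow> y \<in> X \<Longrightarrow> g (g x y) (f y x) = x"
  using symm by (auto simp: symmetric_set_def involutive_def S_eq)

text \<open>
  The first component of the braid equation: \<open>x \<mapsto> g\<^sub>x\<close> is compatible with the relations of the
  structure group, so words act on \<open>X\<close>.
\<close>

lemma g_comp:
  assumes "x \<in> X" "y \<in> X" "z \<in> X"
  shows "g (g x y) (g (f y x) z) = g x (g y z)"
  using symm assms by (auto simp: symmetric_set_def braided_def S12_def S23_def S_eq)

text \<open>
  The action of positive words on \<open>X\<close>, and the cocycle as a list: the trace of \<open>x y z \<dots>\<close>
  is \<open>x\<close>, \<open>g\<^sub>x y\<close>, \<open>g\<^sub>x (g\<^sub>y z)\<close> and so on. Its multiset is the value of the cocycle.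
\<close>

primrec lam :: "'a list \<Rightarrow> 'a \<Rightarrow> 'a" where
  "lam [] = id"
| "lam (x # w) = g x \<circ> lam w"

primrec trace :: "'a list \<Rightarrow> 'a list" where
  "trace [] = []"
| "trace (x # w) = x # map (g x) (trace w)"

lemma lam_append: "lam (u @ v) = lam u \<circ> lam v"
  by (induction u) (auto simp: o_assoc)

lemma trace_append: "trace (u @ v) = trace u @ map (lam u) (trace v)"
  by (induction u) auto

lemma length_trace [simp]: "length (trace w) = length w"
  by (induction w) auto

lemma lam_bij: "w \<in> lists X \<Longrightarrow> bij_betw (lam w) X X"
proof (induction w rule: list.induct)
  case (Cons x w)
  then show ?case using bij_betw_trans[OF _ g_bij, of "lam w" X x] by (simp add: o_def)
qed simp

lemma lam_closed: "w \<in> lists X \<Longrightarrow> z \<in> X \<Longrightarrow> lam w z \<in> X"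
  using bij_betwE[OF lam_bij] by blast

lemma lam_inj: "w \<in> lists X \<Longrightarrow> y \<in> X \<Longrightarrow> z \<in> X \<Longrightarrow> lam w y = lam w z \<longleftrightarrow> y = z"
  using inj_on_eq_iff[of "lam w" X y z] lam_bij[of w] by (simp add: bij_betw_def)

lemma lam_surj:
  assumes "w \<in> lists X" "z \<in> X"
  obtains y where "y \<in> X" "lam w y = z"
proof -
  have "z \<in> lam w ` X" using lam_bij[OF assms(1)] assms(2) by (simp add: bij_betw_def)
  then show thesis using that by auto
qed

lemma trace_closed: "w \<in> lists X \<Longrightarrow> set (trace w) \<subseteq> X"
  by (induction w) (auto intro: g_closed)

text \<open>
  The letters of the word can be recovered one by one, because all \<open>g\<^sub>x\<close> are bijective.
\<close>

lemma trace_surj: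
  assumes "ys \<in> lists X"
  obtains w where "w \<in> lists X" "trace w = ys"
proof -
  have "\<exists>w\<in>lists X. trace w = ys" using assms
  proof (induction ys rule: length_induct)
    case (1 ys)
    show ?case
    proof (cases ys)
      case (Cons x xs)
      have x: "x \<in> X" and xs: "xs \<in> lists X" using 1(2) Cons by auto
      let ?h = "inv_into X (g x)"
      have h: "?h y \<in> X" "g x (?h y) = y" if "y \<in> X" for y
        using g_bij[OF x] that by (auto simp: bij_betw_def inv_into_into f_inv_into_f)
      have "map ?h xs \<in> lists X" using xs h by auto
      then obtain w where w: "w \<in> lists X" "trace w = map ?h xs"
        using 1(1) Cons by (metis length_Cons length_map lessI)
      have "map (g x) (map ?h xs) = xs" using xs h by (induction xs) auto
      then have "trace (x # w) = ys" using w Cons by simp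
      then show ?thesis using w x by (intro bexI[of _ "x # w"]) auto
    qed (intro bexI[of _ "[]"], auto)
  qed
  then show thesis using that by blast
qed

lemma count_map_perm:
  assumes "bij_betw \<sigma> X X" "set ys \<subseteq> X" "z \<in> X"
  shows "count (mset (map \<sigma> ys)) (\<sigma> z) = count (mset ys) z"
  using assms(2)
proof (induction ys)
  case (Cons y ys)
  have "\<sigma> y = \<sigma> z \<longleftrightarrow> y = z" using assms(1,3) Cons.prems by (auto simp: bij_betw_def inj_on_def)
  then show ?case using Cons by auto
qed simp

lemma count_trace_outside: "w \<in> lists X \<Longrightarrow> z \<notin> X \<Longrightarrow> count (mset (trace w)) z = 0"
  using trace_closed by (metis count_inI in_mono set_mset_mset)

text \<open>
  The cocycle rule, in coordinates that avoid the inverse of \<open>lam u\<close>.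
\<close>

lemma count_trace_append:
  assumes "u \<in> lists X" "v \<in> lists X" "z \<in> X"
  shows "count (mset (trace (u @ v))) (lam u z) = count (mset (trace u)) (lam u z) + count (mset (trace v)) z"
  using count_map_perm[OF lam_bij[OF assms(1)] trace_closed[OF assms(2)] assms(3)]
  by (simp add: trace_append)

abbreviation R where "R \<equiv> structure_relations X S"

abbreviation pos :: "'a list \<Rightarrow> ('a \<times> bool) list" where
  "pos \<equiv> map (\<lambda>x. (x, True))"

lemma pos_words: "w \<in> lists X \<Longrightarrow> pos w \<in> group_words X"
  by (induction w) (auto simp: group_words_def)

text \<open>
  Equality in the structure group is bundled with the equality of the two invariants, the cocycle
  and the action, so that one induction over applications of the relations establishes all three.
\<close>

definition equal_pos :: "'a list \<Rightarrow> 'a list \<Rightarrow> bool" where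
  "equal_pos u w \<longleftrightarrow> u \<in> lists X \<and> w \<in> lists X \<and> (pos u, pos w) \<in> pres_cong X R \<and>
    mset (trace u) = mset (trace w) \<and> (\<forall>z\<in>X. lam u z = lam w z)"

lemma equal_pos_refl: "w \<in> lists X \<Longrightarrow> equal_pos w w"
  by (simp add: equal_pos_def pres_cong.refl pos_words)

lemma equal_pos_sym: "equal_pos u w \<Longrightarrow> equal_pos w u"
  by (auto simp: equal_pos_def intro: pres_cong.sym)

lemma equal_pos_trans: "equal_pos u v \<Longrightarrow> equal_pos v w \<Longrightarrow> equal_pos u w"
  by (auto simp: equal_pos_def intro: pres_cong.trans)

lemma equal_pos_Cons:
  assumes "x \<in> X" "equal_pos u w"
  shows "equal_pos (x # u) (x # w)"
proof -
  have "[(x, True)] \<in> group_words X" using assms(1) by (simp add: group_words_def)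
  then have "([(x, True)] @ pos u, [(x, True)] @ pos w) \<in> pres_cong X R"
    using assms(2) by (intro pres_cong.append pres_cong.refl) (simp_all add: equal_pos_def)
  then show ?thesis using assms by (simp add: equal_pos_def)
qed

text \<open>
  A defining relation preserves the trace up to the order of its first two entries: the traces of
  \<open>x y\<close> and \<open>g\<^sub>x y, f\<^sub>y x\<close> are \<open>x, g\<^sub>x y\<close> and \<open>g\<^sub>x y, x\<close>, the latter by involutivity. The tails agree by
  the braid equation.
\<close>

lemma equal_pos_swap:
  assumes "x \<in> X" "y \<in> X" "w \<in> lists X"
  shows "equal_pos (x # y # w) (g x y # f y x # w)"
proof -
  have "([(x, True), (y, True)], [(g x y, True), (f y x, True)]) \<in> R"
    using assms S_eq by (auto simp: structure_relations_def)
  from pres_cong.append[OF pres_cong.rel[OF this] pres_cong.refl[OF pos_words[OF assms(3)]]]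
  have "(pos (x # y # w), pos (g x y # f y x # w)) \<in> pres_cong X R" by simp
  moreover have "map (g x) (map (g y) (trace w)) = map (g (g x y)) (map (g (f y x)) (trace w))"
    using trace_closed[OF assms(3)] assms by (auto simp: g_comp)
  ultimately show ?thesis
    using assms lam_closed[OF assms(3)]
    by (simp add: equal_pos_def g_closed f_closed g_comp g_g_f del: map_map)
qed

text \<open>
  An entry of the trace is moved to the front by applying the defining relation once at each letter before it.
\<close>

lemma equal_pos_pull_letter:
  assumes "w \<in> lists X" "x \<in> set (trace w)"
  shows "\<exists>w'. equal_pos w (x # w')"
  using assms
proof (induction w arbitrary: x rule: list.induct)
  case (Cons z v)
  then have z: "z \<in> X" "v \<in> lists X" by auto
  show ?case
  proof (cases "x = z")
    case True
    then show ?thesis using equal_pos_refl[OF Cons.prems(1)] by blast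
  next
    case False
    then obtain y where y: "y \<in> set (trace v)" "x = g z y" using Cons.prems(2) by auto
    then obtain v' where v': "equal_pos v (y # v')" using Cons.IH z(2) by blast
    then have yv: "y \<in> X" "v' \<in> lists X" by (auto simp: equal_pos_def)
    have "equal_pos (z # v) (g z y # f y z # v')"
      by (rule equal_pos_trans[OF equal_pos_Cons[OF z(1) v'] equal_pos_swap[OF z(1) yv]])
    then show ?thesis using y(2) by blast
  qed
qed simp

lemma image_mset_inj_eq:
  assumes "inj_on h A" "set_mset M \<subseteq> A" "set_mset N \<subseteq> A" "image_mset h M = image_mset h N"
  shows "M = N"
proof -
  have "image_mset (inv_into A h) (image_mset h L) = L" if "set_mset L \<subseteq> A" for L
    using that assms(1) by (induction L) auto
  then show ?thesis using assms(2-4) by metis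
qed

text \<open>
  The multiset of the trace is a complete invariant of positive words: pull the first letter
  of one word to the front of the other and compare the rest.
\<close>

lemma equal_pos_if_mset_trace_eq:
  assumes "u \<in> lists X" "w \<in> lists X" "mset (trace u) = mset (trace w)"
  shows "equal_pos u w"
  using assms
proof (induction u arbitrary: w rule: list.induct)
  case Nil
  then have "length (trace w) = 0" by (metis mset.simps(1) mset_zero_iff_right list.size(3) trace.simps(1))
  then show ?case using equal_pos_refl[of "[]"] by simp
next
  case (Cons x u)
  then have x: "x \<in> X" "u \<in> lists X" by auto
  have "x \<in> set (trace w)" using Cons.prems(3) by (metis mset_eq_setD list.set_intros(1) trace.simps(2))
  then obtain w' where w': "equal_pos w (x # w')" using equal_pos_pull_letter Cons.prems(2) by blast
  then have w'X: "w' \<in> lists X" and "mset (trace (x # u)) = mset (trace (x # w'))"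
    using Cons.prems(3) by (auto simp: equal_pos_def)
  then have "image_mset (g x) (mset (trace u)) = image_mset (g x) (mset (trace w'))" by simp
  then have "mset (trace u) = mset (trace w')"
    using image_mset_inj_eq[of "g x" X] g_bij[OF x(1)] trace_closed[OF x(2)] trace_closed[OF w'X]
    by (simp add: bij_betw_def)
  then have "equal_pos u w'" using Cons.IH x(2) w'X by blast
  then show ?case using equal_pos_trans[OF equal_pos_Cons[OF x(1)] equal_pos_sym[OF w']] by blast
qed

text \<open>
  If \<open>g\<^sub>z\<close> sends \<open>y\<close> to \<open>z\<close>, then involutivity gives \<open>f\<^sub>y z = y\<close>, so \<open>z\<close> is determined by \<open>y\<close>.
\<close>

lemma power_word_step_inj:
  assumes "z \<in> X" "z' \<in> X" "y \<in> X" "g z y = z" "g z' y = z'"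
  shows "z = z'"
proof -
  have "f y z = y" if "z \<in> X" "g z y = z" for z
  proof -
    have "g z (f y z) = g z y" using g_g_f[OF that(1) assms(3)] that(2) by simp
    then show ?thesis using g_bij[OF that(1)] f_closed[OF assms(3) that(1)] assms(3)
      by (auto simp: bij_betw_def inj_on_def)
  qed
  then have "f y z = f y z'" using assms by metis
  then show ?thesis using f_bij[OF assms(3)] assms(1,2) by (auto simp: bij_betw_def inj_on_def)
qed

text \<open>
  Let \<open>W k\<close> be the word with trace \<open>x, \<dots>, x\<close> of length \<open>k\<close>. Two of the permutations of the finite set \<open>X\<close>
  given by these words coincide. The permutation of \<open>W (Suc k)\<close> determines the one of \<open>W k\<close>: the letter
  \<open>z\<close> added to \<open>W k\<close> satisfies \<open>g\<^sub>z y = z\<close> for the \<open>y\<close> that \<open>W (Suc k)\<close> sends to \<open>x\<close>, and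
  \<open>power_word_step_inj\<close> recovers it. So the coincidence can be moved down to \<open>W 0\<close>, the empty word.
\<close>

lemma period_of_letter:
  assumes x: "x \<in> X"
  obtains d w where "d > 0" "w \<in> lists X" "trace w = replicate d x" "\<And>z. z \<in> X \<Longrightarrow> lam w z = z"
proof -
  have ex: "\<exists>w. w \<in> lists X \<and> trace w = replicate k x" for k
    using trace_surj[of "replicate k x"] x by (metis in_lists_conv_set in_set_replicate)
  define z where "z = (\<lambda>w. inv_into X (lam w) x)"
  have z: "z w \<in> X" "lam w (z w) = x" if "w \<in> lists X" for w
    using lam_bij[OF that] x by (auto simp: z_def bij_betw_def inv_into_into f_inv_into_f)
  define W where "W = rec_nat [] (\<lambda>_ w. w @ [z w])"
  have W0: "W 0 = []" and WS: "W (Suc k) = W k @ [z (W k)]" for k by (simp_all add: W_def)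
  have WX: "W k \<in> lists X" for k by (induction k) (auto simp: W0 WS z)
  have trW: "trace (W k) = replicate k x" for k
    by (induction k) (auto simp: W0 WS trace_append z WX replicate_append_same)
  have same: "\<forall>y\<in>X. lam (W i) y = lam (W j) y" if "\<forall>y\<in>X. lam (W (Suc i)) y = lam (W (Suc j)) y" for i j
  proof -
    have Y: "\<exists>y\<in>X. lam (W (Suc i)) y = x" using lam_surj[OF WX x] by metis
    then obtain y where y: "y \<in> X" "lam (W (Suc i)) y = x" by blast
    then have y': "lam (W (Suc j)) y = x" using that by simp
    have fixed: "g (z (W k)) y = z (W k)" if "lam (W (Suc k)) y = x" for k
    proof -
      have "lam (W k) (g (z (W k)) y) = lam (W k) (z (W k))"
        using that z(2)[OF WX[of k]] by (simp add: WS lam_append)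
      then show ?thesis using lam_inj[OF WX] g_closed z(1)[OF WX] y(1) by blast
    qed
    have zz: "z (W i) = z (W j)"
      by (rule power_word_step_inj[OF z(1)[OF WX] z(1)[OF WX] y(1) fixed[OF y(2)] fixed[OF y']])
    show ?thesis
    proof
      fix v assume "v \<in> X"
      then have "v \<in> g (z (W i)) ` X" using g_bij[OF z(1)[OF WX[of i]]] by (simp add: bij_betw_def)
      then obtain u where u: "u \<in> X" "g (z (W i)) u = v" by auto
      then show "lam (W i) v = lam (W j) v"
        using bspec[OF that u(1)] by (simp add: WS lam_append zz)
    qed
  qed
  have "finite (X \<rightarrow>\<^sub>E X)" using fin by (simp add: finite_PiE)
  moreover have "range (\<lambda>k. restrict (lam (W k)) X) \<subseteq> X \<rightarrow>\<^sub>E X" using lam_closed[OF WX] by auto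
  ultimately have "\<not> inj (\<lambda>k. restrict (lam (W k)) X)"
    using range_inj_infinite finite_subset by metis
  then obtain i j where ij: "i < j" "restrict (lam (W i)) X = restrict (lam (W j)) X"
    unfolding inj_def by (metis linorder_neqE_nat)
  then have "\<forall>y\<in>X. lam (W i) y = lam (W j) y" by (metis restrict_apply')
  then have "\<forall>y\<in>X. lam (W 0) y = lam (W (j - i)) y" using \<open>i < j\<close>
  proof (induction i arbitrary: j)
    case (Suc i)
    then obtain j' where j: "j = Suc j'" by (cases j) auto
    then have "\<forall>y\<in>X. lam (W i) y = lam (W j') y" using same[of i j'] Suc.prems(1) by blast
    then show ?case using Suc.IH[of j'] Suc.prems(2) j by simp
  qed simp
  then show thesis using that[of "j - i" "W (j - i)"] ij(1) WX trW by (simp add: W0)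
qed

text \<open>
  The traces of words that act trivially are concatenated when the words are, so powers of the words
  from \<open>period_of_letter\<close> reach a common multiple of the periods.
\<close>

lemma common_period:
  obtains e where "e > 0"
    "\<And>x. x \<in> X \<Longrightarrow> \<exists>w\<in>lists X. trace w = replicate e x \<and> (\<forall>z\<in>X. lam w z = z)"
proof -
  have "\<exists>d w. d > 0 \<and> w \<in> lists X \<and> trace w = replicate d x \<and> (\<forall>z\<in>X. lam w z = z)" if "x \<in> X" for x
    using period_of_letter[OF that] by metis
  then obtain d w where dw: "\<And>x. x \<in> X \<Longrightarrow> d x > 0 \<and> w x \<in> lists X \<and> trace (w x) = replicate (d x) x \<and>
    (\<forall>z\<in>X. lam (w x) z = z)" by metis
  show thesis
  proof (rule that[of "\<Prod>x\<in>X. d x"])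
    show "(\<Prod>x\<in>X. d x) > 0" using dw by (simp add: prod_pos)
    fix x assume x: "x \<in> X"
    have "\<exists>v\<in>lists X. trace v = replicate (n * d x) x \<and> (\<forall>z\<in>X. lam v z = z)" for n
    proof (induction n)
      case 0
      show ?case by (intro bexI[of _ "[]"]) auto
    next
      case (Suc n)
      then obtain v where v: "v \<in> lists X" "trace v = replicate (n * d x) x" "\<forall>z\<in>X. lam v z = z" by blast
      have "map (lam (w x)) (replicate k x) = replicate k x" for k using dw[OF x] x by (induction k) auto
      then have "trace (w x @ v) = replicate (Suc n * d x) x"
        using v dw[OF x] by (simp add: trace_append replicate_add)
      then show ?case using v dw[OF x] by (intro bexI[of _ "w x @ v"]) (auto simp: lam_append)
    qed
    moreover have "d x dvd (\<Prod>x\<in>X. d x)" by (rule dvd_prodI[OF fin x])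
    ultimately show "\<exists>v\<in>lists X. trace v = replicate (\<Prod>x\<in>X. d x) x \<and> (\<forall>z\<in>X. lam v z = z)"
      by (metis dvdE mult.commute)
  qed
qed

end

section \<open>Homomorphisms out of a presented group\<close>

fun word_value :: "('b, 'c) monoid_scheme \<Rightarrow> ('a \<Rightarrow> 'b) \<Rightarrow> ('a \<times> bool) list \<Rightarrow> 'b" where
  "word_value H a [] = \<one>\<^bsub>H\<^esub>"
| "word_value H a ((x, e) # w) = (if e then a x else inv\<^bsub>H\<^esub> (a x)) \<otimes>\<^bsub>H\<^esub> word_value H a w"

context
  fixes X :: "'a set" and R and H :: "('b, 'c) monoid_scheme" and a :: "'a \<Rightarrow> 'b"
  assumes R: "R \<subseteq> group_words X \<times> group_words X" and H: "group H"
    and a: "\<And>x. x \<in> X \<Longrightarrow> a x \<in> carrier H"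
    and rel: "\<And>u v. (u, v) \<in> R \<Longrightarrow> word_value H a u = word_value H a v"
begin

interpretation H: group H by (rule H)

lemma word_value_closed: "w \<in> group_words X \<Longrightarrow> word_value H a w \<in> carrier H"
proof (induction w rule: list.induct)
  case (Cons y w)
  then show ?case using a by (cases y) (auto simp: group_words_def)
qed simp

lemma word_value_append:
  "u \<in> group_words X \<Longrightarrow> v \<in> group_words X \<Longrightarrow>
    word_value H a (u @ v) = word_value H a u \<otimes>\<^bsub>H\<^esub> word_value H a v"
proof (induction u rule: list.induct)
  case Nil
  then show ?case using word_value_closed by simp
next
  case (Cons y u)
  obtain x e where y: "y = (x, e)" by force
  have "x \<in> X" "u \<in> group_words X" using Cons.prems(1) by (auto simp: group_words_def y)
  then show ?case using Cons a word_value_closed by (simp add: y H.m_assoc)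
qed

lemma word_value_cong: "(u, v) \<in> pres_cong X R \<Longrightarrow> word_value H a u = word_value H a v"
proof (induction rule: pres_cong.induct)
  case (append u v u' v')
  then show ?case using word_value_append pres_cong_words[OF R] by metis
qed (use rel a in auto)

text \<open>
  The universal property of a presentation: an assignment that respects the relations extends to
  the group.
\<close>

lemma presented_group_hom:
  obtains \<phi> where "group_hom (presented_group X R) H \<phi>"
    "\<And>w. w \<in> group_words X \<Longrightarrow> \<phi> (pres_cong X R `` {w}) = word_value H a w"
proof -
  let ?C = "pres_cong X R" and ?G = "presented_group X R"
  define \<phi> where "\<phi> = (\<lambda>A. word_value H a (SOME w. w \<in> A))"
  have \<phi>: "\<phi> (?C `` {w}) = word_value H a w" if w: "w \<in> group_words X" for w
  proof -
    have "w \<in> ?C `` {w}" using pres_cong.refl[OF w] by simp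
    then have "(SOME v. v \<in> ?C `` {w}) \<in> ?C `` {w}" by (rule someI)
    then have "(w, SOME v. v \<in> ?C `` {w}) \<in> ?C" by simp
    then show ?thesis using word_value_cong by (simp add: \<phi>_def)
  qed
  have C: "\<exists>w\<in>group_words X. A = ?C `` {w}" if "A \<in> carrier ?G" for A
    using that by (auto simp: presented_group_def elim: quotientE)
  have "\<phi> \<in> hom ?G H"
  proof (rule homI)
    fix A assume "A \<in> carrier ?G"
    then show "\<phi> A \<in> carrier H" using C[of A] \<phi> word_value_closed by auto
  next
    fix A B assume "A \<in> carrier ?G" "B \<in> carrier ?G"
    then obtain u v where uv: "u \<in> group_words X" "A = ?C `` {u}" "v \<in> group_words X" "B = ?C `` {v}"
      using C[of A] C[of B] by auto
    have "u @ v \<in> group_words X" using uv by (simp add: group_words_def)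
    then show "\<phi> (A \<otimes>\<^bsub>?G\<^esub> B) = \<phi> A \<otimes>\<^bsub>H\<^esub> \<phi> B"
      using presented_group_mult[OF R uv(1,3)] \<phi> uv word_value_append by simp
  qed
  then have "group_hom ?G H \<phi>"
    using group_presented_group[OF R] H by (simp add: group_hom_def group_hom_axioms_def)
  then show thesis using that \<phi> by blast
qed

end

section \<open>The finite quotient\<close>

locale symmetric_solution_period = symmetric_solution +
  fixes e :: nat
  assumes e_pos: "e > 0"
    and period: "\<And>x. x \<in> X \<Longrightarrow> \<exists>w\<in>lists X. trace w = replicate e x \<and> (\<forall>z\<in>X. lam w z = z)"
begin

abbreviation cnt :: "'a list \<Rightarrow> 'a \<Rightarrow> nat" where
  "cnt w z \<equiv> count (mset (trace w)) z"

lemma word_with_counts: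
  obtains w where "w \<in> lists X" "\<And>z. z \<in> X \<Longrightarrow> cnt w z = c z"
proof -
  obtain xs where xs: "distinct xs" "set xs = X" using finite_distinct_list[OF fin] by blast
  let ?ys = "concat (map (\<lambda>z. replicate (c z) z) xs)"
  have "?ys \<in> lists X" using xs(2) by (auto simp: in_lists_conv_set split: if_splits)
  then obtain w where w: "w \<in> lists X" "trace w = ?ys" by (rule trace_surj)
  have "count (mset (concat (map (\<lambda>z. replicate (c z) z) zs))) y = (if y \<in> set zs then c y else 0)"
    if "distinct zs" for zs y
    using that by (induction zs) auto
  then show thesis using that[OF w(1)] w(2) xs by simp
qed

text \<open>
  A word whose multiset has \<open>e\<close> copies of \<open>x\<close> can be rewritten so that it starts with the word of
  trace \<open>x, \<dots>, x\<close> from \<open>period\<close>. This prefix acts trivially, so the rest keeps the remaining trace entries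
  and is shorter.
\<close>

lemma lam_trivial:
  assumes "w \<in> lists X" "\<And>z. z \<in> X \<Longrightarrow> e dvd cnt w z" "z \<in> X"
  shows "lam w z = z"
  using assms
proof (induction "length w" arbitrary: w z rule: less_induct)
  case less
  show ?case
  proof (cases w)
    case (Cons x v)
    then have x: "x \<in> X" using less.prems(1) by auto
    have "cnt w x > 0" using Cons by simp
    then have "e \<le> cnt w x" using less.prems(2)[OF x] by (rule dvd_imp_le[rotated])
    then have sub: "replicate_mset e x \<subseteq># mset (trace w)" by (simp add: count_le_replicate_mset_subset_eq)
    obtain ys where ys: "mset ys = mset (trace w) - replicate_mset e x" using ex_mset by blast
    have "set ys \<subseteq> set (trace w)" using arg_cong[OF ys, of set_mset] by (auto dest: in_diffD)
    then have "set ys \<subseteq> X" using trace_closed[OF less.prems(1)] by (rule subset_trans)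
    then have "ys \<in> lists X" by auto
    then obtain u where u: "u \<in> lists X" "trace u = ys" by (rule trace_surj)
    obtain p where p: "p \<in> lists X" "trace p = replicate e x" "\<forall>z\<in>X. lam p z = z" using period[OF x] by blast
    have "map (lam p) ys = ys" using \<open>set ys \<subseteq> X\<close> p(3) by (intro map_idI) auto
    then have "mset (trace (p @ u)) = mset (trace w)"
      using sub u p(2) ys by (simp add: trace_append)
    then have "equal_pos w (p @ u)" using p(1) u(1) less.prems(1) by (intro equal_pos_if_mset_trace_eq) auto
    then have "lam w z = lam p (lam u z)" using less.prems(3) by (simp add: equal_pos_def lam_append)
    also have "\<dots> = lam u z" using p(3) lam_closed[OF u(1) less.prems(3)] by blast
    also have "\<dots> = z"
    proof (rule less.hyps[OF _ u(1) _ less.prems(3)])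
      have "size (mset ys) = length w - e" using ys sub by (simp add: size_Diff_submset)
      then have "length u = length w - e" using u(2) by (metis length_trace size_mset)
      then show "length u < length w" using e_pos Cons by simp
      show "e dvd cnt u y" if "y \<in> X" for y
        using less.prems(2)[OF that] u(2) ys by (auto simp: dvd_diff_nat)
    qed
    finally show ?thesis .
  qed simp
qed

text \<open>
  A word \<open>w\<close> with cocycle \<open>(e - 1)\<close> times \<open>u\<inverse> (\<pi> u)\<close> is an inverse of \<open>u\<close> modulo \<open>e\<close>: the words
  \<open>u w\<close> and \<open>w u\<close> have cocycles divisible by \<open>e\<close>, so they act trivially. Modulo \<open>e\<close> the cocycle of \<open>w v\<close> is that of
  \<open>w u\<close>, so \<open>w\<close> inverts the action of \<open>v\<close> as well.
\<close>

lemma lam_determined_by_counts: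
  assumes u: "u \<in> lists X" and v: "v \<in> lists X"
    and eq: "\<And>z. z \<in> X \<Longrightarrow> cnt u z mod e = cnt v z mod e" and z: "z \<in> X"
  shows "lam u z = lam v z"
proof -
  obtain w0 where w0: "w0 \<in> lists X" "\<And>z. z \<in> X \<Longrightarrow> cnt w0 z = (e - 1) * cnt u z"
    by (rule word_with_counts[of "\<lambda>z. (e - 1) * cnt u z"], rule that)
  let ?h = "inv_into X (lam u)"
  have h: "?h y \<in> X" "lam u (?h y) = y" if "y \<in> X" for y
    using lam_bij[OF u] that by (auto simp: bij_betw_def inv_into_into f_inv_into_f)
  have hbij: "bij_betw ?h X X" by (rule bij_betw_inv_into[OF lam_bij[OF u]])
  have "map ?h (trace w0) \<in> lists X" using subsetD[OF trace_closed[OF w0(1)]] h(1) by auto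
  then obtain w where w: "w \<in> lists X" "trace w = map ?h (trace w0)" by (rule trace_surj)
  have cw: "cnt w (?h y) = (e - 1) * cnt u y" if "y \<in> X" for y
    unfolding w(2) using count_map_perm[OF hbij trace_closed[OF w0(1)] that] w0(2)[OF that] by simp
  have uw: "lam u (lam w y) = y" if y: "y \<in> X" for y
  proof -
    have "lam (u @ w) y = y"
    proof (rule lam_trivial[OF _ _ y])
      show "e dvd cnt (u @ w) x" if x: "x \<in> X" for x
      proof -
        have "cnt (u @ w) (lam u (?h x)) = cnt u x + (e - 1) * cnt u x"
          using count_trace_append[OF u w(1) h(1)[OF x]] cw[OF x] h(2)[OF x] by simp
        also have "\<dots> = e * cnt u x" using e_pos by (cases e) auto
        finally show ?thesis using h(2)[OF x] by simp
      qed
    qed (use u w in auto)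
    then show ?thesis by (simp add: lam_append)
  qed
  have hw: "lam w y = ?h y" if "y \<in> X" for y
    using uw[OF that] h[OF that] lam_inj[OF u lam_closed[OF w(1) that] h(1)[OF that]] by simp
  have vw: "lam w (lam v' y) = y"
    if v': "v' \<in> lists X" "\<And>z. z \<in> X \<Longrightarrow> cnt u z mod e = cnt v' z mod e" and y: "y \<in> X" for v' y
  proof -
    have "lam (w @ v') y = y"
    proof (rule lam_trivial[OF _ _ y])
      show "e dvd cnt (w @ v') x" if x: "x \<in> X" for x
      proof -
        obtain x' where x': "x' \<in> X" "lam w x' = x" using lam_surj[OF w(1) x] by metis
        have "cnt (w @ v') x = cnt w x + cnt v' x'"
          using count_trace_append[OF w(1) v'(1) x'(1)] x'(2) by simp
        also have "cnt w x = (e - 1) * cnt u x'" using cw[OF x'(1)] hw[OF x'(1)] x'(2) by simp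
        finally have "cnt (w @ v') x mod e = ((e - 1) * cnt u x' + cnt u x') mod e"
          using v'(2)[OF x'(1)] by (metis mod_add_right_eq)
        also have "(e - 1) * cnt u x' + cnt u x' = e * cnt u x'" using e_pos by (cases e) auto
        finally show ?thesis by (simp add: dvd_eq_mod_eq_0)
      qed
    qed (use v' w in auto)
    then show ?thesis by (simp add: lam_append)
  qed
  have "lam w (lam u z) = lam w (lam v z)" using vw[OF u _ z] vw[OF v eq z] by simp
  then show ?thesis using lam_inj[OF w(1) lam_closed[OF u z] lam_closed[OF v z]] by simp
qed

definition B :: "('a \<times> nat) set" where "B = X \<times> {..<e}"

text \<open>
  The structure group acts on \<open>X \<times> \<int>\<close> by permuting the first component and shifting
  the second one by the entry of the cocycle at the new position; \<open>T\<close> is this action modulo \<open>e\<close>. The permutation \<open>T w\<close> records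
  exactly the action of \<open>w\<close> on \<open>X\<close> and its cocycle modulo \<open>e\<close>.
\<close>

definition T :: "'a list \<Rightarrow> 'a \<times> nat \<Rightarrow> 'a \<times> nat" where
  "T w = restrict (\<lambda>(y, k). (lam w y, (k + cnt w (lam w y)) mod e)) B"

lemma T_apply: "y \<in> X \<Longrightarrow> k < e \<Longrightarrow> T w (y, k) = (lam w y, (k + cnt w (lam w y)) mod e)"
  by (simp add: T_def B_def)

lemma T_Bij: assumes w: "w \<in> lists X" shows "T w \<in> Bij B"
proof -
  have fB: "finite B" using fin by (simp add: B_def)
  have le: "k \<le> k'" if eq: "(k + c) mod e = (k' + c) mod e" and k: "k < e" for k c k' :: nat
  proof (rule ccontr)
    assume "\<not> k \<le> k'"
    then have "e dvd k - k'" "0 < k - k'" "k - k' < e"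
      using mod_eq_dvd_iff_nat[of "k' + c" "k + c" e] eq k by simp_all
    then show False using nat_dvd_not_less by blast
  qed
  have "inj_on (T w) B"
  proof (rule inj_onI)
    fix p q assume "p \<in> B" "q \<in> B" and eq: "T w p = T w q"
    then obtain y k y' k' where pq: "p = (y, k)" "q = (y', k')" "y \<in> X" "y' \<in> X" "k < e" "k' < e"
      by (auto simp: B_def)
    have yy: "y = y'" using eq pq lam_inj[OF w pq(3,4)] by (simp add: T_apply)
    then have "(k + cnt w (lam w y)) mod e = (k' + cnt w (lam w y)) mod e" using eq pq by (simp add: T_apply)
    then have "k = k'" using le[OF _ pq(5)] le[OF HOL.sym pq(6)] by (intro antisym)
    then show "p = q" using pq yy by simp
  qed
  moreover have "T w ` B \<subseteq> B" using lam_closed[OF w] e_pos by (auto simp: B_def T_apply)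
  ultimately have "bij_betw (T w) B B" using endo_inj_surj[OF fB] by (simp add: bij_betw_def)
  then show ?thesis by (simp add: Bij_def T_def)
qed

abbreviation P where "P \<equiv> BijGroup B"

lemma T_closed: "w \<in> lists X \<Longrightarrow> T w \<in> carrier P"
  using T_Bij by (simp add: BijGroup_def)

lemma T_append:
  assumes "u \<in> lists X" "v \<in> lists X"
  shows "T (u @ v) = T u \<otimes>\<^bsub>P\<^esub> T v"
proof -
  have "T (u @ v) = compose B (T u) (T v)"
  proof (rule extensionalityI[of _ B])
    fix p assume "p \<in> B"
    then obtain y k where p: "p = (y, k)" "y \<in> X" "k < e" by (auto simp: B_def)
    have v: "lam v y \<in> X" by (rule lam_closed[OF assms(2) p(2)])
    have "compose B (T u) (T v) p = T u (lam v y, (k + cnt v (lam v y)) mod e)"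
      using p by (simp add: compose_def T_apply B_def)
    also have "\<dots> = (lam u (lam v y), (k + cnt v (lam v y) + cnt u (lam u (lam v y))) mod e)"
      using v e_pos by (simp add: T_apply mod_add_left_eq)
    also have "\<dots> = T (u @ v) p"
      using p count_trace_append[OF assms v] by (simp add: T_apply lam_append add.assoc add.commute)
    finally show "T (u @ v) p = compose B (T u) (T v) p" by simp
  qed (auto simp: T_def)
  then show ?thesis using T_Bij assms by (simp add: BijGroup_def)
qed

lemma T_Nil: "T [] = \<one>\<^bsub>P\<^esub>"
  by (rule ext) (auto simp: T_def BijGroup_def B_def)

lemma T_eq_imp:
  assumes "u \<in> lists X" "v \<in> lists X" "T u = T v" "z \<in> X"
  shows "lam u z = lam v z" "cnt u z mod e = cnt v z mod e"
proof -
  have *: "lam u y = lam v y \<and> cnt u (lam u y) mod e = cnt v (lam u y) mod e" if "y \<in> X" for y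
    using fun_cong[OF assms(3), of "(y, 0)"] that e_pos by (auto simp: T_apply)
  then show "lam u z = lam v z" using assms(4) by blast
  obtain y where "y \<in> X" "lam u y = z" using lam_surj[OF assms(1,4)] by metis
  then show "cnt u z mod e = cnt v z mod e" using * by blast
qed

lemma T_eqI:
  assumes "u \<in> lists X" "v \<in> lists X" "\<And>z. z \<in> X \<Longrightarrow> cnt u z mod e = cnt v z mod e"
  shows "T u = T v"
proof (rule extensionalityI[of _ B])
  fix p assume "p \<in> B"
  then obtain y k where p: "p = (y, k)" "y \<in> X" "k < e" by (auto simp: B_def)
  have l: "lam u y = lam v y" by (rule lam_determined_by_counts[OF assms p(2)])
  have "cnt u (lam v y) mod e = cnt v (lam v y) mod e" by (rule assms(3)[OF lam_closed[OF assms(2) p(2)]])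
  then have "(k + cnt u (lam v y)) mod e = (k + cnt v (lam v y)) mod e" by (metis mod_add_right_eq)
  then show "T u p = T v p" using p l by (simp add: T_apply)
qed (auto simp: T_def)

text \<open>
  The group \<open>m \<int>\<^sup>X\<close> is invariant under permutations of \<open>X\<close>, so by the cocycle rule the elements with
  cocycle in it form a subgroup. Positive words reach all of them because the quotient is finite.
\<close>

definition H :: "nat \<Rightarrow> ('a \<times> nat \<Rightarrow> 'a \<times> nat) set" where
  "H m = {T w | w. w \<in> lists X \<and> (\<forall>z\<in>X. m dvd cnt w z)}"

interpretation P: group P by (rule group_BijGroup)

lemma finite_P: "finite (carrier P)"
proof -
  have "finite B" using fin by (simp add: B_def)
  moreover have "Bij B \<subseteq> B \<rightarrow>\<^sub>E B" using Bij_imp_funcset Bij_imp_extensional by (auto simp: PiE_def)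
  ultimately show ?thesis using finite_subset[of "Bij B" "B \<rightarrow>\<^sub>E B"] by (simp add: BijGroup_def finite_PiE)
qed

lemma H_subset: "H m \<subseteq> carrier P"
  using T_closed by (auto simp: H_def)

lemma finite_H: "finite (H m)"
  using finite_subset[OF H_subset finite_P] .

lemma H_subgroup: "subgroup (H m) P"
proof (rule P.finite_closed_imp_subgroup[OF finite_H H_subset])
  have "T [] \<in> H m" unfolding H_def by (rule CollectI, rule exI[of _ "[]"]) simp
  then show "H m \<noteq> {}" by blast
  fix s t assume "s \<in> H m" "t \<in> H m"
  then obtain u v where uv: "u \<in> lists X" "v \<in> lists X" "s = T u" "t = T v"
    "\<forall>z\<in>X. m dvd cnt u z" "\<forall>z\<in>X. m dvd cnt v z" by (auto simp: H_def)
  have "m dvd cnt (u @ v) z" if z: "z \<in> X" for z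
  proof -
    obtain y where y: "y \<in> X" "lam u y = z" using lam_surj[OF uv(1) z] by metis
    have "m dvd cnt u z" "m dvd cnt v y" using uv(5,6) z y(1) by blast+
    then show ?thesis using count_trace_append[OF uv(1,2) y(1)] by (simp only: y(2) dvd_add)
  qed
  moreover have "u @ v \<in> lists X" using uv(1,2) by simp
  ultimately have "T (u @ v) \<in> H m" unfolding H_def by blast
  then show "s \<otimes>\<^bsub>P\<^esub> t \<in> H m" by (simp only: T_append[OF uv(1,2)] uv(3,4))
qed

lemma H_mono:
  assumes "m dvd m'"
  shows "H m' \<subseteq> H m"
proof
  fix t assume "t \<in> H m'"
  then obtain w where "w \<in> lists X" "t = T w" "\<forall>z\<in>X. m' dvd cnt w z" by (auto simp: H_def)
  moreover from this have "\<forall>z\<in>X. m dvd cnt w z" using dvd_trans[OF assms] by blast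
  ultimately show "t \<in> H m" unfolding H_def by blast
qed

text \<open>
  By \<open>T_eqI\<close> and \<open>T_eq_imp\<close> an element of \<open>H m\<close> is the same as a cocycle modulo \<open>e\<close> with all entries
  divisible by \<open>m\<close>.
\<close>

lemma card_H:
  assumes m: "m dvd e"
  shows "card (H m) = (e div m) ^ card X"
proof -
  have mpos: "m > 0" using m e_pos by (auto intro: Nat.gr0I)
  have em: "m * (e div m) = e" using m by simp
  define W where "W = (\<lambda>b. SOME w. w \<in> lists X \<and> (\<forall>z\<in>X. cnt w z = m * b z))"
  have W: "W b \<in> lists X \<and> (\<forall>z\<in>X. cnt (W b) z = m * b z)" for b
  proof -
    obtain w where "w \<in> lists X" "\<And>z. z \<in> X \<Longrightarrow> cnt w z = m * b z"
      by (rule word_with_counts[of "\<lambda>z. m * b z"], rule that)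
    then have "\<exists>w. w \<in> lists X \<and> (\<forall>z\<in>X. cnt w z = m * b z)" by blast
    then show ?thesis unfolding W_def by (rule someI_ex)
  qed
  have "bij_betw (\<lambda>b. T (W b)) (X \<rightarrow>\<^sub>E {..<e div m}) (H m)"
    unfolding bij_betw_def
  proof
    show "inj_on (\<lambda>b. T (W b)) (X \<rightarrow>\<^sub>E {..<e div m})"
    proof (rule inj_onI)
      fix b b' assume b: "b \<in> X \<rightarrow>\<^sub>E {..<e div m}" "b' \<in> X \<rightarrow>\<^sub>E {..<e div m}" and eq: "T (W b) = T (W b')"
      show "b = b'"
      proof (rule PiE_ext[OF b])
        fix z assume z: "z \<in> X"
        have "m * b z mod e = m * b' z mod e"
          using T_eq_imp(2)[OF _ _ eq z] W z by simp
        moreover have "m * b z < m * (e div m)" "m * b' z < m * (e div m)"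
          using b z mpos by (auto simp: PiE_def)
        ultimately show "b z = b' z" using mpos unfolding em by simp
      qed
    qed
    show "(\<lambda>b. T (W b)) ` (X \<rightarrow>\<^sub>E {..<e div m}) = H m"
    proof (intro equalityI subsetI)
      fix t assume "t \<in> (\<lambda>b. T (W b)) ` (X \<rightarrow>\<^sub>E {..<e div m})"
      then obtain b where "t = T (W b)" by blast
      moreover have "\<forall>z\<in>X. m dvd cnt (W b) z" using W by simp
      ultimately show "t \<in> H m" using W unfolding H_def by blast
    next
      fix t assume "t \<in> H m"
      then obtain w where w: "w \<in> lists X" "t = T w" "\<forall>z\<in>X. m dvd cnt w z" by (auto simp: H_def)
      define b where "b = (\<lambda>z\<in>X. (cnt w z mod e) div m)"
      have "b \<in> X \<rightarrow>\<^sub>E {..<e div m}"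
      proof (rule PiE_I)
        fix z assume z: "z \<in> X"
        have "cnt w z mod e < m * (e div m)" using e_pos unfolding em by simp
        then show "b z \<in> {..<e div m}"
          using z by (simp add: b_def less_mult_imp_div_less mult.commute)
      qed (simp add: b_def)
      moreover have "T (W b) = T w"
      proof (rule T_eqI)
        fix z assume z: "z \<in> X"
        have "m dvd cnt w z mod e" using w(3) z m by (simp add: dvd_mod)
        then have "m * b z = cnt w z mod e" using z by (simp add: b_def)
        then show "cnt (W b) z mod e = cnt w z mod e" using W z by simp
      qed (use W w in auto)
      ultimately show "t \<in> (\<lambda>b. T (W b)) ` (X \<rightarrow>\<^sub>E {..<e div m})"
        using w(2) by (intro image_eqI[of _ _ b]) simp_all
    qed
  qed
  then have "card (X \<rightarrow>\<^sub>E {..<e div m}) = card (H m)" by (rule bij_betw_same_card)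
  moreover have "card (X \<rightarrow>\<^sub>E {..<e div m}) = (e div m) ^ card X" using fin by (simp add: card_PiE)
  ultimately show ?thesis by (simp only:)
qed

end

lemma two_or_three_primes:
  fixes n :: nat
  assumes "n > 0"
  obtains p q i j where "prime p" "prime q" "n = p ^ i * q ^ j"
  | p q r where "prime p" "prime q" "prime r" "p \<noteq> q" "p \<noteq> r" "q \<noteq> r" "p dvd n" "q dvd n" "r dvd n"
proof -
  have split: "\<exists>i m. n = s ^ i * m \<and> \<not> s dvd m \<and> m > 0" if n: "n > 0" and s: "prime s" for s n :: nat
  proof -
    have "\<not> is_unit s" "n \<noteq> 0" using n s by auto
    then obtain m where m: "n = s ^ multiplicity s n * m" "\<not> s dvd m"
      using multiplicity_decompose'[of n s] by metis
    moreover have "m > 0" using m(2) by (cases m) auto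
    ultimately show ?thesis by blast
  qed
  show thesis
  proof (cases "n = 1")
    case True
    then show thesis using that(1)[of 2 2 0 0] by simp
  next
    case False
    then obtain p where p: "prime p" "p dvd n" using prime_factor_nat by blast
    obtain i m where m: "n = p ^ i * m" "\<not> p dvd m" "m > 0" using split[OF assms p(1)] by blast
    show thesis
    proof (cases "m = 1")
      case True
      then show thesis using that(1)[of p p i 0] p m by simp
    next
      case False
      then obtain q where q: "prime q" "q dvd m" using prime_factor_nat by blast
      obtain j l where l: "m = q ^ j * l" "\<not> q dvd l" "l > 0" using split[OF m(3) q(1)] by blast
      show thesis
      proof (cases "l = 1")
        case True
        then show thesis using that(1)[of p q i j] p q m l by simp
      next
        case False
        then obtain r where r: "prime r" "r dvd l" using prime_factor_nat by blast
        have "r dvd m" using r(2) l(1) by simp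
        moreover have "p \<noteq> q" using q(2) m(2) by blast
        moreover have "p \<noteq> r" using \<open>r dvd m\<close> m(2) by blast
        moreover have "q \<noteq> r" using r(2) l(2) by blast
        moreover have "q dvd n" "r dvd n" using q(2) \<open>r dvd m\<close> m(1) by simp_all
        ultimately show thesis using that(2)[of p q r] p q(1) r(1) by blast
      qed
    qed
  qed
qed

context symmetric_solution_period
begin

interpretation P: group P by (rule group_BijGroup)

text \<open>
  Induction on \<open>e div m\<close>. With at most two primes in \<open>e div m\<close>, Burnside's theorem applies. Otherwise
  \<open>H (m * s)\<close> has index \<open>s ^ card X\<close> in \<open>H m\<close> for every prime \<open>s\<close> dividing \<open>e div m\<close>, so three primes
  give a triple for Wielandt's theorem.
\<close>

lemma H_solvable:
  assumes "m dvd e"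
  shows "solvable (P\<lparr>carrier := H m\<rparr>)"
  using assms
proof (induction "e div m" arbitrary: m rule: less_induct)
  case less
  let ?M = "P\<lparr>carrier := H m\<rparr>" and ?n = "card X"
  interpret M: group ?M by (rule P.subgroup_imp_group[OF H_subgroup])
  have finM: "finite (carrier ?M)" using finite_H by simp
  obtain c where "e = m * c" using less.prems by (rule dvdE)
  then have N0: "e div m > 0" using e_pos by auto
  have ordM: "Coset.order ?M = (e div m) ^ ?n" using card_H[OF less.prems] by (simp add: Coset.order_def)
  from N0 show ?case
  proof (cases rule: two_or_three_primes)
    case (1 p q i j)
    have "Coset.order ?M = p ^ (i * ?n) * q ^ (j * ?n)"
      unfolding ordM 1(3) by (simp add: power_mult_distrib power_mult)
    then show ?thesis using M.two_prime_order_solvable[OF finM 1(1,2)] by blast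
  next
    case (2 p q r)
    have sub: "subgroup (H (m * s)) ?M \<and> solvable_seq ?M (H (m * s)) \<and>
        Coset.order ?M = s ^ ?n * card (H (m * s))"
      if s: "prime s" "s dvd e div m" for s
    proof -
      have ms: "m * s dvd e" using less.prems s(2) by (metis dvd_mult_div_cancel mult_dvd_mono dvd_refl)
      have quot: "e div m = s * (e div (m * s))" using s(2) by (simp add: div_mult2_eq)
      have "e div (m * s) > 0" using quot N0 by (metis mult_0_right neq0_conv)
      then have lt: "e div (m * s) < e div m" unfolding quot using prime_gt_1_nat[OF s(1)] by simp
      have J: "subgroup (H (m * s)) ?M"
        by (rule P.subgroup_incl[OF H_subgroup H_subgroup H_mono]) simp
      have "solvable (P\<lparr>carrier := H (m * s)\<rparr>)" by (rule less.hyps[OF lt ms])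
      then have "solvable_seq ?M (H (m * s))" using M.solvable_subgroup_iff[OF J] by simp
      moreover have "Coset.order ?M = s ^ ?n * card (H (m * s))"
        unfolding ordM card_H[OF ms] quot by (rule power_mult_distrib)
      ultimately show ?thesis using J by blast
    qed
    have cop: "coprime (s ^ ?n) (t ^ ?n)" if "prime s" "prime t" "s \<noteq> t" for s t :: nat
      using primes_coprime[OF that] by simp
    have "coprime_solvable_triple ?M"
      unfolding coprime_solvable_triple_def
      using sub[OF 2(1,7)] sub[OF 2(2,8)] sub[OF 2(3,9)] cop[OF 2(1,2,4)] cop[OF 2(1,3,5)] cop[OF 2(2,3,6)]
      by blast
    then show ?thesis by (rule M.coprime_solvable_triple_imp_solvable[OF finM])
  qed
qed

section \<open>The structure group\<close>

abbreviation GX where "GX \<equiv> structure_group X S"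
abbreviation cl where "cl w \<equiv> pres_cong X R `` {w}"

lemma R_words: "R \<subseteq> group_words X \<times> group_words X"
  using g_closed f_closed by (auto simp: structure_relations_def group_words_def S_eq)

interpretation GX: group GX
  by (rule group_structure_group[OF bij_S])

lemma cl_append:
  "u \<in> group_words X \<Longrightarrow> v \<in> group_words X \<Longrightarrow> cl u \<otimes>\<^bsub>GX\<^esub> cl v = cl (u @ v)"
  unfolding structure_group_def by (rule presented_group_mult[OF R_words])

lemma cl_closed: "w \<in> group_words X \<Longrightarrow> cl w \<in> carrier GX"
  by (auto simp: structure_group_def presented_group_def intro: quotientI)

lemma cl_Nil: "cl [] = \<one>\<^bsub>GX\<^esub>"
  by (simp add: structure_group_def presented_group_def)

lemma cl_eqI: "(u, v) \<in> pres_cong X R \<Longrightarrow> cl u = cl v"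
  by (rule equiv_class_eq[OF equiv_pres_cong[OF R_words]])

lemma cl_pos_append:
  "u \<in> lists X \<Longrightarrow> v \<in> lists X \<Longrightarrow> cl (pos u) \<otimes>\<^bsub>GX\<^esub> cl (pos v) = cl (pos (u @ v))"
  using cl_append[OF pos_words pos_words] by simp

lemma cl_pos_closed: "w \<in> lists X \<Longrightarrow> cl (pos w) \<in> carrier GX"
  by (rule cl_closed[OF pos_words])

lemma cl_pos_eqI:
  assumes "u \<in> lists X" "v \<in> lists X" "mset (trace u) = mset (trace v)"
  shows "cl (pos u) = cl (pos v)"
  using equal_pos_if_mset_trace_eq[OF assms] cl_eqI unfolding equal_pos_def by blast

text \<open>
  If both words act trivially, the traces of \<open>u v\<close> and \<open>v u\<close> are just the concatenations of the traces.
\<close>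

lemma cl_pos_commute_if_lam_trivial:
  assumes "u \<in> lists X" "v \<in> lists X" "\<And>z. z \<in> X \<Longrightarrow> lam u z = z" "\<And>z. z \<in> X \<Longrightarrow> lam v z = z"
  shows "cl (pos u) \<otimes>\<^bsub>GX\<^esub> cl (pos v) = cl (pos v) \<otimes>\<^bsub>GX\<^esub> cl (pos u)"
proof -
  have triv: "map (lam u) (trace v) = trace v" "map (lam v) (trace u) = trace u"
    using assms(3,4) subsetD[OF trace_closed[OF assms(1)]] subsetD[OF trace_closed[OF assms(2)]]
    by (auto intro: map_idI)
  have "cl (pos (u @ v)) = cl (pos (v @ u))"
    by (rule cl_pos_eqI) (use assms(1,2) in \<open>auto simp: trace_append triv\<close>)
  then show ?thesis using assms(1,2) by (simp only: cl_pos_append)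
qed

text \<open>
  The word \<open>\<Delta>\<close> has every element of \<open>X\<close> exactly \<open>e\<close> times in its trace. It acts trivially, and as its cocycle is invariant
  under permutations of \<open>X\<close>, the words \<open>w \<Delta>\<close> and \<open>\<Delta> w\<close> have the same cocycle. Each letter divides \<open>\<Delta>\<close>
  because it occurs in the trace.
\<close>

lemma garside_element:
  obtains \<Delta> where "\<Delta> \<in> lists X" "\<And>z. z \<in> X \<Longrightarrow> lam \<Delta> z = z" "T \<Delta> = \<one>\<^bsub>P\<^esub>"
    "\<And>w. w \<in> lists X \<Longrightarrow> cl (pos w) \<otimes>\<^bsub>GX\<^esub> cl (pos \<Delta>) = cl (pos \<Delta>) \<otimes>\<^bsub>GX\<^esub> cl (pos w)"
    "\<And>x. x \<in> X \<Longrightarrow> \<exists>s\<in>lists X. cl (pos \<Delta>) = cl (pos (x # s))"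
proof -
  obtain \<Delta> where \<Delta>: "\<Delta> \<in> lists X" "\<And>z. z \<in> X \<Longrightarrow> cnt \<Delta> z = e"
    by (rule word_with_counts[of "\<lambda>_. e"], rule that)
  have lam: "lam \<Delta> z = z" if "z \<in> X" for z by (rule lam_trivial[OF \<Delta>(1) _ that]) (simp add: \<Delta>(2))
  have T: "T \<Delta> = \<one>\<^bsub>P\<^esub>" unfolding T_Nil[symmetric] by (rule T_eqI) (use \<Delta> in auto)
  have central: "cl (pos w) \<otimes>\<^bsub>GX\<^esub> cl (pos \<Delta>) = cl (pos \<Delta>) \<otimes>\<^bsub>GX\<^esub> cl (pos w)" if w: "w \<in> lists X" for w
  proof -
    have "mset (trace (w @ \<Delta>)) = mset (trace (\<Delta> @ w))"
    proof (rule multiset_eqI)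
      fix z
      show "cnt (w @ \<Delta>) z = cnt (\<Delta> @ w) z"
      proof (cases "z \<in> X")
        case True
        obtain y where y: "y \<in> X" "lam w y = z" using lam_surj[OF w True] by metis
        have "cnt (w @ \<Delta>) z = cnt w z + e"
          using count_trace_append[OF w \<Delta>(1) y(1)] unfolding y(2) \<Delta>(2)[OF y(1)] .
        moreover have "cnt (\<Delta> @ w) z = e + cnt w z"
          using count_trace_append[OF \<Delta>(1) w True] unfolding lam[OF True] \<Delta>(2)[OF True] .
        ultimately show ?thesis by simp
      next
        case False
        then show ?thesis using w \<Delta>(1) by (simp add: count_trace_outside)
      qed
    qed
    then have "cl (pos (w @ \<Delta>)) = cl (pos (\<Delta> @ w))" by (intro cl_pos_eqI) (use w \<Delta>(1) in auto)
    then show ?thesis using w \<Delta>(1) by (simp only: cl_pos_append)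
  qed
  have divisor: "\<exists>s\<in>lists X. cl (pos \<Delta>) = cl (pos (x # s))" if x: "x \<in> X" for x
  proof -
    have "x \<in># mset (trace \<Delta>)" using \<Delta>(2)[OF x] e_pos by (metis count_greater_zero_iff)
    then have "x \<in> set (trace \<Delta>)" by simp
    then obtain s where s: "equal_pos \<Delta> (x # s)" using equal_pos_pull_letter[OF \<Delta>(1)] by blast
    then have "x # s \<in> lists X" "(pos \<Delta>, pos (x # s)) \<in> pres_cong X R" unfolding equal_pos_def by blast+
    then have "s \<in> lists X" "cl (pos \<Delta>) = cl (pos (x # s))" using cl_eqI by auto
    then show ?thesis by blast
  qed
  show thesis by (rule that[OF \<Delta>(1) lam T central divisor])
qed

text \<open>
  A power of the central element \<open>\<Delta>\<close> absorbs all inverse letters of a word: writing \<open>\<Delta> = x s\<close>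
  gives \<open>x\<inverse> \<Delta> = s\<close>.
\<close>

lemma positive_multiple:
  assumes \<Delta>: "\<Delta> \<in> lists X"
    and central: "\<And>w. w \<in> lists X \<Longrightarrow> cl (pos w) \<otimes>\<^bsub>GX\<^esub> cl (pos \<Delta>) = cl (pos \<Delta>) \<otimes>\<^bsub>GX\<^esub> cl (pos w)"
    and divisor: "\<And>x. x \<in> X \<Longrightarrow> \<exists>s\<in>lists X. cl (pos \<Delta>) = cl (pos (x # s))"
    and u: "u \<in> group_words X"
  shows "\<exists>k::nat. \<exists>w\<in>lists X. cl u \<otimes>\<^bsub>GX\<^esub> cl (pos \<Delta>) [^]\<^bsub>GX\<^esub> k = cl (pos w)"
  using u
proof (induction u rule: list.induct)
  case Nil
  have "cl [] \<otimes>\<^bsub>GX\<^esub> cl (pos \<Delta>) [^]\<^bsub>GX\<^esub> (0::nat) = cl (pos [])" by (simp add: cl_Nil)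
  then show ?case by (intro exI[of _ 0] bexI[of _ "[]"]) simp_all
next
  case (Cons y v)
  obtain x b where y: "y = (x, b)" by force
  have x: "x \<in> X" and v: "v \<in> group_words X" using Cons.prems by (auto simp: y group_words_def)
  have xb: "[(x, b)] \<in> group_words X" for b using x by (simp add: group_words_def)
  let ?\<delta> = "cl (pos \<Delta>)"
  have \<delta>: "?\<delta> \<in> carrier GX" by (rule cl_pos_closed[OF \<Delta>])
  obtain k w where w: "w \<in> lists X" "cl v \<otimes>\<^bsub>GX\<^esub> ?\<delta> [^]\<^bsub>GX\<^esub> (k::nat) = cl (pos w)"
    using Cons.IH[OF v] by blast
  have first: "cl (y # v) \<otimes>\<^bsub>GX\<^esub> ?\<delta> [^]\<^bsub>GX\<^esub> k = cl [(x, b)] \<otimes>\<^bsub>GX\<^esub> cl (pos w)"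
    unfolding w(2)[symmetric] using cl_append[OF xb v, of b] cl_closed[OF xb] cl_closed[OF v] \<delta>
    by (simp add: y GX.m_assoc[symmetric])
  show ?case
  proof (cases b)
    case True
    have "cl [(x, b)] \<otimes>\<^bsub>GX\<^esub> cl (pos w) = cl (pos (x # w))"
      using cl_append[OF xb pos_words[OF w(1)], of b] True by simp
    then show ?thesis using first x w(1) by (intro exI[of _ k] bexI[of _ "x # w"]) simp_all
  next
    case False
    obtain s where s: "s \<in> lists X" "?\<delta> = cl (pos (x # s))" using divisor[OF x] by blast
    have "cl (y # v) \<otimes>\<^bsub>GX\<^esub> ?\<delta> [^]\<^bsub>GX\<^esub> Suc k = (cl [(x, b)] \<otimes>\<^bsub>GX\<^esub> cl (pos w)) \<otimes>\<^bsub>GX\<^esub> ?\<delta>"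
      unfolding first[symmetric] using \<delta> cl_closed[OF Cons.prems] by (simp add: GX.m_assoc)
    also have "\<dots> = cl [(x, b)] \<otimes>\<^bsub>GX\<^esub> (?\<delta> \<otimes>\<^bsub>GX\<^esub> cl (pos w))"
      using central[OF w(1)] \<delta> cl_closed[OF xb] cl_pos_closed[OF w(1)] by (simp add: GX.m_assoc)
    also have "\<dots> = cl ([(x, b), (x, \<not> b)] @ pos (s @ w))"
    proof -
      have xs: "x # s \<in> lists X" and xsw: "x # s @ w \<in> lists X" using x s(1) w(1) by simp_all
      have "?\<delta> \<otimes>\<^bsub>GX\<^esub> cl (pos w) = cl (pos (x # s @ w))"
        unfolding s(2) cl_pos_append[OF xs w(1)] by simp
      then show ?thesis using cl_append[OF xb pos_words[OF xsw], of b] False by simp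
    qed
    also have "\<dots> = cl ([] @ pos (s @ w))"
      by (rule cl_eqI, rule pres_cong.append[OF pres_cong.cancel[OF x] pres_cong.refl[OF pos_words]])
        (use s(1) w(1) in simp)
    finally show ?thesis using s(1) w(1) by (intro exI[of _ "Suc k"] bexI[of _ "s @ w"]) simp_all
  qed
qed

text \<open>
  The letters act by \<open>T\<close>, which extends to a homomorphism \<open>\<phi>\<close> onto the solvable group \<open>H 1\<close>. The
  kernel is commutative: multiplied with suitable powers of the central \<open>\<Delta>\<close>, which themselves lie in the kernel, its
  elements become positive words acting trivially on \<open>X\<close>, and those commute.
\<close>

theorem structure_group_solvable: "solvable GX"
proof -
  let ?a = "\<lambda>x. T [x]"
  have val: "word_value P ?a (pos w) = T w" if "w \<in> lists X" for w
    using that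
  proof (induction w rule: list.induct)
    case (Cons x w)
    then show ?case using T_append[of "[x]" w] by simp
  qed (simp add: T_Nil)
  have rel: "word_value P ?a u = word_value P ?a v" if uv: "(u, v) \<in> R" for u v
  proof -
    obtain x y where xy: "x \<in> X" "y \<in> X" "u = pos [x, y]" "v = pos [g x y, f y x]"
      using uv by (auto simp: structure_relations_def S_eq)
    have "T [x, y] = T [g x y, f y x]"
      using xy equal_pos_swap[OF xy(1,2), of "[]"] by (intro T_eqI) (simp_all add: equal_pos_def)
    then show ?thesis
      using val[of "[x, y]"] val[of "[g x y, f y x]"] xy g_closed f_closed by simp
  qed
  obtain \<phi> where \<phi>: "group_hom (presented_group X R) P \<phi>" "\<And>w. w \<in> group_words X \<Longrightarrow> \<phi> (cl w) = word_value P ?a w"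
  proof (rule presented_group_hom[where a = ?a, OF R_words group_BijGroup])
    show "T [x] \<in> carrier P" if "x \<in> X" for x by (rule T_closed) (use that in simp)
    show "word_value P ?a u = word_value P ?a v" if "(u, v) \<in> R" for u v by (rule rel[OF that])
  qed (rule that)
  interpret \<phi>: group_hom GX P \<phi> using \<phi>(1) by (simp only: structure_group_def)
  have \<phi>_pos: "\<phi> (cl (pos w)) = T w" if "w \<in> lists X" for w
    using \<phi>(2)[OF pos_words[OF that]] val[OF that] by simp
  have rep: "\<exists>u\<in>group_words X. A = cl u" if "A \<in> carrier GX" for A
    using that by (auto simp: structure_group_def presented_group_def elim: quotientE)
  obtain \<Delta> where \<Delta>: "\<Delta> \<in> lists X" "\<And>z. z \<in> X \<Longrightarrow> lam \<Delta> z = z" "T \<Delta> = \<one>\<^bsub>P\<^esub>"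
    "\<And>w. w \<in> lists X \<Longrightarrow> cl (pos w) \<otimes>\<^bsub>GX\<^esub> cl (pos \<Delta>) = cl (pos \<Delta>) \<otimes>\<^bsub>GX\<^esub> cl (pos w)"
    "\<And>x. x \<in> X \<Longrightarrow> \<exists>s\<in>lists X. cl (pos \<Delta>) = cl (pos (x # s))"
    by (rule garside_element, rule that)
  let ?\<delta> = "cl (pos \<Delta>)"
  have \<delta>: "?\<delta> \<in> carrier GX" "\<phi> ?\<delta> = \<one>\<^bsub>P\<^esub>"
    using cl_pos_closed[OF \<Delta>(1)] \<phi>_pos[OF \<Delta>(1)] \<Delta>(3) by simp_all
  have mult: "\<exists>k::nat. \<exists>w\<in>lists X. A \<otimes>\<^bsub>GX\<^esub> ?\<delta> [^]\<^bsub>GX\<^esub> k = cl (pos w)" if "A \<in> carrier GX" for A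
    using rep[OF that] positive_multiple[OF \<Delta>(1,4,5)] by blast
  have image: "\<phi> ` carrier GX = H 1"
  proof (intro equalityI subsetI)
    fix t assume "t \<in> \<phi> ` carrier GX"
    then obtain A where A: "A \<in> carrier GX" "t = \<phi> A" by blast
    obtain k w where w: "w \<in> lists X" "A \<otimes>\<^bsub>GX\<^esub> ?\<delta> [^]\<^bsub>GX\<^esub> (k::nat) = cl (pos w)"
      using mult[OF A(1)] by blast
    have "\<phi> (A \<otimes>\<^bsub>GX\<^esub> ?\<delta> [^]\<^bsub>GX\<^esub> k) = t" using A \<delta> by (simp add: \<phi>.hom_nat_pow)
    then have "t = T w" using w \<phi>_pos by simp
    then show "t \<in> H 1" using w(1) by (auto simp: H_def)
  next
    fix t assume "t \<in> H 1"
    then obtain w where "w \<in> lists X" "t = T w" by (auto simp: H_def)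
    then show "t \<in> \<phi> ` carrier GX" using \<phi>_pos cl_pos_closed by (metis imageI)
  qed
  let ?K = "kernel GX P \<phi>"
  have comm: "A \<otimes>\<^bsub>GX\<^esub> A' = A' \<otimes>\<^bsub>GX\<^esub> A" if "A \<in> ?K" "A' \<in> ?K" for A A'
  proof -
    have A: "A \<in> carrier GX" "\<phi> A = \<one>\<^bsub>P\<^esub>" "A' \<in> carrier GX" "\<phi> A' = \<one>\<^bsub>P\<^esub>"
      using that by (auto simp: kernel_def)
    obtain k w where w: "w \<in> lists X" "A \<otimes>\<^bsub>GX\<^esub> ?\<delta> [^]\<^bsub>GX\<^esub> (k::nat) = cl (pos w)"
      using mult[OF A(1)] by blast
    obtain l v where v: "v \<in> lists X" "A' \<otimes>\<^bsub>GX\<^esub> ?\<delta> [^]\<^bsub>GX\<^esub> (l::nat) = cl (pos v)"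
      using mult[OF A(3)] by blast
    have lam: "lam u z = z" if "u \<in> lists X" "B \<otimes>\<^bsub>GX\<^esub> ?\<delta> [^]\<^bsub>GX\<^esub> (i::nat) = cl (pos u)"
      "B \<in> carrier GX" "\<phi> B = \<one>\<^bsub>P\<^esub>" "z \<in> X" for u B i z
    proof -
      have "\<phi> (B \<otimes>\<^bsub>GX\<^esub> ?\<delta> [^]\<^bsub>GX\<^esub> i) = \<one>\<^bsub>P\<^esub>" using that(3,4) \<delta> by (simp add: \<phi>.hom_nat_pow)
      then have "T u = T []" using that(1,2) \<phi>_pos by (simp add: T_Nil)
      then show ?thesis using T_eq_imp(1)[OF that(1) _ _ that(5), of "[]"] by simp
    qed
    have \<delta>_comm: "cl (pos u) \<otimes>\<^bsub>GX\<^esub> ?\<delta> [^]\<^bsub>GX\<^esub> i = ?\<delta> [^]\<^bsub>GX\<^esub> i \<otimes>\<^bsub>GX\<^esub> cl (pos u)"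
      if "u \<in> lists X" for u and i :: nat
      using GX.group_commutes_pow[OF \<Delta>(4)[OF that, symmetric] \<delta>(1) cl_pos_closed[OF that], of i] by simp
    let ?c = "?\<delta> [^]\<^bsub>GX\<^esub> k" and ?d = "?\<delta> [^]\<^bsub>GX\<^esub> l" and ?w = "cl (pos w)" and ?v = "cl (pos v)"
    have car: "?c \<in> carrier GX" "?d \<in> carrier GX" "?w \<in> carrier GX" "?v \<in> carrier GX"
      using \<delta> cl_pos_closed w(1) v(1) by simp_all
    have wv: "?w \<otimes>\<^bsub>GX\<^esub> ?v = ?v \<otimes>\<^bsub>GX\<^esub> ?w"
      by (rule cl_pos_commute_if_lam_trivial[OF w(1) v(1) lam[OF w A(1,2)] lam[OF v A(3,4)]])
    have prod: "(B \<otimes>\<^bsub>GX\<^esub> C) \<otimes>\<^bsub>GX\<^esub> (?\<delta> [^]\<^bsub>GX\<^esub> (i + j)) = cl (pos u) \<otimes>\<^bsub>GX\<^esub> cl (pos t)"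
      if "u \<in> lists X" "t \<in> lists X" "B \<in> carrier GX" "C \<in> carrier GX"
        "B \<otimes>\<^bsub>GX\<^esub> ?\<delta> [^]\<^bsub>GX\<^esub> i = cl (pos u)" "C \<otimes>\<^bsub>GX\<^esub> ?\<delta> [^]\<^bsub>GX\<^esub> j = cl (pos t)"
      for B C u t and i j :: nat
    proof -
      let ?i = "?\<delta> [^]\<^bsub>GX\<^esub> i" and ?j = "?\<delta> [^]\<^bsub>GX\<^esub> j"
      have ij: "?i \<in> carrier GX" "?j \<in> carrier GX" using \<delta> by simp_all
      have "cl (pos u) \<otimes>\<^bsub>GX\<^esub> cl (pos t) = B \<otimes>\<^bsub>GX\<^esub> (?i \<otimes>\<^bsub>GX\<^esub> cl (pos t))"
        unfolding that(5)[symmetric] using that(3) ij cl_pos_closed[OF that(2)] by (simp add: GX.m_assoc)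
      also have "\<dots> = B \<otimes>\<^bsub>GX\<^esub> (cl (pos t) \<otimes>\<^bsub>GX\<^esub> ?i)" by (simp only: \<delta>_comm[OF that(2)])
      also have "\<dots> = (B \<otimes>\<^bsub>GX\<^esub> C) \<otimes>\<^bsub>GX\<^esub> (?j \<otimes>\<^bsub>GX\<^esub> ?i)"
        unfolding that(6)[symmetric] using that(3,4) ij by (simp add: GX.m_assoc)
      also have "?j \<otimes>\<^bsub>GX\<^esub> ?i = ?\<delta> [^]\<^bsub>GX\<^esub> (i + j)"
        using GX.nat_pow_mult[OF \<delta>(1), of j i] by (simp add: add.commute)
      finally show ?thesis by simp
    qed
    have "(A \<otimes>\<^bsub>GX\<^esub> A') \<otimes>\<^bsub>GX\<^esub> (?\<delta> [^]\<^bsub>GX\<^esub> (k + l)) = (A' \<otimes>\<^bsub>GX\<^esub> A) \<otimes>\<^bsub>GX\<^esub> (?\<delta> [^]\<^bsub>GX\<^esub> (k + l))"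
      using prod[OF w(1) v(1) A(1,3) w(2) v(2)] prod[OF v(1) w(1) A(3,1) v(2) w(2)] wv
      by (simp only: add.commute)
    then show ?thesis using A(1,3) \<delta>(1) by simp
  qed
  have subK: "subgroup ?K GX" by (rule \<phi>.subgroup_kernel)
  have "solvable (GX\<lparr>carrier := ?K\<rparr>)"
    using group.solvable_if_commutative[OF GX.subgroup_imp_group[OF subK]] comm by simp
  then have solvK: "solvable_seq GX ?K" using GX.solvable_subgroup_iff[OF subK] by blast
  interpret \<psi>: group_hom GX "P\<lparr>carrier := H 1\<rparr>" \<phi>
    using \<phi>.homh image P.subgroup_imp_group[OF H_subgroup]
    by (auto simp: group_hom_def group_hom_axioms_def hom_def GX.is_group)
  have "kernel GX (P\<lparr>carrier := H 1\<rparr>) \<phi> = ?K" by (simp add: kernel_def)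
  then show ?thesis
    using \<psi>.solvable_if_kernel_and_image solvK image H_solvable[of 1] by simp
qed

end

theorem theorem2p14:
  fixes X :: "'a set" and S :: "'a \<times> 'a \<Rightarrow> 'a \<times> 'a"
  assumes "X \<noteq> {}"
    and "finite X"
    and "bij_betw S (X \<times> X) (X \<times> X)"
    and "nondegenerate X S"
    and "symmetric_set X S"
  shows "solvable (structure_group X S)"
proof -
  interpret symmetric_solution X S by unfold_locales (use assms in auto)
  obtain e where "e > 0"
    "\<And>x. x \<in> X \<Longrightarrow> \<exists>w\<in>lists X. trace w = replicate e x \<and> (\<forall>z\<in>X. lam w z = z)"
    by (rule common_period, rule that)
  then interpret symmetric_solution_period X S e by unfold_locales
  show ?thesis by (rule structure_group_solvable)
qed

end
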